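(* Let $f$ and $A_0$ be as in the context and, for $\rho>0$, let $\mathcal S(\varphi,\psi)=(\varphi+\rho f(\varphi,\psi),A_0\psi)$ and $\overline{\mathcal S}(\varphi,\psi)=(\varphi+\rho\overline f(\varphi),A_0\psi)$, with $\overline f(\varphi)=\langle f(\varphi,\cdot)\rangle$. Let $W$ describe the invariant manifold of $\mathcal S$. There exists $\rho_*>0$ such that for any $\gamma'\in(0,\gamma)$ there is a constant $C_8$, independent of $\rho$, such that for all $\rho\in(0,\rho_* )$, all $n\in\mathbb N$ and all $\varphi\in\mathcal U$ $$\Bigl|\bigl\langle(\mathcal S^n)_\varphi(\varphi,\cdot)-\bigl((\overline{\mathcal S}^n)_\varphi(\varphi,\cdot)+W(A_0^n\cdot)\bigr)\bigr\rangle\Bigr|\le C_8\,\rho\,(1-\rho\gamma')^n,$$ $$\Bigl\langle\bigl((\mathcal S^n)_\varphi(\varphi,\cdot)-\bigl((\overline{\mathcal S}^n)_\varphi(\varphi,\cdot)+W(A_0^n\cdot)\bigr)\bigr)^2\Bigr\rangle\le C_8\,\rho\,(1-\rho\gamma')^{2n}.$$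
   Context: $\mathbb T=\mathbb R/2\pi\mathbb Z$. $A_0$ is an Anosov (hyperbolic linear) automorphism of $\mathbb T^2$. $\langle g\rangle=\int_{\mathbb T^2}g(\psi)\,d\psi/(2\pi)^2$. The subscript $\varphi$ denotes the first component of a map. For $\alpha\in(0,1]$, $k\ge1$, and $g(\varphi,\psi)$ on $\mathbb T\times\mathbb T^2$: $|g|_\alpha=\sup|g(\varphi,\psi')-g(\varphi,\psi)|/|\psi'-\psi|^\alpha$, and $\mathscr B_{\alpha,k}$ is the space of functions $k$ times continuously differentiable in $\varphi$ with $|||g|||_{\alpha,k}=\sum_{n=0}^k\|\partial_\varphi^ng\|_\infty+\alpha\sum_{n=0}^{k-1}|\partial_\varphi^ng|_\alpha<\infty$. Standing assumptions: $f\in\mathscr B_{\alpha_0,6}(\mathbb T\times\mathbb T^2,\mathbb R)$ for some $\alpha_0\in(0,1]$, $|||f|||_{\alpha_0,6}=1$; there is a closed interval $\mathcal U=[\phi_m,\phi_M]\subsetneq\mathbb T$, $\phi_m<\phi_M$ (identified with an interval of $\mathbb R$), with $\Omega=\mathcal U\times\mathbb T^2$, such that $f(\phi_m,\psi)>0>f(\phi_M,\psi)$ for all $\psi$; for every $\psi$ there is a unique $S(\psi)\in\operatorname{int}\mathcal U$ with $f(S(\psi),\psi)=0$; with $S_m=\inf_\psi S$, $S_M=\sup_\psi S$, $\Lambda=[S_m,S_M]\times\mathbb T^2$, one has $\gamma:=-\sup_{\Lambda}\partial_\varphi f>0$. The parametrization of $\mathbb T$ is such that $0\in[S_m,S_M]$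 is the unique zero of $\overline f$ in $\mathcal U$. The parameter $\rho$ is taken smaller than a suitable $\rho_*>0$ depending on $f$, such that in particular $1+\rho\,\partial_\varphi f>0$ on $\Omega$. Then $\mathcal S$ and $\overline{\mathcal S}$ map $\Omega$ into itself (as a subset of $\mathbb R\times\mathbb T^2$), and there is a unique $W:\mathbb T^2\to\mathbb R$ with graph in $\Lambda$ such that $\mathcal S(W(\psi),\psi)=(W(A_0\psi),A_0\psi)$ for all $\psi$. *)

theory Defs
  imports "HOL-Analysis.Analysis"
begin

(* The tori T = R/2piZ and T^2 are handled through lifts: a function on T x T^2 is a function on
   R x R^2 that is 2pi-periodic in every coordinate, and a function on T^2 is a function on R^2
   that is 2pi-periodic in both coordinates. *)

definition torus_periodic :: "(real^2 \<Rightarrow> 'b) \<Rightarrow> bool" where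
  "torus_periodic g \<longleftrightarrow> (\<forall>\<psi> i. g (\<psi> + axis i (2 * pi)) = g \<psi>)"

definition torus_mean :: "(real^2 \<Rightarrow> real) \<Rightarrow> real" where
  "torus_mean g =
     set_lebesgue_integral lborel (cbox 0 (vec (2 * pi))) g / (2 * pi)\<^sup>2"

(* Lift of a hyperbolic linear automorphism of T^2.  Hyperbolicity refers to all complex
   eigenvalues, hence the complexified matrix. *)
definition anosov_automorphism :: "real^2^2 \<Rightarrow> bool" where
  "anosov_automorphism A \<longleftrightarrow>
     (\<forall>i j. A $ i $ j \<in> \<int>) \<and> \<bar>det A\<bar> = 1 \<and>
     (\<forall>(\<mu>::complex) v. v \<noteq> 0 \<and> map_matrix complex_of_real A *v v = \<mu> *s v \<longrightarrow> cmod \<mu> \<noteq> 1)"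

definition dphi :: "(real \<Rightarrow> real^2 \<Rightarrow> real) \<Rightarrow> real \<Rightarrow> real^2 \<Rightarrow> real" where
  "dphi g = (\<lambda>\<phi> \<psi>. deriv (\<lambda>x. g x \<psi>) \<phi>)"

definition sup_norm :: "(real \<Rightarrow> real^2 \<Rightarrow> real) \<Rightarrow> ennreal" where
  "sup_norm g = (SUP \<phi>. SUP \<psi>. ennreal \<bar>g \<phi> \<psi>\<bar>)"

(* For a periodic g the supremum over pairs of lifts equals the supremum taken with the quotient
   distance on T^2, since that distance is the minimum of norm (\<psi>' - \<psi>) over the lifts. *)
definition holder_seminorm :: "real \<Rightarrow> (real \<Rightarrow> real^2 \<Rightarrow> real) \<Rightarrow> ennreal" where
  "holder_seminorm \<alpha> g =
     (SUP \<phi>. SUP \<psi>. SUP \<psi>' \<in> - {\<psi>}. ennreal (\<bar>g \<phi> \<psi>' - g \<phi> \<psi>\<bar> / norm (\<psi>' - \<psi>) powr \<alpha>))"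

definition B_norm :: "real \<Rightarrow> nat \<Rightarrow> (real \<Rightarrow> real^2 \<Rightarrow> real) \<Rightarrow> ennreal" where
  "B_norm \<alpha> k g =
     (\<Sum>n\<le>k. sup_norm ((dphi ^^ n) g)) +
     ennreal \<alpha> * (\<Sum>n<k. holder_seminorm \<alpha> ((dphi ^^ n) g))"

definition B_space :: "real \<Rightarrow> nat \<Rightarrow> (real \<Rightarrow> real^2 \<Rightarrow> real) set" where
  "B_space \<alpha> k = {g.
     (\<forall>\<phi> \<psi>. g (\<phi> + 2 * pi) \<psi> = g \<phi> \<psi>) \<and> (\<forall>\<phi>. torus_periodic (g \<phi>)) \<and>
     (\<forall>\<psi>. (\<forall>n<k. \<forall>\<phi>. (\<lambda>x. (dphi ^^ n) g x \<psi>) differentiable (at \<phi>)) \<and>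
          (\<forall>n\<le>k. continuous_on UNIV (\<lambda>x. (dphi ^^ n) g x \<psi>))) \<and>
     B_norm \<alpha> k g < \<infinity>}"

definition zero_curve :: "(real \<Rightarrow> real^2 \<Rightarrow> real) \<Rightarrow> real \<Rightarrow> real \<Rightarrow> real^2 \<Rightarrow> real" where
  "zero_curve f \<phi>\<^sub>m \<phi>\<^sub>M \<psi> = (THE s. s \<in> {\<phi>\<^sub>m<..<\<phi>\<^sub>M} \<and> f s \<psi> = 0)"

definition Lambda :: "(real \<Rightarrow> real^2 \<Rightarrow> real) \<Rightarrow> real \<Rightarrow> real \<Rightarrow> (real \<times> (real^2)) set" where
  "Lambda f \<phi>\<^sub>m \<phi>\<^sub>M =
     {(INF \<psi>. zero_curve f \<phi>\<^sub>m \<phi>\<^sub>M \<psi>)..(SUP \<psi>. zero_curve f \<phi>\<^sub>m \<phi>\<^sub>M \<psi>)} \<times> UNIV"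

definition contraction_rate :: "(real \<Rightarrow> real^2 \<Rightarrow> real) \<Rightarrow> real \<Rightarrow> real \<Rightarrow> real" where
  "contraction_rate f \<phi>\<^sub>m \<phi>\<^sub>M = - (SUP (\<phi>, \<psi>) \<in> Lambda f \<phi>\<^sub>m \<phi>\<^sub>M. dphi f \<phi> \<psi>)"

definition fbar :: "(real \<Rightarrow> real^2 \<Rightarrow> real) \<Rightarrow> real \<Rightarrow> real" where
  "fbar f \<phi> = torus_mean (f \<phi>)"

definition Smap :: "(real \<Rightarrow> real^2 \<Rightarrow> real) \<Rightarrow> real^2^2 \<Rightarrow> real \<Rightarrow> real \<times> (real^2) \<Rightarrow> real \<times> (real^2)" where
  "Smap f A \<rho> = (\<lambda>(\<phi>, \<psi>). (\<phi> + \<rho> * f \<phi> \<psi>, A *v \<psi>))"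

definition Smap_bar :: "(real \<Rightarrow> real^2 \<Rightarrow> real) \<Rightarrow> real^2^2 \<Rightarrow> real \<Rightarrow> real \<times> (real^2) \<Rightarrow> real \<times> (real^2)" where
  "Smap_bar f A \<rho> = (\<lambda>(\<phi>, \<psi>). (\<phi> + \<rho> * fbar f \<phi>, A *v \<psi>))"

definition is_invariant_graph ::
  "(real \<Rightarrow> real^2 \<Rightarrow> real) \<Rightarrow> real^2^2 \<Rightarrow> real \<Rightarrow> real \<Rightarrow> real \<Rightarrow> (real^2 \<Rightarrow> real) \<Rightarrow> bool" where
  "is_invariant_graph f A \<phi>\<^sub>m \<phi>\<^sub>M \<rho> W \<longleftrightarrow>
     torus_periodic W \<and> (\<forall>\<psi>. (W \<psi>, \<psi>) \<in> Lambda f \<phi>\<^sub>m \<phi>\<^sub>M) \<and>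
     (\<forall>\<psi>. Smap f A \<rho> (W \<psi>, \<psi>) = (W (A *v \<psi>), A *v \<psi>))"

definition invariant_graph ::
  "(real \<Rightarrow> real^2 \<Rightarrow> real) \<Rightarrow> real^2^2 \<Rightarrow> real \<Rightarrow> real \<Rightarrow> real \<Rightarrow> real^2 \<Rightarrow> real" where
  "invariant_graph f A \<phi>\<^sub>m \<phi>\<^sub>M \<rho> = (THE W. is_invariant_graph f A \<phi>\<^sub>m \<phi>\<^sub>M \<rho> W)"

(* (S^n)_phi(phi, psi) - ((Sbar^n)_phi(phi, psi) + W(A^n psi)) *)
definition deviation ::
  "(real \<Rightarrow> real^2 \<Rightarrow> real) \<Rightarrow> real^2^2 \<Rightarrow> real \<Rightarrow> real \<Rightarrow> real \<Rightarrow> nat \<Rightarrow> real \<Rightarrow> real^2 \<Rightarrow> real" where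
  "deviation f A \<phi>\<^sub>m \<phi>\<^sub>M \<rho> n \<phi> \<psi> =
     fst ((Smap f A \<rho> ^^ n) (\<phi>, \<psi>)) -
     (fst ((Smap_bar f A \<rho> ^^ n) (\<phi>, \<psi>)) +
      invariant_graph f A \<phi>\<^sub>m \<phi>\<^sub>M \<rho> (((*v) A ^^ n) \<psi>))"

end

theory Submission
  imports Defs
begin

text \<open>
  Correlations decay exponentially when a function that is Hoelder along unstable lines meets a Hoelder
  function composed with iterates of the automorphism: \<open>A\<^sup>i\<close> maps a coordinate circle to a closed
  geodesic that is both close to an unstable segment and almost equidistributed, so averages over
  unstable segments are close to the mean.

  The deviation \<open>\<Delta>\<close> obeys a linear recursion with slope \<open>\<partial>\<^sub>\<phi> f\<close>, forced by a centred function
  of the fast variable. In mean square, subtracting the response of a constant-coefficient linear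
  recursion to this forcing, which is of order \<open>\<rho>\<^sup>1\<^sup>/\<^sup>2\<close> by decay of correlations, leaves a
  contracting recursion. In mean, a Taylor expansion to second order leaves correlations
  \<open>\<langle>\<Delta> v\<rangle>\<close> with centred \<open>v\<close>; these are of order \<open>\<rho>\<close> because \<open>\<Delta>\<close> is a sum of increments of size
  \<open>\<rho>\<close>, each of which is Hoelder along unstable lines. The times before the orbits enter the
  contracting region number \<open>O(1 / \<rho>)\<close> and only change the constants.
\<close>

section \<open>Means over the torus\<close>

text \<open>The obstacle is regularity. The graph transform composes with the inverse automorphism,
  which contracts unstable lines and expands stable ones, so Holder bounds uniform in \<rho> are
  obtained for \<open>W\<close> and for the orbits only along unstable lines. Correlations are
  therefore asymmetric: the factor made by the dynamics is controlled along unstable lines, and full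
  Holder continuity is asked only of the other one, which comes from \<open>f\<close> at a slow
  variable independent of the fast point. Two competitions fix the constants. Unstable Holder bounds
  survive a slow step because they grow by at most \<open>1 + 2 * \<rho>\<close> while the inverse
  automorphism gains \<open>\<sigma> ^ 4\<close>; and sums of correlations inherit the rate
  \<open>q = 1 - \<rho> * \<gamma>'\<close> because \<open>\<sigma> \<le> q\<close>. Both hold for
  \<open>\<rho> < (1 - \<sigma>) / 2\<close>, which does not involve \<gamma>'. The slack \<gamma> -
  \<gamma>' is spent in halves: one on the slopes in a neighbourhood of the strip, leaving the rate
  \<open>g2 = (\<gamma> + \<gamma>') / 2\<close>, the other on absorbing forcing that itself decays
  like \<open>q ^ n\<close>.\<close>

definition torus_continuous :: "(real^2 \<Rightarrow> real) \<Rightarrow> bool" where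
  "torus_continuous g \<longleftrightarrow> continuous_on UNIV g \<and> torus_periodic g"

lemma torus_continuousI:
  "continuous_on UNIV g \<Longrightarrow> (\<And>\<psi> i. g (\<psi> + axis i (2 * pi)) = g \<psi>) \<Longrightarrow> torus_continuous g"
  by (simp add: torus_continuous_def torus_periodic_def)

lemma torus_continuous_cont: "torus_continuous g \<Longrightarrow> continuous_on UNIV g"
  and torus_continuous_period: "torus_continuous g \<Longrightarrow> g (\<psi> + axis i (2 * pi)) = g \<psi>"
  by (simp_all add: torus_continuous_def torus_periodic_def)

lemma torus_continuous_const: "torus_continuous (\<lambda>\<psi>. c)"
  and torus_continuous_add: "torus_continuous g \<Longrightarrow> torus_continuous h \<Longrightarrow> torus_continuous (\<lambda>\<psi>. g \<psi> + h \<psi>)"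
  and torus_continuous_diff: "torus_continuous g \<Longrightarrow> torus_continuous h \<Longrightarrow> torus_continuous (\<lambda>\<psi>. g \<psi> - h \<psi>)"
  and torus_continuous_mult: "torus_continuous g \<Longrightarrow> torus_continuous h \<Longrightarrow> torus_continuous (\<lambda>\<psi>. g \<psi> * h \<psi>)"
  and torus_continuous_minus: "torus_continuous g \<Longrightarrow> torus_continuous (\<lambda>\<psi>. - g \<psi>)"
  and torus_continuous_abs: "torus_continuous g \<Longrightarrow> torus_continuous (\<lambda>\<psi>. \<bar>g \<psi>\<bar>)"
  and torus_continuous_power: "torus_continuous g \<Longrightarrow> torus_continuous (\<lambda>\<psi>. g \<psi> ^ m)"
  and torus_continuous_divide: "torus_continuous g \<Longrightarrow> torus_continuous (\<lambda>\<psi>. g \<psi> / c)"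
  by (auto simp: torus_continuous_def torus_periodic_def divide_inverse intro!: continuous_intros)

lemma torus_continuous_sum:
  "(\<And>k. k \<in> I \<Longrightarrow> torus_continuous (g k)) \<Longrightarrow> torus_continuous (\<lambda>\<psi>. \<Sum>k\<in>I. g k \<psi>)"
  by (auto simp: torus_continuous_def torus_periodic_def intro!: continuous_intros)

lemma torus_continuous_translate:
  assumes "torus_continuous g" shows "torus_continuous (\<lambda>\<psi>. g (\<psi> + \<tau>))"
proof (rule torus_continuousI)
  show "continuous_on UNIV (\<lambda>\<psi>. g (\<psi> + \<tau>))"
    by (rule continuous_on_compose2[OF torus_continuous_cont[OF assms]]) (auto intro!: continuous_intros)
next
  fix \<psi> i
  have "\<psi> + axis i (2 * pi) + \<tau> = (\<psi> + \<tau>) + axis i (2 * pi)" by simp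
  then show "g (\<psi> + axis i (2 * pi) + \<tau>) = g (\<psi> + \<tau>)"
    by (metis torus_continuous_period[OF assms])
qed

lemmas torus_continuous_intros =
  torus_continuous_const torus_continuous_add torus_continuous_diff torus_continuous_mult
  torus_continuous_minus torus_continuous_abs torus_continuous_power torus_continuous_divide
  torus_continuous_sum torus_continuous_translate

abbreviation torus_box :: "(real^2) set" where
  "torus_box \<equiv> cbox 0 (vec (2 * pi))"

text \<open>Continuity gives integrability on the compact box, and there the Lebesgue integral of
  the definition agrees with the gauge integral, for which splitting of boxes, translation and
  exchange of order are at hand.\<close>

lemma torus_mean_eq_integral:
  assumes "continuous_on UNIV g"
  shows "torus_mean g = integral torus_box g / (2 * pi)\<^sup>2"
proof -
  have "set_integrable lborel torus_box g"
    unfolding set_integrable_def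
    by (rule borel_integrable_compact) (auto intro: continuous_on_subset[OF assms])
  then show ?thesis
    unfolding torus_mean_def by (simp add: set_borel_integral_eq_integral(2))
qed

lemma integrable_torus_box: "continuous_on UNIV g \<Longrightarrow> g integrable_on torus_box" for g :: "real^2 \<Rightarrow> real"
  by (rule integrable_continuous) (rule continuous_on_subset, auto)

lemma torus_mean_const: "torus_mean (\<lambda>\<psi>. c) = c"
proof -
  have "measure lborel torus_box = (2 * pi)\<^sup>2"
    by (subst content_cbox_cart) (auto simp: interval_ne_empty_cart UNIV_2 power2_eq_square)
  then show ?thesis
    by (subst torus_mean_eq_integral) (auto simp: power2_eq_square)
qed

lemma torus_mean_add:
  "continuous_on UNIV g \<Longrightarrow> continuous_on UNIV h \<Longrightarrow>
    torus_mean (\<lambda>\<psi>. g \<psi> + h \<psi>) = torus_mean g + torus_mean h"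
  by (simp add: torus_mean_eq_integral integral_add integrable_torus_box add_divide_distrib
      continuous_on_add)

lemma torus_mean_cmult: "continuous_on UNIV g \<Longrightarrow> torus_mean (\<lambda>\<psi>. c * g \<psi>) = c * torus_mean g"
  by (simp add: torus_mean_eq_integral continuous_on_mult_left)

lemma torus_mean_minus: "continuous_on UNIV g \<Longrightarrow> torus_mean (\<lambda>\<psi>. - g \<psi>) = - torus_mean g"
  using torus_mean_cmult[of g "-1"] by simp

lemma torus_mean_diff:
  "continuous_on UNIV g \<Longrightarrow> continuous_on UNIV h \<Longrightarrow>
    torus_mean (\<lambda>\<psi>. g \<psi> - h \<psi>) = torus_mean g - torus_mean h"
  using torus_mean_add[of g "\<lambda>\<psi>. - h \<psi>"] torus_mean_minus[of h] by (auto intro!: continuous_intros)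

lemma torus_mean_sum:
  assumes "finite I" "\<And>k. k \<in> I \<Longrightarrow> continuous_on UNIV (g k)"
  shows "torus_mean (\<lambda>\<psi>. \<Sum>k\<in>I. g k \<psi>) = (\<Sum>k\<in>I. torus_mean (g k))"
  using assms
proof (induction I rule: finite_induct)
  case empty
  show ?case using torus_mean_const[of 0] by simp
next
  case (insert k I)
  then show ?case
    by (simp add: torus_mean_add continuous_on_sum)
qed

lemma torus_mean_mono:
  assumes "continuous_on UNIV g" "continuous_on UNIV h" "\<And>\<psi>. \<psi> \<in> torus_box \<Longrightarrow> g \<psi> \<le> h \<psi>"
  shows "torus_mean g \<le> torus_mean h"
  using assms
  by (subst (1 2) torus_mean_eq_integral)
    (auto intro!: divide_right_mono integral_le integrable_torus_box)

lemma torus_mean_bound: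
  assumes "continuous_on UNIV g" "\<And>\<psi>. \<psi> \<in> torus_box \<Longrightarrow> \<bar>g \<psi>\<bar> \<le> B"
  shows "\<bar>torus_mean g\<bar> \<le> B"
proof -
  have "torus_mean g \<le> torus_mean (\<lambda>\<psi>. B)" "torus_mean (\<lambda>\<psi>. - B) \<le> torus_mean g"
    using assms by (auto intro!: torus_mean_mono simp: abs_le_iff minus_le_iff continuous_on_const)
  then show ?thesis by (simp add: torus_mean_const abs_le_iff)
qed

lemma torus_mean_abs_le:
  assumes "continuous_on UNIV g" "continuous_on UNIV h" "\<And>\<psi>. \<psi> \<in> torus_box \<Longrightarrow> \<bar>g \<psi>\<bar> \<le> h \<psi>"
  shows "\<bar>torus_mean g\<bar> \<le> torus_mean h"
proof -
  have "torus_mean g \<le> torus_mean h" "torus_mean (\<lambda>\<psi>. - g \<psi>) \<le> torus_mean h"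
    using assms by (auto intro!: torus_mean_mono continuous_intros simp: abs_le_iff)
  then show ?thesis by (simp add: torus_mean_minus assms abs_le_iff)
qed

section \<open>Translations and linear substitutions in the mean\<close>

lemma integral_torus_box_shift_axis:
  fixes g :: "real^2 \<Rightarrow> real"
  assumes g: "torus_continuous g" and s: "0 \<le> s" "s \<le> 2 * pi"
  shows "integral (cbox (a + axis i s) (a + axis i s + vec (2 * pi))) g =
    integral (cbox a (a + vec (2 * pi))) g"
proof -
  let ?b = "a + vec (2 * pi)"
  let ?big = "cbox a (?b + axis i s)"
  have int: "g integrable_on ?big"
    by (rule integrable_continuous, rule continuous_on_subset[OF torus_continuous_cont[OF g]]) auto
  have k: "axis i 1 \<in> (Basis :: (real^2) set)" by (auto simp: Basis_vec_def)
  have ik: "x \<bullet> axis i 1 = x $ i" for x :: "real^2" by (simp add: inner_axis)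
  \<comment> \<open>The box lengthened by \<open>s\<close> in direction \<open>i\<close> is cut
    twice: at \<open>a $ i + 2 * pi\<close> (\<open>1\<close>, \<open>2\<close>) and at
    \<open>a $ i + s\<close> (\<open>3\<close>, \<open>4\<close>). The far slab of the first cut is
    the near slab of the second one moved by a period, so the two full-size boxes carry the same
    integral.\<close>
  have 1: "?big \<inter> {x. x \<bullet> axis i 1 \<le> a $ i + 2 * pi} = cbox a ?b"
    unfolding ik using s exhaust_2[of i] by (auto simp: mem_box_cart axis_def forall_2)
  have 2: "?big \<inter> {x. a $ i + 2 * pi \<le> x \<bullet> axis i 1} =
      cbox (a + axis i (2 * pi)) (?b + axis i (s - 2 * pi) + axis i (2 * pi))"
    unfolding ik using s exhaust_2[of i] by (auto simp: mem_box_cart axis_def forall_2)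
  have 3: "?big \<inter> {x. x \<bullet> axis i 1 \<le> a $ i + s} = cbox a (?b + axis i (s - 2 * pi))"
    unfolding ik using s exhaust_2[of i] by (auto simp: mem_box_cart axis_def forall_2)
  have 4: "?big \<inter> {x. a $ i + s \<le> x \<bullet> axis i 1} =
      cbox (a + axis i s) (a + axis i s + vec (2 * pi))"
    unfolding ik using s exhaust_2[of i] by (auto simp: mem_box_cart axis_def forall_2)
  have per: "g \<circ> (+) (axis i (2 * pi)) = g"
    using torus_continuous_period[OF g] by (auto simp: add.commute)
  have "integral (cbox a (?b + axis i (s - 2 * pi))) g =
      integral (cbox (a + axis i (2 * pi)) (?b + axis i (s - 2 * pi) + axis i (2 * pi))) g"
    using integral_shift_cbox_plus[of a "?b + axis i (s - 2 * pi)" g "axis i (2 * pi)"]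
    by (simp add: per)
  moreover have "integral ?big g = integral (cbox a ?b) g +
      integral (cbox (a + axis i (2 * pi)) (?b + axis i (s - 2 * pi) + axis i (2 * pi))) g"
    using integral_split[OF int k, of "a $ i + 2 * pi"] unfolding 1 2 by simp
  moreover have "integral ?big g = integral (cbox a (?b + axis i (s - 2 * pi))) g +
      integral (cbox (a + axis i s) (a + axis i s + vec (2 * pi))) g"
    using integral_split[OF int k, of "a $ i + s"] unfolding 3 4 by simp
  ultimately show ?thesis by simp
qed

lemma torus_periodic_int:
  assumes "torus_periodic g"
  shows "g (\<psi> + axis i (2 * pi * of_int m)) = g \<psi>"
proof -
  have nat: "g (\<psi> + axis i (2 * pi * of_nat m)) = g \<psi>" for \<psi> m
  proof (induction m)
    case 0
    have "axis i 0 = (0 :: real^2)" by (simp add: axis_eq_0_iff)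
    then show ?case by (simp only: of_nat_0 mult_zero_right add_0_right)
  next
    case (Suc m)
    have "\<psi> + axis i (2 * pi * of_nat (Suc m)) = \<psi> + axis i (2 * pi * of_nat m) + axis i (2 * pi)"
      by (auto simp: axis_def vec_eq_iff algebra_simps)
    then show ?case
      using Suc assms by (simp only: torus_periodic_def)
  qed
  show ?thesis
  proof (cases "m \<ge> 0")
    case True
    then show ?thesis using nat[of \<psi> "nat m"] by (simp add: of_nat_nat)
  next
    case False
    have "\<psi> + axis i (2 * pi * of_int m) + axis i (2 * pi * of_nat (nat (- m))) = \<psi>"
      using False by (auto simp: axis_def vec_eq_iff of_nat_nat)
    then show ?thesis
      using nat[of "\<psi> + axis i (2 * pi * of_int m)" "nat (- m)"] by (simp only:)
  qed
qed

lemma torus_periodic_lattice: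
  assumes "torus_periodic g" "\<forall>i. l $ i \<in> \<int>"
  shows "g (\<psi> + (2 * pi) *\<^sub>R l) = g \<psi>"
proof -
  have "\<exists>m. \<forall>i. l $ i = of_int (m i)"
    using assms(2) by (intro choice) (auto elim: Ints_cases)
  then obtain m where m: "\<And>i. l $ i = of_int (m i)"
    by blast
  have "\<psi> + (2 * pi) *\<^sub>R l = \<psi> + axis 1 (2 * pi * of_int (m 1)) + axis 2 (2 * pi * of_int (m 2))"
    by (simp add: axis_def vec_eq_iff forall_2 m)
  then show ?thesis
    by (simp only: torus_periodic_int[OF assms(1)])
qed

text \<open>One axis at a time: a floor splits off the whole periods of the shift, and the remainder
  lies in the range covered by a single enlarged box.\<close>

lemma torus_mean_translate:
  assumes g: "torus_continuous g"
  shows "torus_mean (\<lambda>\<psi>. g (\<psi> + \<tau>)) = torus_mean g"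
proof -
  have axis: "torus_mean (\<lambda>\<psi>. g (\<psi> + axis i t)) = torus_mean g" if g: "torus_continuous g" for g i t
  proof -
    define m where "m = \<lfloor>t / (2 * pi)\<rfloor>"
    define s where "s = t - 2 * pi * of_int m"
    have s: "0 \<le> s" "s \<le> 2 * pi"
    proof -
      have "of_int m \<le> t / (2 * pi)" "t / (2 * pi) \<le> of_int m + 1"
        unfolding m_def by (auto intro: less_imp_le)
      then show "0 \<le> s" "s \<le> 2 * pi"
        unfolding s_def by (auto simp: field_simps)
    qed
    have "g (\<psi> + axis i t) = g (\<psi> + axis i s)" for \<psi>
    proof -
      have "\<psi> + axis i t = \<psi> + axis i s + axis i (2 * pi * of_int m)"
        by (auto simp: axis_def vec_eq_iff s_def)
      then show ?thesis
        using g torus_periodic_int[of g] by (simp only: torus_continuous_def)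
    qed
    moreover have "integral torus_box (\<lambda>\<psi>. g (\<psi> + axis i s)) = integral torus_box g"
      using integral_torus_box_shift_axis[OF g s, of 0 i]
        integral_shift_cbox_plus[of 0 "vec (2 * pi)" g "axis i s"]
      by (simp add: o_def add.commute)
    ultimately show ?thesis
      using torus_mean_eq_integral[OF torus_continuous_cont[OF g]]
        torus_mean_eq_integral[OF torus_continuous_cont[OF torus_continuous_translate[OF g, of "axis i s"]]]
      by simp
  qed
  have "\<psi> + \<tau> = \<psi> + axis 1 (\<tau> $ 1) + axis 2 (\<tau> $ 2)" for \<psi>
    by (auto simp: axis_def vec_eq_iff forall_2)
  then have "torus_mean (\<lambda>\<psi>. g (\<psi> + \<tau>)) = torus_mean (\<lambda>\<psi>. g (\<psi> + axis 1 (\<tau> $ 1) + axis 2 (\<tau> $ 2)))"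
    by (simp only:)
  also have "\<dots> = torus_mean (\<lambda>\<psi>. g (\<psi> + axis 2 (\<tau> $ 2)))"
    using axis[OF torus_continuous_translate[OF g, of "axis 2 (\<tau> $ 2)"]] by simp
  also have "\<dots> = torus_mean g"
    by (rule axis[OF g])
  finally show ?thesis .
qed

lemma continuous_on_section:
  fixes g :: "'x::topological_space \<Rightarrow> 'y::topological_space \<Rightarrow> 'z::topological_space"
  assumes "continuous_on UNIV (\<lambda>(x, y). g x y)"
  shows "continuous_on UNIV (g x)" "continuous_on UNIV (\<lambda>x. g x y)" "continuous_on UNIV (\<lambda>(y, x). g x y)"
  using continuous_on_compose2[OF assms, of UNIV "Pair x"]
    continuous_on_compose2[OF assms, of UNIV "\<lambda>x. (x, y)"]
    continuous_on_compose2[OF assms, of UNIV "\<lambda>p. (snd p, fst p)"]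
  by (simp_all add: continuous_on_Pair continuous_on_fst continuous_on_snd continuous_on_const
      continuous_on_id case_prod_unfold)

lemma torus_mean_continuous_param:
  fixes g :: "real^2 \<Rightarrow> real^2 \<Rightarrow> real"
  assumes "continuous_on UNIV (\<lambda>(\<psi>, \<tau>). g \<psi> \<tau>)"
  shows "continuous_on UNIV (\<lambda>\<psi>. torus_mean (g \<psi>))"
proof -
  have "continuous_on UNIV (\<lambda>\<psi>. integral torus_box (g \<psi>))"
    by (rule integral_continuous_on_param) (rule continuous_on_subset[OF assms], auto)
  then show ?thesis
    by (simp add: torus_mean_eq_integral continuous_on_section(1)[OF assms] continuous_on_divide)
qed

lemma torus_mean_swap:
  fixes g :: "real^2 \<Rightarrow> real^2 \<Rightarrow> real"
  assumes "continuous_on UNIV (\<lambda>(\<psi>, \<tau>). g \<psi> \<tau>)"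
  shows "torus_mean (\<lambda>\<psi>. torus_mean (g \<psi>)) = torus_mean (\<lambda>\<tau>. torus_mean (\<lambda>\<psi>. g \<psi> \<tau>))"
proof -
  note c = continuous_on_section[OF assms]
  have c3: "continuous_on UNIV (\<lambda>\<psi>. integral torus_box (g \<psi>))"
    by (rule integral_continuous_on_param) (rule continuous_on_subset[OF assms], auto)
  have c4: "continuous_on UNIV (\<lambda>\<tau>. integral torus_box (\<lambda>\<psi>. g \<psi> \<tau>))"
    by (rule integral_continuous_on_param) (rule continuous_on_subset[OF c(3)], auto)
  have "integral torus_box (\<lambda>\<psi>. integral torus_box (g \<psi>)) =
      integral torus_box (\<lambda>\<tau>. integral torus_box (\<lambda>\<psi>. g \<psi> \<tau>))"
    by (rule integral_swap_continuous) (rule continuous_on_subset[OF assms], auto)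
  then show ?thesis
    using c(1,2) c3 c4 by (simp add: torus_mean_eq_integral continuous_on_divide)
qed

lemma torus_continuous_matrix:
  fixes A :: "real^2^2"
  assumes g: "torus_continuous g" and A: "\<forall>i j. A $ i $ j \<in> \<int>"
  shows "torus_continuous (\<lambda>\<psi>. g (A *v \<psi>))"
proof (rule torus_continuousI)
  show "continuous_on UNIV (\<lambda>\<psi>. g (A *v \<psi>))"
    by (rule continuous_on_compose2[OF torus_continuous_cont[OF g]])
      (auto intro: matrix_vector_mult_linear_continuous_on)
next
  fix \<psi> and i :: 2
  have "A *v (\<psi> + axis i (2 * pi)) = A *v \<psi> + (2 * pi) *\<^sub>R column i A"
    using exhaust_2[of i]
    by (auto simp: matrix_vector_mult_def vec_eq_iff column_def axis_def UNIV_2 algebra_simps)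
  moreover have "\<forall>j. column i A $ j \<in> \<int>" using A by (simp add: column_def)
  ultimately show "g (A *v (\<psi> + axis i (2 * pi))) = g (A *v \<psi>)"
    using torus_periodic_lattice[of g "column i A"] g by (simp add: torus_continuous_def)
qed

text \<open>Translation invariance lets one average over an extra translation of the argument; after
  exchanging the two means the inner one no longer sees the matrix.\<close>
lemma torus_mean_matrix:
  fixes A :: "real^2^2"
  assumes g: "torus_continuous g" and A: "\<forall>i j. A $ i $ j \<in> \<int>" and B: "A ** B = mat 1"
  shows "torus_mean (\<lambda>\<psi>. g (A *v \<psi>)) = torus_mean g"
proof -
  have gA: "torus_continuous (\<lambda>\<psi>. g (A *v \<psi>))"
    by (rule torus_continuous_matrix[OF g A])
  have 1: "torus_mean (\<lambda>\<psi>. g (A *v \<psi> + \<tau>)) = torus_mean (\<lambda>\<psi>. g (A *v \<psi>))" for \<tau>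
  proof -
    have "A *v \<psi> + \<tau> = A *v (\<psi> + B *v \<tau>)" for \<psi>
      using B by (simp add: matrix_vector_right_distrib matrix_vector_mul_assoc)
    then show ?thesis
      using torus_mean_translate[OF gA, of "B *v \<tau>"] by simp
  qed
  have "torus_mean (\<lambda>\<tau>. torus_mean (\<lambda>\<psi>. g (A *v \<psi> + \<tau>))) =
      torus_mean (\<lambda>\<psi>. torus_mean (\<lambda>\<tau>. g (A *v \<psi> + \<tau>)))"
  proof (rule torus_mean_swap)
    have "continuous_on UNIV (\<lambda>p. A *v snd p + fst p)"
      by (intro continuous_intros continuous_on_compose2[OF matrix_vector_mult_linear_continuous_on[of UNIV A]]) auto
    then show "continuous_on UNIV (\<lambda>(\<tau>, \<psi>). g (A *v \<psi> + \<tau>))"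
      using continuous_on_compose2[OF torus_continuous_cont[OF g], of UNIV "\<lambda>p. A *v snd p + fst p"]
      by (simp add: case_prod_unfold)
  qed
  moreover have "torus_mean (\<lambda>\<tau>. g (A *v \<psi> + \<tau>)) = torus_mean g" for \<psi>
    using torus_mean_translate[OF g, of "A *v \<psi>"] by (simp add: add.commute)
  ultimately show ?thesis
    using 1 by (simp add: torus_mean_const)
qed

section \<open>The mean-square norm\<close>

definition torus_L2 :: "(real^2 \<Rightarrow> real) \<Rightarrow> real" where
  "torus_L2 g = sqrt (torus_mean (\<lambda>\<psi>. (g \<psi>)\<^sup>2))"

lemma torus_mean_square_nonneg: "torus_continuous g \<Longrightarrow> 0 \<le> torus_mean (\<lambda>\<psi>. (g \<psi>)\<^sup>2)"
  using torus_mean_mono[of "\<lambda>\<psi>. 0" "\<lambda>\<psi>. (g \<psi>)\<^sup>2"]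
  by (simp add: torus_mean_const torus_continuous_cont continuous_on_power)

lemma torus_L2_nonneg: "torus_continuous g \<Longrightarrow> 0 \<le> torus_L2 g"
  by (simp add: torus_L2_def torus_mean_square_nonneg)

lemma torus_L2_square: "torus_continuous g \<Longrightarrow> (torus_L2 g)\<^sup>2 = torus_mean (\<lambda>\<psi>. (g \<psi>)\<^sup>2)"
  by (simp add: torus_L2_def torus_mean_square_nonneg)

lemma torus_L2_mono:
  assumes "torus_continuous g" "torus_continuous h" "\<And>\<psi>. \<bar>g \<psi>\<bar> \<le> h \<psi>"
  shows "torus_L2 g \<le> torus_L2 h"
proof -
  have "(g \<psi>)\<^sup>2 \<le> (h \<psi>)\<^sup>2" for \<psi>
    using assms(3)[of \<psi>] by (metis abs_ge_zero power2_abs power_mono)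
  then show ?thesis
    unfolding torus_L2_def using assms
    by (intro real_sqrt_le_mono torus_mean_mono) (auto simp: continuous_on_power torus_continuous_cont)
qed

lemma torus_L2_cmult: "torus_continuous g \<Longrightarrow> 0 \<le> c \<Longrightarrow> torus_L2 (\<lambda>\<psi>. c * g \<psi>) = c * torus_L2 g"
  by (simp add: torus_L2_def power_mult_distrib torus_mean_cmult real_sqrt_mult torus_continuous_cont
      continuous_on_power)

lemma torus_L2_abs: "torus_L2 (\<lambda>\<psi>. \<bar>g \<psi>\<bar>) = torus_L2 g"
  by (simp add: torus_L2_def)

text \<open>Minkowski's inequality, from \<open>(x + y)\<^sup>2 \<le> (a + b) (x\<^sup>2 / a + y\<^sup>2 / b)\<close> with
  \<open>a\<close>, \<open>b\<close> slightly above the two norms.\<close>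
lemma torus_L2_triangle:
  assumes g: "torus_continuous g" and h: "torus_continuous h"
  shows "torus_L2 (\<lambda>\<psi>. g \<psi> + h \<psi>) \<le> torus_L2 g + torus_L2 h"
proof (rule field_le_epsilon)
  fix e :: real assume e: "e > 0"
  define a where "a = torus_L2 g + e / 2"
  define b where "b = torus_L2 h + e / 2"
  have ab: "a > 0" "b > 0"
    using torus_L2_nonneg[OF g] torus_L2_nonneg[OF h] e by (auto simp: a_def b_def)
  have le: "torus_mean (\<lambda>\<psi>. (g \<psi>)\<^sup>2) \<le> a\<^sup>2" "torus_mean (\<lambda>\<psi>. (h \<psi>)\<^sup>2) \<le> b\<^sup>2"
    using torus_L2_nonneg[OF g] torus_L2_nonneg[OF h] e
    by (auto simp: torus_L2_square[symmetric] g h a_def b_def intro!: power_mono)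
  have titu: "(x + y)\<^sup>2 \<le> (a + b) / a * x\<^sup>2 + (a + b) / b * y\<^sup>2" for x y :: real
  proof -
    have "(a + b) / a * x\<^sup>2 + (a + b) / b * y\<^sup>2 - (x + y)\<^sup>2 = (b * x - a * y)\<^sup>2 / (a * b)"
      using ab by (simp add: field_simps power2_eq_square)
    also have "\<dots> \<ge> 0" using ab by simp
    finally show ?thesis by simp
  qed
  note cont = torus_continuous_cont[OF g] torus_continuous_cont[OF h]
  have "torus_mean (\<lambda>\<psi>. (g \<psi> + h \<psi>)\<^sup>2) \<le>
      torus_mean (\<lambda>\<psi>. (a + b) / a * (g \<psi>)\<^sup>2 + (a + b) / b * (h \<psi>)\<^sup>2)"
    by (intro torus_mean_mono titu continuous_intros cont)
  also have "\<dots> = (a + b) / a * torus_mean (\<lambda>\<psi>. (g \<psi>)\<^sup>2) + (a + b) / b * torus_mean (\<lambda>\<psi>. (h \<psi>)\<^sup>2)"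
    by (subst torus_mean_add torus_mean_cmult, (intro continuous_intros cont)+)+ simp
  also have "\<dots> \<le> (a + b) / a * a\<^sup>2 + (a + b) / b * b\<^sup>2"
    using ab le by (intro add_mono mult_left_mono) auto
  also have "\<dots> = (a + b)\<^sup>2"
    using ab by (simp add: field_simps power2_eq_square)
  finally have "torus_L2 (\<lambda>\<psi>. g \<psi> + h \<psi>) \<le> a + b"
    unfolding torus_L2_def using ab by (intro real_le_lsqrt) auto
  then show "torus_L2 (\<lambda>\<psi>. g \<psi> + h \<psi>) \<le> torus_L2 g + torus_L2 h + e"
    by (simp add: a_def b_def)
qed

text \<open>Serves one step of a perturbed contraction: the first term carries the old norm, the
  other two are forcing.\<close>

lemma torus_L2_le3:
  assumes u: "torus_continuous u" and g: "torus_continuous g" and h: "torus_continuous h" and k: "torus_continuous k"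
    and abc: "0 \<le> a" "0 \<le> b" "0 \<le> c"
    and le: "\<And>\<psi>. \<bar>u \<psi>\<bar> \<le> a * \<bar>g \<psi>\<bar> + b * \<bar>h \<psi>\<bar> + c * \<bar>k \<psi>\<bar>"
  shows "torus_L2 u \<le> a * torus_L2 g + b * torus_L2 h + c * torus_L2 k"
proof -
  have t: "torus_continuous (\<lambda>\<psi>. a * \<bar>g \<psi>\<bar>)" "torus_continuous (\<lambda>\<psi>. b * \<bar>h \<psi>\<bar>)" "torus_continuous (\<lambda>\<psi>. c * \<bar>k \<psi>\<bar>)"
    by (intro torus_continuous_intros g h k)+
  have "torus_L2 u \<le> torus_L2 (\<lambda>\<psi>. a * \<bar>g \<psi>\<bar> + b * \<bar>h \<psi>\<bar> + c * \<bar>k \<psi>\<bar>)"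
    by (intro torus_L2_mono u torus_continuous_add t le)
  also have "\<dots> \<le> torus_L2 (\<lambda>\<psi>. a * \<bar>g \<psi>\<bar> + b * \<bar>h \<psi>\<bar>) + torus_L2 (\<lambda>\<psi>. c * \<bar>k \<psi>\<bar>)"
    by (intro torus_L2_triangle torus_continuous_add t)
  also have "\<dots> \<le> torus_L2 (\<lambda>\<psi>. a * \<bar>g \<psi>\<bar>) + torus_L2 (\<lambda>\<psi>. b * \<bar>h \<psi>\<bar>) + torus_L2 (\<lambda>\<psi>. c * \<bar>k \<psi>\<bar>)"
    by (intro add_right_mono torus_L2_triangle t)
  also have "\<dots> = a * torus_L2 g + b * torus_L2 h + c * torus_L2 k"
    using torus_L2_cmult[OF torus_continuous_abs] g h k abc by (simp add: torus_L2_abs)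
  finally show ?thesis .
qed

text \<open>One representative works for all periodic functions at once; it turns bounds obtained by
  compactness of the box into bounds on the whole plane.\<close>

lemma torus_box_representative:
  obtains \<psi>\<^sub>0 where "\<psi>\<^sub>0 \<in> torus_box" "\<And>g :: real^2 \<Rightarrow> real. torus_periodic g \<Longrightarrow> g \<psi> = g \<psi>\<^sub>0"
proof -
  define l :: "real^2" where "l = (\<chi> i. of_int \<lfloor>\<psi> $ i / (2 * pi)\<rfloor>)"
  define \<psi>\<^sub>0 where "\<psi>\<^sub>0 = \<psi> - (2 * pi) *\<^sub>R l"
  have "0 \<le> \<psi>\<^sub>0 $ i \<and> \<psi>\<^sub>0 $ i \<le> 2 * pi" for i
  proof -
    have "l $ i \<le> \<psi> $ i / (2 * pi)" "\<psi> $ i / (2 * pi) \<le> l $ i + 1"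
      by (auto simp: l_def intro: less_imp_le)
    then show ?thesis by (auto simp: \<psi>\<^sub>0_def field_simps)
  qed
  then have "\<psi>\<^sub>0 \<in> torus_box" by (auto simp: mem_box_cart)
  moreover have "g \<psi> = g \<psi>\<^sub>0" if "torus_periodic g" for g :: "real^2 \<Rightarrow> real"
    using torus_periodic_lattice[OF that, of l \<psi>\<^sub>0] by (simp add: \<psi>\<^sub>0_def l_def)
  ultimately show thesis by (rule that)
qed

section \<open>Hyperbolic splitting and decay of correlations\<close>

text \<open>\<open>z\<close> is unstable, \<open>\<zeta>\<close> and \<open>w\<close> are stable.
  The first lattice generator is unstable up to a stable vector, so its image under i iterates
  shadows \<open>\<mu> ^ i *\<^sub>R z\<close>; the second is a real multiple of the first up to a
  stable vector, so its image moves the line through the image of the first only by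
  \<open>\<nu> ^ i *\<^sub>R w\<close>.\<close>

locale toral_splitting =
  fixes A B :: "real^2^2" and \<mu> \<nu> r :: real and z \<zeta> w :: "real^2"
  assumes A_int: "\<forall>i j. A $ i $ j \<in> \<int>"
    and B_int: "\<forall>i j. B $ i $ j \<in> \<int>"
    and AB: "A ** B = mat 1" and BA: "B ** A = mat 1"
    and Az: "A *v z = \<mu> *\<^sub>R z" and A\<zeta>: "A *v \<zeta> = \<nu> *\<^sub>R \<zeta>" and Aw: "A *v w = \<nu> *\<^sub>R w"
    and axis1: "axis 1 (2 * pi) = z + \<zeta>"
    and axis2: "axis 2 (2 * pi) = r *\<^sub>R axis 1 (2 * pi) + w"
    and \<mu>: "\<bar>\<mu>\<bar> > 1" and \<mu>\<nu>: "\<bar>\<mu>\<bar> * \<bar>\<nu>\<bar> = 1"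

text \<open>An eigenvalue of modulus one would arise from a vanishing lower left entry, and also
  from a negative discriminant. Hence the eigenvalues are real, neither has modulus one, and their
  product does, so exactly one expands; as c is nonzero, both eigenvectors have the form (\<kappa> -
  d, c).\<close>

lemma anosov_splitting:
  assumes "anosov_automorphism A"
  obtains B \<mu> \<nu> r z \<zeta> w where "toral_splitting A B \<mu> \<nu> r z \<zeta> w"
proof -
  define a b c d where abcd: "a = A $ 1 $ 1" "b = A $ 1 $ 2" "c = A $ 2 $ 1" "d = A $ 2 $ 2"
  have A_int: "\<forall>i j. A $ i $ j \<in> \<int>" and detA: "\<bar>det A\<bar> = 1"
    and hyp: "\<And>\<mu> v. v \<noteq> 0 \<Longrightarrow> map_matrix complex_of_real A *v v = \<mu> *s v \<Longrightarrow> cmod \<mu> \<noteq> 1"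
    using assms by (auto simp: anosov_automorphism_def)
  define D where "D = a * d - b * c"
  have D: "D = det A" by (simp add: D_def det_2 abcd)
  have D1: "D = 1 \<or> D = - 1" using detA D by linarith
  have int: "a \<in> \<int>" "b \<in> \<int>" "c \<in> \<int>" "d \<in> \<int>" using A_int by (auto simp: abcd)
  have mulv: "A *v (vector [x, y] :: real^2) = vector [a * x + b * y, c * x + d * y]" for x y
    by (simp add: matrix_vector_mult_def vec_eq_iff forall_2 UNIV_2 sum.insert abcd vector_2)
  have c0: "c \<noteq> 0"
  proof
    assume "c = 0"
    then have "a * d = D" by (simp add: D_def)
    then have "\<bar>a\<bar> * \<bar>d\<bar> = 1" using D1 by (auto simp flip: abs_mult)
    moreover obtain m l :: int where "a = of_int m" "d = of_int l" using int by (auto elim!: Ints_cases)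
    ultimately have "real_of_int \<bar>m * l\<bar> = 1" by (simp add: abs_mult)
    then have "\<bar>m * l\<bar> = 1" by linarith
    then have "\<bar>m\<bar> = 1" by (rule abs_zmult_eq_1)
    then have "\<bar>a\<bar> = 1" by (simp add: \<open>a = of_int m\<close> flip: of_int_abs)
    have "map_matrix complex_of_real A *v vector [1, 0] = complex_of_real a *s vector [1, 0]"
      using \<open>c = 0\<close>
      by (simp add: matrix_vector_mult_def vec_eq_iff forall_2 UNIV_2 abcd vector_2 map_matrix_def)
    moreover have "vector [1, 0] \<noteq> (0 :: complex^2)"
      by (simp add: vec_eq_iff forall_2 vector_2)
    ultimately have "cmod (complex_of_real a) \<noteq> 1" by (rule hyp[rotated])
    then show False using \<open>\<bar>a\<bar> = 1\<close> by simp
  qed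
  have root: "cmod \<kappa> \<noteq> 1" if "\<kappa> * \<kappa> - (complex_of_real a + complex_of_real d) * \<kappa> + complex_of_real D = 0" for \<kappa>
  proof -
    have "complex_of_real a * (\<kappa> - complex_of_real d) + complex_of_real b * complex_of_real c =
        \<kappa> * (\<kappa> - complex_of_real d)"
      using that by (simp add: D_def algebra_simps)
    then have "map_matrix complex_of_real A *v vector [\<kappa> - complex_of_real d, complex_of_real c] =
        \<kappa> *s vector [\<kappa> - complex_of_real d, complex_of_real c]"
      by (simp add: matrix_vector_mult_def vec_eq_iff forall_2 UNIV_2 abcd vector_2 map_matrix_def
          algebra_simps)
    moreover have "vector [\<kappa> - complex_of_real d, complex_of_real c] \<noteq> (0 :: complex^2)"
      using c0 by (simp add: vec_eq_iff forall_2 vector_2)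
    ultimately show ?thesis by (rule hyp[rotated])
  qed
  define disc where "disc = (a + d)\<^sup>2 - 4 * D"
  have disc: "disc \<ge> 0"
  proof (rule ccontr)
    assume "\<not> disc \<ge> 0"
    then have neg: "disc < 0" by simp
    \<comment> \<open>Conjugate roots have squared modulus \<open>D\<close>, and a negative
      discriminant forces \<open>D = 1\<close>.\<close>
    define \<kappa> where "\<kappa> = Complex ((a + d) / 2) (sqrt (- disc) / 2)"
    have sq: "sqrt (- disc) * sqrt (- disc) = - disc" using neg by simp
    have "D > 0"
      using neg zero_le_power2[of "a + d"] unfolding disc_def by linarith
    then have "D = 1" using D1 by auto
    have "(cmod \<kappa>)\<^sup>2 = ((a + d)\<^sup>2 + - disc) / 4"
      using sq by (simp add: \<kappa>_def cmod_power2 power_divide)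
    then have "(cmod \<kappa>)\<^sup>2 = 1" using \<open>D = 1\<close> by (simp add: disc_def)
    then have "cmod \<kappa> = 1" by (metis norm_ge_zero one_power2 power2_eq_iff_nonneg zero_le_one)
    moreover have "\<kappa> * \<kappa> - (complex_of_real a + complex_of_real d) * \<kappa> + complex_of_real D = 0"
      using sq by (simp add: \<kappa>_def complex_eq_iff disc_def power2_eq_square field_simps)
    ultimately show False using root by blast
  qed
  define \<mu>1 where "\<mu>1 = (a + d + sqrt disc) / 2"
  define \<mu>2 where "\<mu>2 = (a + d - sqrt disc) / 2"
  have sq: "sqrt disc * sqrt disc = disc" using disc by simp
  have vieta: "\<mu>1 + \<mu>2 = a + d" "\<mu>1 * \<mu>2 = D"
    using sq by (simp_all add: \<mu>1_def \<mu>2_def disc_def field_simps power2_eq_square)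
  have prod: "\<bar>\<mu>1\<bar> * \<bar>\<mu>2\<bar> = 1" using vieta D1 by (auto simp flip: abs_mult)
  have ne: "\<bar>\<mu>1\<bar> \<noteq> 1"
  proof -
    have "\<mu>1 * \<mu>1 - (a + d) * \<mu>1 + D = 0" by (simp add: vieta[symmetric] algebra_simps)
    then have "complex_of_real (\<mu>1 * \<mu>1 - (a + d) * \<mu>1 + D) = 0" by simp
    then show ?thesis using root[of "complex_of_real \<mu>1"] by simp
  qed
  obtain \<mu> \<nu> where mn: "\<bar>\<mu>\<bar> > 1" "\<bar>\<mu>\<bar> * \<bar>\<nu>\<bar> = 1" "\<mu> + \<nu> = a + d" "\<mu> * \<nu> = D"
  proof (cases "\<bar>\<mu>1\<bar> > 1")
    case True
    then show ?thesis using that[of \<mu>1 \<mu>2] prod vieta by simp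
  next
    case False
    then have "\<bar>\<mu>1\<bar> < 1" using ne by simp
    then have "\<bar>\<mu>2\<bar> > 1"
      using prod by (smt (verit) mult_left_le mult_strict_right_mono abs_ge_zero mult_le_one)
    then show ?thesis using that[of \<mu>2 \<mu>1] prod vieta by (simp add: mult.commute add.commute)
  qed
  have "\<bar>\<nu>\<bar> < 1"
    using mn by (smt (verit) mult_le_cancel_left1 mult_left_mono)
  then have mne: "\<mu> - \<nu> \<noteq> 0" using mn(1) by auto
  have eig: "A *v (vector [\<kappa> - d, c] :: real^2) = \<kappa> *\<^sub>R vector [\<kappa> - d, c]" if "\<kappa> = \<mu> \<or> \<kappa> = \<nu>" for \<kappa>
  proof -
    have "\<kappa> * \<kappa> - (a + d) * \<kappa> + D = 0" using that mn(3,4)[symmetric] by (auto simp: algebra_simps)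
    then show ?thesis
      unfolding mulv by (simp add: vec_eq_iff forall_2 vector_2 D_def algebra_simps)
  qed
  \<comment> \<open>The adjugate times the determinant; since \<open>D = 1 / D\<close>, the inverse
    has integer entries.\<close>
  define B :: "real^2^2" where "B = vector [vector [D * d, - D * b], vector [- D * c, D * a]]"
  have Bint: "\<forall>i j. B $ i $ j \<in> \<int>"
    using int D1 by (auto simp: forall_2 B_def vector_2)
  have DD: "D * D = 1" using D1 by auto
  have inv: "D * (a * d) = 1 + D * (b * c)" "a * (d * D) = 1 + b * (c * D)"
    using DD by (auto simp: D_def algebra_simps)
  \<comment> \<open>Chosen so that the eigenvectors scaled by \<open>p\<close> and
    \<open>- p\<close> have cancelling second coordinates and first coordinates adding up to 2
    \<pi>, as \<open>axis1\<close> demands. The value given to \<open>r\<close> below cancels the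
    first coordinate in \<open>axis2\<close>.\<close>
  define p where "p = 2 * pi / (\<mu> - \<nu>)"
  have p: "p * \<mu> = 2 * pi + p * \<nu>" using mne by (simp add: p_def field_simps)
  show thesis
  proof (rule that[of B \<mu> \<nu> "- (\<nu> - d) / c" "p *\<^sub>R vector [\<mu> - d, c]"
        "(- p) *\<^sub>R vector [\<nu> - d, c]" "(2 * pi / c) *\<^sub>R vector [\<nu> - d, c]"],
      unfold_locales)
    show "A ** B = mat 1" "B ** A = mat 1"
      using inv
      by (simp_all add: vec_eq_iff forall_2 matrix_matrix_mult_def UNIV_2 B_def vector_2 mat_def
          flip: abcd) (auto simp: algebra_simps)
    show "A *v p *\<^sub>R vector [\<mu> - d, c] = \<mu> *\<^sub>R p *\<^sub>R vector [\<mu> - d, c]"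
      and "A *v (- p) *\<^sub>R vector [\<nu> - d, c] = \<nu> *\<^sub>R (- p) *\<^sub>R vector [\<nu> - d, c]"
      and "A *v (2 * pi / c) *\<^sub>R vector [\<nu> - d, c] = \<nu> *\<^sub>R (2 * pi / c) *\<^sub>R vector [\<nu> - d, c]"
      by (simp_all only: matrix_vector_mult_scaleR eig[OF disjI1[OF refl]] eig[OF disjI2[OF refl]]
          scaleR_left_commute)
    show "(axis 1 (2 * pi) :: real^2) = p *\<^sub>R vector [\<mu> - d, c] + (- p) *\<^sub>R vector [\<nu> - d, c]"
      using p unfolding vec_eq_iff forall_2 by (simp add: vector_2 axis_def algebra_simps)
    show "(axis 2 (2 * pi) :: real^2) = (- (\<nu> - d) / c) *\<^sub>R axis 1 (2 * pi) + (2 * pi / c) *\<^sub>R vector [\<nu> - d, c]"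
      using c0 by (simp add: vec_eq_iff forall_2 vector_2 axis_def field_simps)
  qed (use A_int Bint mn in auto)
qed

text \<open>One step backwards shrinks unstable distances by 1 / |\<mu>|, hence their \<alpha>-th
  powers by \<open>\<sigma> ^ 4\<close>. The fourth root is taken because halving the time in the
  mixing estimate leaves two factors \<sigma> per step: one is later traded for the slow rate, the
  other sums a geometric series.\<close>

locale toral_mixing = toral_splitting +
  fixes \<alpha> \<sigma> :: real
  assumes \<alpha>: "0 < \<alpha>" and \<sigma>_def: "\<sigma> = \<bar>\<mu>\<bar> powr (- \<alpha> / 4)"
begin

lemma \<sigma>_pos: "0 < \<sigma>" and \<sigma>_less_1: "\<sigma> < 1"
  using \<mu> \<alpha> by (simp_all add: \<sigma>_def powr_less_one)

lemma \<sigma>_power4: "\<sigma> ^ (4 * i) = (\<bar>\<nu>\<bar> ^ i) powr \<alpha>"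
proof -
  have \<nu>: "\<bar>\<nu>\<bar> = 1 / \<bar>\<mu>\<bar>" using \<mu> \<mu>\<nu> by (simp add: field_simps)
  have "\<sigma> ^ (4 * i) = \<bar>\<mu>\<bar> powr (- \<alpha> * real i)"
    using \<mu> by (simp add: \<sigma>_def powr_powr flip: powr_realpow)
  also have "\<dots> = (\<bar>\<nu>\<bar> powr real i) powr \<alpha>"
    using \<mu> by (simp add: \<nu> powr_powr powr_divide powr_minus_divide mult.commute)
  also have "\<dots> = (\<bar>\<nu>\<bar> ^ i) powr \<alpha>"
    using \<mu> \<nu> by (subst powr_realpow) auto
  finally show ?thesis .
qed

lemma powr_decay: "(x * \<bar>\<nu>\<bar> ^ i) powr \<alpha> = x powr \<alpha> * \<sigma> ^ (4 * i)" if "x \<ge> 0"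
  using that by (simp add: \<sigma>_power4 powr_mult)

abbreviation Ait :: "nat \<Rightarrow> real^2 \<Rightarrow> real^2" where "Ait n \<equiv> (*v) A ^^ n"

lemma Ait_add: "Ait n (x + y) = Ait n x + Ait n y"
  and Ait_scale: "Ait n (t *\<^sub>R x) = t *\<^sub>R Ait n x"
  by (induction n) (simp_all add: matrix_vector_right_distrib matrix_vector_mult_scaleR)

lemma Ait_z: "Ait n z = \<mu> ^ n *\<^sub>R z" and Ait_\<zeta>: "Ait n \<zeta> = \<nu> ^ n *\<^sub>R \<zeta>" and Ait_w: "Ait n w = \<nu> ^ n *\<^sub>R w"
  by (induction n) (simp_all add: matrix_vector_mult_scaleR Az A\<zeta> Aw mult.commute)

lemma norm_shift_along_z:
  "norm (Ait n (\<psi> + t *\<^sub>R z) - Ait n \<psi>) powr \<alpha> = norm z powr \<alpha> * (\<bar>\<mu>\<bar> ^ n * \<bar>t\<bar>) powr \<alpha>"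
proof -
  have "Ait n (\<psi> + t *\<^sub>R z) - Ait n \<psi> = (t * \<mu> ^ n) *\<^sub>R z"
    by (simp add: Ait_add Ait_scale Ait_z)
  then show ?thesis by (simp add: abs_mult power_abs powr_mult mult_ac)
qed

lemma Ait_inverse: "Ait n (((*v) B ^^ n) x) = x"
  by (induction n arbitrary: x)
    (simp_all add: funpow_swap1[of "(*v) A"] matrix_vector_mul_assoc AB)

lemma Ait_int: "\<forall>i. x $ i \<in> \<int> \<Longrightarrow> \<forall>i. Ait n x $ i \<in> \<int>"
  by (induction n) (auto simp: matrix_vector_mult_def A_int intro!: Ints_sum Ints_mult)

lemma Ait_continuous: "continuous_on S (Ait n)"
proof (induction n)
  case (Suc n)
  show ?case
    using continuous_on_compose2[OF matrix_vector_mult_linear_continuous_on[of UNIV A] Suc] by simp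
qed (simp add: id_def)

lemma torus_continuous_Ait: "torus_continuous g \<Longrightarrow> torus_continuous (\<lambda>\<psi>. g (Ait n \<psi>))"
proof (induction n arbitrary: g)
  case (Suc n)
  then show ?case
    using Suc.IH[OF torus_continuous_matrix[OF Suc.prems A_int]] by simp
qed simp

lemma torus_mean_Ait: "torus_continuous g \<Longrightarrow> torus_mean (\<lambda>\<psi>. g (Ait n \<psi>)) = torus_mean g"
proof (induction n arbitrary: g)
  case (Suc n)
  then show ?case
    using Suc.IH[OF torus_continuous_matrix[OF Suc.prems A_int]] torus_mean_matrix[OF Suc.prems A_int AB]
    by simp
qed simp

section \<open>Equidistribution of unstable segments and mixing\<close>

definition holder_const :: "real \<Rightarrow> (real^2 \<Rightarrow> real) \<Rightarrow> bool" where
  "holder_const L v \<longleftrightarrow> (\<forall>\<psi> \<psi>'. \<bar>v \<psi>' - v \<psi>\<bar> \<le> L * norm (\<psi>' - \<psi>) powr \<alpha>)"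

definition loop_const :: real where "loop_const = norm w powr \<alpha> + norm \<zeta> powr \<alpha>"

text \<open>The closed geodesic from \<open>\<xi>\<close> to \<open>\<xi> + A\<^sup>i (axis 1 (2 * pi))\<close> is close to the unstable segment
  from \<open>\<xi>\<close> to \<open>\<xi> + \<mu> ^ i *\<^sub>R z\<close>. The average of \<open>v\<close> over it hardly depends on \<open>\<xi>\<close>,
  because its translates by multiples of \<open>A\<^sup>i w\<close> sweep out the whole torus.\<close>
lemma unstable_segment_average:
  assumes v: "torus_continuous v" and L: "holder_const L v"
  shows "\<bar>torus_mean (\<lambda>\<tau>. v (\<xi> + (\<tau> $ 1 / (2 * pi)) *\<^sub>R (\<mu> ^ i *\<^sub>R z))) - torus_mean v\<bar>
    \<le> L * loop_const * \<sigma> ^ (4 * i)"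
proof -
  define l where "l = Ait i (axis 1 (2 * pi))"
  \<comment> \<open>The average over the closed loop, a one-dimensional integral, is written as a
    torus mean of a function of the first coordinate alone; translation invariance and exchange of
    means then apply to it unchanged.\<close>
  define m where "m \<xi> = torus_mean (\<lambda>\<tau>. v (\<xi> + (\<tau> $ 1 / (2 * pi)) *\<^sub>R l))" for \<xi>
  have vc: "continuous_on UNIV v" and vp: "torus_periodic v"
    using v by (auto simp: torus_continuous_def)
  have L0: "L \<ge> 0"
  proof -
    have "0 \<le> L * norm (axis 1 1 :: real^2) powr \<alpha>"
      using L abs_ge_zero order_trans unfolding holder_const_def by (metis diff_zero)
    then show ?thesis by simp
  qed
  have holder: "\<bar>v \<psi>' - v \<psi>\<bar> \<le> L * norm (\<psi>' - \<psi>) powr \<alpha>" for \<psi> \<psi>'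
    using L by (simp add: holder_const_def)
  have cont: "continuous_on UNIV (\<lambda>\<tau>. v (\<xi> + (\<tau> $ 1 / (2 * pi)) *\<^sub>R x))" for \<xi> x
    by (rule continuous_on_compose2[OF vc]) (auto intro!: continuous_intros)
  have l: "l = (2 * pi) *\<^sub>R Ait i (axis 1 1)" "\<forall>j. Ait i (axis 1 1) $ j \<in> \<int>"
  proof -
    have "axis 1 (2 * pi) = (2 * pi) *\<^sub>R (axis 1 1 :: real^2)"
      by (auto simp: axis_def vec_eq_iff)
    then show "l = (2 * pi) *\<^sub>R Ait i (axis 1 1)" by (simp only: l_def Ait_scale)
    show "\<forall>j. Ait i (axis 1 1) $ j \<in> \<int>" by (rule Ait_int) (simp add: axis_def)
  qed
  have lp: "v (\<psi> + l) = v \<psi>" for \<psi>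
    using torus_periodic_lattice[OF vp l(2)] l(1) by simp
  have G: "torus_continuous (\<lambda>\<tau>. v (\<xi> + (\<tau> $ 1 / (2 * pi)) *\<^sub>R l))" for \<xi>
  proof (rule torus_continuousI[OF cont])
    fix \<tau> :: "real^2" and j :: 2
    have "\<xi> + ((\<tau> + axis 1 (2 * pi)) $ 1 / (2 * pi)) *\<^sub>R l = \<xi> + (\<tau> $ 1 / (2 * pi)) *\<^sub>R l + l"
      by (simp add: axis_def add_divide_distrib scaleR_left_distrib)
    then show "v (\<xi> + ((\<tau> + axis j (2 * pi)) $ 1 / (2 * pi)) *\<^sub>R l) = v (\<xi> + (\<tau> $ 1 / (2 * pi)) *\<^sub>R l)"
      using exhaust_2[of j] lp[of "\<xi> + (\<tau> $ 1 / (2 * pi)) *\<^sub>R l"] by (auto simp: axis_def add.assoc)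
  qed
  have m_along: "m (\<xi> + s *\<^sub>R l) = m \<xi>" for \<xi> s
  proof -
    have "\<xi> + s *\<^sub>R l + (\<tau> $ 1 / (2 * pi)) *\<^sub>R l = \<xi> + ((\<tau> + axis 1 (2 * pi * s)) $ 1 / (2 * pi)) *\<^sub>R l" for \<tau> :: "real^2"
      by (simp add: axis_def add_divide_distrib scaleR_left_distrib)
    then show ?thesis
      using torus_mean_translate[OF G, of \<xi> "axis 1 (2 * pi * s)"] by (simp only: m_def)
  qed
  have m_lattice: "m (\<xi> + (2 * pi) *\<^sub>R k) = m \<xi>" if "\<forall>j. k $ j \<in> \<int>" for \<xi> k
  proof -
    have "\<xi> + (2 * pi) *\<^sub>R k + x = \<xi> + x + (2 * pi) *\<^sub>R k" for x by simp
    then show ?thesis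
      by (simp only: m_def torus_periodic_lattice[OF vp that])
  qed
  have m_near: "\<bar>m (\<xi> + d) - m \<xi>\<bar> \<le> L * norm d powr \<alpha>" for \<xi> d
  proof -
    have "m (\<xi> + d) - m \<xi> = torus_mean (\<lambda>\<tau>. v (\<xi> + d + (\<tau> $ 1 / (2 * pi)) *\<^sub>R l) - v (\<xi> + (\<tau> $ 1 / (2 * pi)) *\<^sub>R l))"
      unfolding m_def by (rule torus_mean_diff[symmetric]) (rule cont)+
    also have "\<bar>\<dots>\<bar> \<le> L * norm d powr \<alpha>"
    proof (rule torus_mean_bound)
      show "continuous_on UNIV (\<lambda>\<tau>. v (\<xi> + d + (\<tau> $ 1 / (2 * pi)) *\<^sub>R l) - v (\<xi> + (\<tau> $ 1 / (2 * pi)) *\<^sub>R l))"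
        by (intro continuous_on_diff cont)
      show "\<bar>v (\<xi> + d + (\<tau> $ 1 / (2 * pi)) *\<^sub>R l) - v (\<xi> + (\<tau> $ 1 / (2 * pi)) *\<^sub>R l)\<bar> \<le> L * norm d powr \<alpha>" for \<tau>
        using holder[of "\<xi> + d + (\<tau> $ 1 / (2 * pi)) *\<^sub>R l" "\<xi> + (\<tau> $ 1 / (2 * pi)) *\<^sub>R l"] by simp
    qed
    finally show ?thesis .
  qed
  \<comment> \<open>Pull \<open>\<tau>\<close> back by i iterates and expand it in the lattice
    generators. Multiples of the first one slide the loop along itself, the integer part of
    \<open>y\<close> disappears by periodicity, and its fractional part contributes a stable vector
    no longer than \<open>\<nu> ^ i *\<^sub>R w\<close>.\<close>
  have m_far: "\<bar>m (\<xi> + \<tau>) - m \<xi>\<bar> \<le> L * (norm w powr \<alpha> * \<sigma> ^ (4 * i))" for \<tau>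
  proof -
    define x where "x = ((*v) B ^^ i) \<tau> $ 1 / (2 * pi)"
    define y where "y = ((*v) B ^^ i) \<tau> $ 2 / (2 * pi)"
    have "((*v) B ^^ i) \<tau> = x *\<^sub>R axis 1 (2 * pi) + y *\<^sub>R axis 2 (2 * pi)"
      by (simp add: vec_eq_iff forall_2 axis_def x_def y_def)
    also have "\<dots> = x *\<^sub>R axis 1 (2 * pi) + frac y *\<^sub>R (r *\<^sub>R axis 1 (2 * pi) + w) + (2 * pi) *\<^sub>R (of_int \<lfloor>y\<rfloor> *\<^sub>R axis 2 1)"
      unfolding axis2[symmetric]
      by (simp add: vec_eq_iff forall_2 axis_def frac_def algebra_simps)
    finally have "\<tau> = Ait i (x *\<^sub>R axis 1 (2 * pi) + frac y *\<^sub>R (r *\<^sub>R axis 1 (2 * pi) + w) + (2 * pi) *\<^sub>R (of_int \<lfloor>y\<rfloor> *\<^sub>R axis 2 1))"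
      using Ait_inverse[of i \<tau>] by simp
    also have "\<dots> = frac y *\<^sub>R \<nu> ^ i *\<^sub>R w + (x + frac y * r) *\<^sub>R l + (2 * pi) *\<^sub>R Ait i (of_int \<lfloor>y\<rfloor> *\<^sub>R axis 2 1)"
      by (simp add: Ait_add Ait_scale Ait_w l_def algebra_simps)
    finally have "\<xi> + \<tau> = \<xi> + frac y *\<^sub>R \<nu> ^ i *\<^sub>R w + (x + frac y * r) *\<^sub>R l + (2 * pi) *\<^sub>R Ait i (of_int \<lfloor>y\<rfloor> *\<^sub>R axis 2 1)"
      by (simp add: add.assoc)
    moreover have lattice: "\<forall>j. Ait i (of_int \<lfloor>y\<rfloor> *\<^sub>R axis 2 1) $ j \<in> \<int>"
      by (rule Ait_int) (simp add: axis_def)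
    ultimately have "m (\<xi> + \<tau>) = m (\<xi> + frac y *\<^sub>R \<nu> ^ i *\<^sub>R w)"
      by (simp only: m_lattice[OF lattice] m_along)
    then have "\<bar>m (\<xi> + \<tau>) - m \<xi>\<bar> \<le> L * norm (frac y *\<^sub>R \<nu> ^ i *\<^sub>R w) powr \<alpha>"
      using m_near[of \<xi> "frac y *\<^sub>R \<nu> ^ i *\<^sub>R w"] by simp
    also have "norm (frac y *\<^sub>R \<nu> ^ i *\<^sub>R w) \<le> 1 * (\<bar>\<nu>\<bar> ^ i * norm w)"
      unfolding norm_scaleR using frac_lt_1[of y] frac_ge_0[of y]
      by (intro mult_mono) (auto simp: power_abs)
    then have "L * norm (frac y *\<^sub>R \<nu> ^ i *\<^sub>R w) powr \<alpha> \<le> L * (norm w * \<bar>\<nu>\<bar> ^ i) powr \<alpha>"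
      using L0 \<alpha> by (intro mult_left_mono powr_mono2) (auto simp: mult.commute)
    finally show ?thesis by (simp add: powr_decay)
  qed
  have joint: "continuous_on UNIV (\<lambda>(\<tau>, \<tau>'). v (\<xi> + \<tau> + (\<tau>' $ 1 / (2 * pi)) *\<^sub>R l))"
    unfolding case_prod_unfold
    by (rule continuous_on_compose2[OF vc]) (auto intro!: continuous_intros)
  have joint': "continuous_on UNIV (\<lambda>\<tau>. m (\<xi> + \<tau>))"
    unfolding m_def by (rule torus_mean_continuous_param[OF joint])
  \<comment> \<open>Averaged over all starting points the loop average becomes the torus mean, so by
    \<open>m_far\<close> every single loop average is close to it.\<close>
  have "torus_mean (\<lambda>\<tau>. m (\<xi> + \<tau>)) = torus_mean (\<lambda>\<tau>'. torus_mean (\<lambda>\<tau>. v (\<xi> + \<tau> + (\<tau>' $ 1 / (2 * pi)) *\<^sub>R l)))"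
    unfolding m_def by (rule torus_mean_swap[OF joint])
  also have "\<dots> = torus_mean v"
  proof -
    have "\<xi> + \<tau> + x = \<tau> + (\<xi> + x)" for \<tau> x by simp
    then show ?thesis by (simp only: torus_mean_translate[OF v] torus_mean_const)
  qed
  finally have "torus_mean v - m \<xi> = torus_mean (\<lambda>\<tau>. m (\<xi> + \<tau>) - m \<xi>)"
    using joint' by (simp add: torus_mean_diff torus_mean_const)
  also have "\<bar>\<dots>\<bar> \<le> L * (norm w powr \<alpha> * \<sigma> ^ (4 * i))"
    by (rule torus_mean_bound) (auto intro!: continuous_intros joint' m_far)
  finally have 1: "\<bar>torus_mean v - m \<xi>\<bar> \<le> L * (norm w powr \<alpha> * \<sigma> ^ (4 * i))" .
  have "torus_mean (\<lambda>\<tau>. v (\<xi> + (\<tau> $ 1 / (2 * pi)) *\<^sub>R (\<mu> ^ i *\<^sub>R z))) - m \<xi> =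
      torus_mean (\<lambda>\<tau>. v (\<xi> + (\<tau> $ 1 / (2 * pi)) *\<^sub>R (\<mu> ^ i *\<^sub>R z)) - v (\<xi> + (\<tau> $ 1 / (2 * pi)) *\<^sub>R l))"
    unfolding m_def by (rule torus_mean_diff[symmetric]) (rule cont)+
  also have "\<bar>\<dots>\<bar> \<le> L * (norm \<zeta> * \<bar>\<nu>\<bar> ^ i) powr \<alpha>"
  proof (rule torus_mean_bound)
    show "continuous_on UNIV (\<lambda>\<tau>. v (\<xi> + (\<tau> $ 1 / (2 * pi)) *\<^sub>R (\<mu> ^ i *\<^sub>R z)) - v (\<xi> + (\<tau> $ 1 / (2 * pi)) *\<^sub>R l))"
      by (intro continuous_on_diff cont)
    fix \<tau> :: "real^2" assume "\<tau> \<in> torus_box"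
    then have \<tau>: "\<bar>\<tau> $ 1 / (2 * pi)\<bar> \<le> 1"
      by (auto simp: mem_box_cart)
    have "l = \<mu> ^ i *\<^sub>R z + \<nu> ^ i *\<^sub>R \<zeta>"
      unfolding l_def axis1 by (simp add: Ait_add Ait_z Ait_\<zeta>)
    then have eq: "(\<xi> + (\<tau> $ 1 / (2 * pi)) *\<^sub>R (\<mu> ^ i *\<^sub>R z)) - (\<xi> + (\<tau> $ 1 / (2 * pi)) *\<^sub>R l) =
        - ((\<tau> $ 1 / (2 * pi)) *\<^sub>R \<nu> ^ i *\<^sub>R \<zeta>)"
      by (simp add: scaleR_right_distrib)
    have "norm ((\<tau> $ 1 / (2 * pi)) *\<^sub>R \<nu> ^ i *\<^sub>R \<zeta>) \<le> 1 * (\<bar>\<nu>\<bar> ^ i * norm \<zeta>)"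
      using \<tau> unfolding norm_scaleR by (intro mult_mono \<tau>) (auto simp: power_abs)
    then have "norm ((\<tau> $ 1 / (2 * pi)) *\<^sub>R \<nu> ^ i *\<^sub>R \<zeta>) powr \<alpha> \<le> (norm \<zeta> * \<bar>\<nu>\<bar> ^ i) powr \<alpha>"
      using \<alpha> by (intro powr_mono2) (auto simp: mult.commute)
    then show "\<bar>v (\<xi> + (\<tau> $ 1 / (2 * pi)) *\<^sub>R (\<mu> ^ i *\<^sub>R z)) - v (\<xi> + (\<tau> $ 1 / (2 * pi)) *\<^sub>R l)\<bar> \<le> L * (norm \<zeta> * \<bar>\<nu>\<bar> ^ i) powr \<alpha>"
      using holder[of "\<xi> + (\<tau> $ 1 / (2 * pi)) *\<^sub>R (\<mu> ^ i *\<^sub>R z)" "\<xi> + (\<tau> $ 1 / (2 * pi)) *\<^sub>R l"] L0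
      unfolding eq norm_minus_cancel by (meson mult_left_mono order_trans)
  qed
  finally have 2: "\<bar>torus_mean (\<lambda>\<tau>. v (\<xi> + (\<tau> $ 1 / (2 * pi)) *\<^sub>R (\<mu> ^ i *\<^sub>R z))) - m \<xi>\<bar> \<le> L * (norm \<zeta> powr \<alpha> * \<sigma> ^ (4 * i))"
    by (simp add: powr_decay)
  show ?thesis using 1 2 by (simp add: loop_const_def algebra_simps)
qed

definition smooth_obs :: "real \<Rightarrow> (real^2 \<Rightarrow> real) \<Rightarrow> bool" where
  "smooth_obs c v \<longleftrightarrow> torus_continuous v \<and> (\<forall>\<psi>. \<bar>v \<psi>\<bar> \<le> c) \<and> holder_const c v"

text \<open>The model is a Holder function composed with k iterates, whose constant along unstable
  lines is multiplied by the \<alpha>-th power of \<open>\<bar>\<mu>\<bar> ^ k\<close>. Along stable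
  lines only continuity is asked for.\<close>

definition unstable_obs :: "nat \<Rightarrow> real \<Rightarrow> (real^2 \<Rightarrow> real) \<Rightarrow> bool" where
  "unstable_obs k c F \<longleftrightarrow> torus_continuous F \<and> (\<forall>\<psi>. \<bar>F \<psi>\<bar> \<le> c) \<and>
    (\<forall>\<psi> t. \<bar>F (\<psi> + t *\<^sub>R z) - F \<psi>\<bar> \<le> c * (\<bar>\<mu>\<bar> ^ k * \<bar>t\<bar>) powr \<alpha>)"

text \<open>The 1 pays for shifting the first factor, \<open>loop_const\<close> for the segment
  average, and the division by \<open>\<sigma>\<^sup>2\<close> for rounding down half of an odd
  time.\<close>

definition mix_const :: real where "mix_const = (1 + loop_const) / \<sigma>\<^sup>2"

lemma loop_const_nonneg: "0 \<le> loop_const"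
  by (simp add: loop_const_def)

lemma mix_const_nonneg: "0 \<le> mix_const"
  by (simp add: mix_const_def loop_const_nonneg)

text \<open>Shifting both factors along the unstable direction by a fraction of the scale at which \<open>F\<close>
  varies leaves \<open>F\<close> almost unchanged, while \<open>v \<circ> Ait n\<close> gets averaged over a long unstable
  segment.\<close>
lemma decay_of_correlations:
  assumes F: "unstable_obs k c F" and v: "smooth_obs c' v" "torus_mean v = 0" and kn: "k \<le> n"
  shows "\<bar>torus_mean (\<lambda>\<psi>. F \<psi> * v (Ait n \<psi>))\<bar> \<le> mix_const * c * c' * \<sigma> ^ (2 * (n - k))"
proof -
  \<comment> \<open>The available time is halved. A shift by at most \<open>z\<close> divided by
    \<open>\<mu> ^ (k + j)\<close> is of relative size \<open>\<bar>\<nu>\<bar> ^ j\<close> at the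
    scale of \<open>F\<close>, and n iterates stretch it to a piece of
    \<open>\<mu> ^ i *\<^sub>R z\<close>. Freezing \<open>F\<close> thus costs
    \<open>\<sigma> ^ (4 * j)\<close>, and the segment average of \<open>v\<close> is of order
    \<open>\<sigma> ^ (4 * i)\<close>, no larger since \<open>j \<le> i\<close>.\<close>
  define j where "j = (n - k) div 2"
  define i where "i = n - k - j"
  define t where "t \<tau> = \<tau> $ 1 / (2 * pi)" for \<tau> :: "real^2"
  define s where "s \<tau> = t \<tau> / \<mu> ^ (k + j)" for \<tau> :: "real^2"
  have ij: "j \<le> i" "n = i + (k + j)" using kn by (auto simp: i_def j_def)
  have \<mu>0: "\<mu> \<noteq> 0" using \<mu> by auto
  have F': "torus_continuous F" "\<And>\<psi>. \<bar>F \<psi>\<bar> \<le> c"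
      "\<And>\<psi> t. \<bar>F (\<psi> + t *\<^sub>R z) - F \<psi>\<bar> \<le> c * (\<bar>\<mu>\<bar> ^ k * \<bar>t\<bar>) powr \<alpha>"
    using F by (auto simp: unstable_obs_def)
  have v': "torus_continuous v" "\<And>\<psi>. \<bar>v \<psi>\<bar> \<le> c'" "holder_const c' v"
    using v by (auto simp: smooth_obs_def)
  have c0: "0 \<le> c" "0 \<le> c'" using F'(2)[of 0] v'(2)[of 0] by linarith+
  note Fc = torus_continuous_cont[OF F'(1)] and vc = torus_continuous_cont[OF v'(1)]
  have Fv: "torus_continuous (\<lambda>\<psi>. F \<psi> * v (Ait n \<psi>))"
    by (intro torus_continuous_mult F' torus_continuous_Ait v')
  have st: "Ait n (s \<tau> *\<^sub>R z) = t \<tau> *\<^sub>R (\<mu> ^ i *\<^sub>R z)" for \<tau>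
    using \<mu>0 by (simp add: Ait_scale Ait_z s_def ij(2) power_add)
  have Ac: "continuous_on UNIV (\<lambda>p. Ait n (g p))" if "continuous_on UNIV g" for g :: "'x::topological_space \<Rightarrow> real^2"
    by (rule continuous_on_compose2[OF Ait_continuous that]) auto
  have sc: "continuous_on UNIV s" "continuous_on UNIV t"
    by (auto simp: s_def[abs_def] t_def[abs_def] \<mu>0 intro!: continuous_intros)
  note Fc2 = continuous_on_compose2[OF Fc] and vc2 = continuous_on_compose2[OF vc]
    and sc2 = continuous_on_compose2[OF sc(1)] and tc2 = continuous_on_compose2[OF sc(2)]
  define P where "P \<psi> \<tau> = F (\<psi> + s \<tau> *\<^sub>R z) * v (Ait n \<psi> + t \<tau> *\<^sub>R (\<mu> ^ i *\<^sub>R z))" for \<psi> \<tau>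
  define R where "R \<psi> \<tau> = F \<psi> * v (Ait n \<psi> + t \<tau> *\<^sub>R (\<mu> ^ i *\<^sub>R z))" for \<psi> \<tau>
  have Pc: "continuous_on UNIV (\<lambda>(\<tau>, \<psi>). P \<psi> \<tau>)"
    unfolding P_def case_prod_unfold
    by (intro continuous_on_mult Fc2 vc2 continuous_on_add continuous_on_scaleR Ac sc2 tc2
        continuous_on_fst continuous_on_snd continuous_on_id continuous_on_const) auto
  have Rc: "continuous_on UNIV (\<lambda>(\<tau>, \<psi>). R \<psi> \<tau>)"
    unfolding R_def case_prod_unfold
    by (intro continuous_on_mult Fc2 vc2 continuous_on_add continuous_on_scaleR Ac sc2 tc2
        continuous_on_fst continuous_on_snd continuous_on_id continuous_on_const) auto
  have sec: "continuous_on UNIV (\<lambda>\<psi>. H \<psi> \<tau>)" "continuous_on UNIV (H \<psi>)"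
      "continuous_on UNIV (\<lambda>\<tau>. torus_mean (\<lambda>\<psi>. H \<psi> \<tau>))"
      "continuous_on UNIV (\<lambda>\<psi>. torus_mean (H \<psi>))"
    if "continuous_on UNIV (\<lambda>(\<tau>, \<psi>). H \<psi> \<tau>)" for H :: "real^2 \<Rightarrow> real^2 \<Rightarrow> real" and \<psi> \<tau>
    using continuous_on_section[OF that] torus_mean_continuous_param[OF that]
      torus_mean_continuous_param[OF continuous_on_section(3)[OF that]] by simp_all
  have "torus_mean (\<lambda>\<psi>. F \<psi> * v (Ait n \<psi>)) = torus_mean (\<lambda>\<psi>. P \<psi> \<tau>)" for \<tau>
    using torus_mean_translate[OF Fv, of "s \<tau> *\<^sub>R z"] by (simp add: P_def Ait_add st)
  then have shifted: "torus_mean (\<lambda>\<psi>. F \<psi> * v (Ait n \<psi>)) = torus_mean (\<lambda>\<tau>. torus_mean (\<lambda>\<psi>. P \<psi> \<tau>))"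
    by (simp add: torus_mean_const)
  have diff: "\<bar>torus_mean (\<lambda>\<tau>. torus_mean (\<lambda>\<psi>. P \<psi> \<tau>)) - torus_mean (\<lambda>\<tau>. torus_mean (\<lambda>\<psi>. R \<psi> \<tau>))\<bar> \<le> c * c' * \<sigma> ^ (4 * j)"
  proof (subst torus_mean_diff[symmetric])
    show "\<bar>torus_mean (\<lambda>\<tau>. torus_mean (\<lambda>\<psi>. P \<psi> \<tau>) - torus_mean (\<lambda>\<psi>. R \<psi> \<tau>))\<bar> \<le> c * c' * \<sigma> ^ (4 * j)"
    proof (rule torus_mean_bound)
      show "continuous_on UNIV (\<lambda>\<tau>. torus_mean (\<lambda>\<psi>. P \<psi> \<tau>) - torus_mean (\<lambda>\<psi>. R \<psi> \<tau>))"
        by (intro continuous_on_diff sec Pc Rc)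
      fix \<tau> :: "real^2" assume "\<tau> \<in> torus_box"
      then have t: "0 \<le> t \<tau>" "t \<tau> \<le> 1" by (auto simp: mem_box_cart t_def)
      have bound: "\<bar>P \<psi> \<tau> - R \<psi> \<tau>\<bar> \<le> c * c' * \<sigma> ^ (4 * j)" for \<psi>
      proof -
        have "\<bar>\<mu>\<bar> ^ k * \<bar>s \<tau>\<bar> = t \<tau> * \<bar>\<nu>\<bar> ^ j"
        proof -
          have "\<bar>\<nu>\<bar> = 1 / \<bar>\<mu>\<bar>" using \<mu> \<mu>\<nu> by (simp add: field_simps)
          then show ?thesis using \<mu>0 t by (simp add: s_def power_add abs_mult power_abs power_divide)
        qed
        also have "\<dots> \<le> 1 * \<bar>\<nu>\<bar> ^ j" using t by (intro mult_right_mono) auto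
        finally have "(\<bar>\<mu>\<bar> ^ k * \<bar>s \<tau>\<bar>) powr \<alpha> \<le> \<sigma> ^ (4 * j)"
          unfolding \<sigma>_power4 using \<alpha> by (intro powr_mono2) auto
        then have "\<bar>F (\<psi> + s \<tau> *\<^sub>R z) - F \<psi>\<bar> \<le> c * \<sigma> ^ (4 * j)"
          using F'(3)[of \<psi> "s \<tau>"] c0 by (meson mult_left_mono order_trans)
        moreover have "P \<psi> \<tau> - R \<psi> \<tau> = (F (\<psi> + s \<tau> *\<^sub>R z) - F \<psi>) * v (Ait n \<psi> + t \<tau> *\<^sub>R (\<mu> ^ i *\<^sub>R z))"
          by (simp add: P_def R_def algebra_simps)
        ultimately have "\<bar>P \<psi> \<tau> - R \<psi> \<tau>\<bar> \<le> (c * \<sigma> ^ (4 * j)) * c'"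
          using v'(2) c0 \<sigma>_pos by (simp add: abs_mult mult_mono)
        then show ?thesis by (simp add: mult_ac)
      qed
      have "torus_mean (\<lambda>\<psi>. P \<psi> \<tau>) - torus_mean (\<lambda>\<psi>. R \<psi> \<tau>) = torus_mean (\<lambda>\<psi>. P \<psi> \<tau> - R \<psi> \<tau>)"
        by (rule torus_mean_diff[symmetric]) (intro sec Pc Rc)+
      then show "\<bar>torus_mean (\<lambda>\<psi>. P \<psi> \<tau>) - torus_mean (\<lambda>\<psi>. R \<psi> \<tau>)\<bar> \<le> c * c' * \<sigma> ^ (4 * j)"
        using torus_mean_bound[of "\<lambda>\<psi>. P \<psi> \<tau> - R \<psi> \<tau>"] bound sec(1)[OF Pc] sec(1)[OF Rc]
        by (simp add: continuous_on_diff)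
    qed
  qed (intro sec Pc Rc)+
  have "torus_mean (\<lambda>\<tau>. torus_mean (\<lambda>\<psi>. R \<psi> \<tau>)) = torus_mean (\<lambda>\<psi>. torus_mean (R \<psi>))"
    by (rule torus_mean_swap[OF Rc])
  also have "\<bar>\<dots>\<bar> \<le> c * (c' * loop_const * \<sigma> ^ (4 * i))"
  proof (rule torus_mean_bound[OF sec(4)[OF Rc]])
    fix \<psi> :: "real^2"
    have "torus_mean (R \<psi>) = F \<psi> * torus_mean (\<lambda>\<tau>. v (Ait n \<psi> + t \<tau> *\<^sub>R (\<mu> ^ i *\<^sub>R z)))"
      unfolding R_def
      by (rule torus_mean_cmult)
        (intro vc2 continuous_on_add continuous_on_scaleR tc2 continuous_on_id continuous_on_const, auto)
    moreover have "\<bar>torus_mean (\<lambda>\<tau>. v (Ait n \<psi> + t \<tau> *\<^sub>R (\<mu> ^ i *\<^sub>R z)))\<bar> \<le> c' * loop_const * \<sigma> ^ (4 * i)"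
      using unstable_segment_average[OF v'(1,3), of "Ait n \<psi>" i] v(2) by (simp add: t_def)
    ultimately show "\<bar>torus_mean (R \<psi>)\<bar> \<le> c * (c' * loop_const * \<sigma> ^ (4 * i))"
      using F'(2)[of \<psi>] c0 by (simp add: abs_mult mult_mono)
  qed
  also have "\<dots> \<le> c * (c' * loop_const * \<sigma> ^ (4 * j))"
    using c0 loop_const_nonneg \<sigma>_pos \<sigma>_less_1 ij by (intro mult_left_mono power_decreasing) auto
  finally have "\<bar>torus_mean (\<lambda>\<psi>. F \<psi> * v (Ait n \<psi>))\<bar> \<le> (1 + loop_const) * c * c' * \<sigma> ^ (4 * j)"
    using diff shifted by (simp add: algebra_simps)
  also have "\<sigma> ^ (4 * j) \<le> \<sigma> ^ (2 * (n - k)) / \<sigma>\<^sup>2"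
  proof -
    have "\<sigma> ^ (4 * j + 2) \<le> \<sigma> ^ (2 * (n - k))"
      using \<sigma>_pos \<sigma>_less_1 by (intro power_decreasing) (auto simp: j_def)
    then show ?thesis using \<sigma>_pos by (simp only: pos_le_divide_eq power_add zero_less_power)
  qed
  then have "(1 + loop_const) * c * c' * \<sigma> ^ (4 * j) \<le> (1 + loop_const) * c * c' * (\<sigma> ^ (2 * (n - k)) / \<sigma>\<^sup>2)"
    using c0 loop_const_nonneg by (intro mult_left_mono) auto
  finally show ?thesis by (simp add: mix_const_def)
qed

text \<open>Each term decays like \<open>\<sigma> ^ (2 * (n - k))\<close>. One half of the exponent
  is weakened to \<open>q ^ (n - k)\<close> and completes \<open>q ^ k\<close> to
  \<open>q ^ n\<close>; the other half makes the sum over k bounded. The weights \<open>a\<close>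
  admit plain sums as well as convolutions with powers of a contraction factor.\<close>

lemma correlation_sum:
  assumes F: "\<And>k. k < n \<Longrightarrow> unstable_obs k (c * q ^ k) (F k)" and a: "\<And>k. \<bar>a k\<bar> \<le> 1"
    and v: "smooth_obs c' v" "torus_mean v = 0" and q: "\<sigma> \<le> q" and c: "0 \<le> c"
  shows "\<bar>torus_mean (\<lambda>\<psi>. (\<Sum>k<n. a k * F k \<psi>) * v (Ait n \<psi>))\<bar> \<le> mix_const / (1 - \<sigma>) * c * c' * q ^ n"
proof -
  have c': "0 \<le> c'" using v(1) abs_ge_zero order_trans unfolding smooth_obs_def by blast
  have cont: "continuous_on UNIV (\<lambda>\<psi>. F k \<psi> * v (Ait n \<psi>))" if "k < n" for k
    using F[OF that] v
    by (intro torus_continuous_cont torus_continuous_mult torus_continuous_Ait)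
      (auto simp: unstable_obs_def smooth_obs_def)
  have "torus_mean (\<lambda>\<psi>. (\<Sum>k<n. a k * F k \<psi>) * v (Ait n \<psi>)) =
      torus_mean (\<lambda>\<psi>. \<Sum>k<n. a k * (F k \<psi> * v (Ait n \<psi>)))"
    by (simp add: sum_distrib_right mult.assoc)
  also have "\<dots> = (\<Sum>k<n. a k * torus_mean (\<lambda>\<psi>. F k \<psi> * v (Ait n \<psi>)))"
    using cont by (subst torus_mean_sum) (auto simp: torus_mean_cmult intro!: sum.cong continuous_on_mult_left)
  also have "\<bar>\<dots>\<bar> \<le> (\<Sum>k<n. mix_const * c * c' * q ^ n * \<sigma> ^ (n - k))"
  proof (rule order_trans[OF sum_abs], rule sum_mono)
    fix k assume k: "k \<in> {..<n}"
    then have "\<bar>torus_mean (\<lambda>\<psi>. F k \<psi> * v (Ait n \<psi>))\<bar> \<le> mix_const * (c * q ^ k) * c' * \<sigma> ^ (2 * (n - k))"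
      by (intro decay_of_correlations F v) auto
    also have "\<dots> = mix_const * c * c' * (q ^ k * \<sigma> ^ (n - k) * \<sigma> ^ (n - k))"
      by (simp add: mult_2 power_add)
    also have "\<dots> \<le> mix_const * c * c' * (q ^ k * q ^ (n - k) * \<sigma> ^ (n - k))"
      using mix_const_nonneg c c' \<sigma>_pos q by (intro mult_left_mono mult_right_mono power_mono) auto
    also have "q ^ k * q ^ (n - k) = q ^ n" using k by (simp flip: power_add)
    finally have "\<bar>torus_mean (\<lambda>\<psi>. F k \<psi> * v (Ait n \<psi>))\<bar> \<le> mix_const * c * c' * q ^ n * \<sigma> ^ (n - k)"
      by (simp add: mult_ac)
    moreover have "\<bar>a k * torus_mean (\<lambda>\<psi>. F k \<psi> * v (Ait n \<psi>))\<bar> \<le> \<bar>torus_mean (\<lambda>\<psi>. F k \<psi> * v (Ait n \<psi>))\<bar>"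
      unfolding abs_mult using a[of k] by (intro mult_left_le_one_le) auto
    ultimately show "\<bar>a k * torus_mean (\<lambda>\<psi>. F k \<psi> * v (Ait n \<psi>))\<bar> \<le> mix_const * c * c' * q ^ n * \<sigma> ^ (n - k)"
      by (rule order_trans[rotated])
  qed
  also have "\<dots> = mix_const * c * c' * q ^ n * (\<Sum>k<n. \<sigma> ^ (n - k))"
    by (simp add: sum_distrib_left)
  also have "\<dots> \<le> mix_const * c * c' * q ^ n * (1 / (1 - \<sigma>))"
  proof (rule mult_left_mono)
    have "(\<Sum>k<n. \<sigma> ^ (n - k)) = (\<Sum>k<n. \<sigma> ^ Suc k)"
      using sum.nat_diff_reindex[of "\<lambda>k. \<sigma> ^ Suc k" n] by (simp add: Suc_diff_Suc del: power_Suc)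
    also have "\<dots> \<le> (\<Sum>k<n. \<sigma> ^ k)"
      using \<sigma>_pos \<sigma>_less_1 by (intro sum_mono power_decreasing) auto
    also have "\<dots> \<le> 1 / (1 - \<sigma>)"
      using \<sigma>_pos \<sigma>_less_1 by (subst sum_gp_strict) (auto simp: field_simps)
    finally show "(\<Sum>k<n. \<sigma> ^ (n - k)) \<le> 1 / (1 - \<sigma>)" .
  qed (use mix_const_nonneg c c' \<sigma>_pos q in auto)
  finally show ?thesis by (simp add: mult_ac)
qed

end

section \<open>Slow drift and its invariant graph\<close>

lemma entry_time:
  fixes u :: "nat \<Rightarrow> real"
  assumes "a \<le> u 0" "a \<le> l" "0 < c" "0 < \<rho>"
    and below: "\<And>n. a \<le> u n \<Longrightarrow> u n < l \<Longrightarrow> u n + \<rho> * c \<le> u (Suc n)"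
    and above: "\<And>n. l \<le> u n \<Longrightarrow> l \<le> u (Suc n)"
    and n: "(l - a) / c \<le> \<rho> * real n"
  shows "l \<le> u n"
proof -
  \<comment> \<open>Below \<open>l\<close> the sequence climbs by at least \<open>\<rho> * c\<close>
    per step, and above it stays there; so it dominates a ramp truncated at
    \<open>l\<close>.\<close>
  have "min l (a + \<rho> * c * real n) \<le> u n" for n
  proof (induction n)
    case (Suc n)
    have "a \<le> min l (a + \<rho> * c * real n)" using assms by simp
    then have "a \<le> u n" using Suc by linarith
    show ?case
    proof (cases "u n < l")
      case True
      then have "a + \<rho> * c * real n \<le> u n" using Suc by linarith
      then have "a + \<rho> * c * real (Suc n) \<le> u (Suc n)"
        using below[OF \<open>a \<le> u n\<close> True] by (simp add: algebra_simps)
      then show ?thesis by simp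
    next
      case False
      then show ?thesis using above[of n] by simp
    qed
  qed (use assms in simp)
  from this[of n] show ?thesis
    using n \<open>0 < c\<close> by (simp add: field_simps)
qed

definition growth_const :: "real \<Rightarrow> real \<Rightarrow> real" where
  "growth_const T \<eta> = exp (6 * T + 6) / \<eta>"

text \<open>The expanding regime \<open>\<rho> n < T\<close> only costs the factor \<open>exp (6 T + 6)\<close>.\<close>
lemma two_phase_decay:
  fixes d :: "nat \<Rightarrow> real"
  assumes \<rho>: "0 < \<rho>" "\<rho> \<le> 1 / 2" and g: "0 < \<gamma>'" "\<gamma>' < g" "g \<le> 1" and T: "0 \<le> T" and E: "0 \<le> E"
    and q: "q = 1 - \<rho> * \<gamma>'"
    and d0: "0 \<le> d 0"
    and grow: "\<And>n. d (Suc n) \<le> (1 + \<rho>) * d n + \<rho> * E * q ^ n"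
    and contract: "\<And>n. T \<le> \<rho> * real n \<Longrightarrow> d (Suc n) \<le> (1 - \<rho> * g) * d n + \<rho> * E * q ^ n"
  shows "d n \<le> growth_const T (g - \<gamma>') * (d 0 + E) * q ^ n"
proof -
  have "\<rho> * \<gamma>' \<le> \<rho> * 1" using \<rho> g by (intro mult_left_mono) auto
  moreover have "0 < \<rho> * \<gamma>'" using \<rho> g by simp
  ultimately have q1: "1 - \<rho> \<le> q" "q \<le> 1" "0 < q" using \<rho> unfolding q by linarith+
  have "\<rho> * g \<le> \<rho> * 1" using \<rho> g by (intro mult_left_mono) auto
  then have p0: "0 \<le> 1 - \<rho> * g" using \<rho> by linarith
  define X where "X = d 0 + E"
  have X: "0 \<le> X" "E \<le> X" using d0 E by (auto simp: X_def)
  \<comment> \<open>Because \<open>q ^ n \<le> 1\<close>, the forcing merely raises the growth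
    factor from \<open>1 + \<rho>\<close> to \<open>1 + 2 * \<rho>\<close>.\<close>
  have grown: "d n \<le> X * (1 + 2 * \<rho>) ^ n" for n
  proof (induction n)
    case (Suc n)
    have "E * q ^ n \<le> X * (1 + 2 * \<rho>) ^ n"
    proof (rule mult_mono)
      have "q ^ n \<le> 1" using q1 by (simp add: power_le_one)
      also have "1 \<le> (1 + 2 * \<rho>) ^ n" using \<rho> by (intro one_le_power) auto
      finally show "q ^ n \<le> (1 + 2 * \<rho>) ^ n" .
    qed (use X E q1 in auto)
    then have "\<rho> * (E * q ^ n) \<le> \<rho> * (X * (1 + 2 * \<rho>) ^ n)" using \<rho> by (intro mult_left_mono) auto
    moreover have "(1 + \<rho>) * d n \<le> (1 + \<rho>) * (X * (1 + 2 * \<rho>) ^ n)" using Suc \<rho> by (intro mult_left_mono) auto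
    ultimately show ?case using grow[of n] by (simp add: algebra_simps)
  qed (use E in \<open>simp add: X_def\<close>)
  \<comment> \<open>The 6 comes from 1 + 2 \<rho> \<le> (1 + 6 \<rho>) (1 - \<rho>), valid for
    \<rho> \<le> 1/2. The regime is extended from \<open>T\<close> to \<open>T + 1\<close> so that a
    step ending beyond it starts after \<open>T\<close>.\<close>
  have early: "(1 + 2 * \<rho>) ^ n \<le> exp (6 * T + 6) * q ^ n" if n: "\<rho> * real n \<le> T + 1" for n
  proof -
    have "\<rho> * (2 * \<rho>) \<le> \<rho> * 1" using \<rho> by (intro mult_left_mono) auto
    then have "1 + 2 * \<rho> \<le> (1 + 6 * \<rho>) * (1 - \<rho>)" by (simp add: algebra_simps)
    also have "\<dots> \<le> exp (6 * \<rho>) * q" using \<rho> q1 by (intro mult_mono exp_ge_add_one_self) auto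
    finally have "(1 + 2 * \<rho>) ^ n \<le> (exp (6 * \<rho>) * q) ^ n" using \<rho> by (intro power_mono) auto
    also have "\<dots> = exp (6 * (\<rho> * real n)) * q ^ n"
      by (simp add: power_mult_distrib exp_of_nat_mult[symmetric] mult_ac)
    also have "\<dots> \<le> exp (6 * T + 6) * q ^ n" using n q1 by (intro mult_right_mono) auto
    finally show ?thesis .
  qed
  \<comment> \<open>\<open>Y\<close> dominates both \<open>exp (6 * T + 6) * X\<close> and
    \<open>E / (g - \<gamma>')\<close>. The second property makes \<open>Y * q ^ n\<close> a
    supersolution, as 1 - \<rho> g + \<rho> (g - \<gamma>') equals \<open>q\<close>.\<close>
  define Y where "Y = growth_const T (g - \<gamma>') * X"
  have "1 \<le> exp (6 * T + 6)" using T by simp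
  have YX: "exp (6 * T + 6) * X \<le> Y"
  proof -
    have "exp (6 * T + 6) * X * (g - \<gamma>') \<le> exp (6 * T + 6) * X * 1"
      using X g by (intro mult_left_mono) auto
    then show ?thesis using g by (simp add: Y_def growth_const_def pos_le_divide_eq)
  qed
  have EY: "E \<le> Y * (g - \<gamma>')"
  proof -
    have "1 * E \<le> exp (6 * T + 6) * X" using X E \<open>1 \<le> exp (6 * T + 6)\<close> by (intro mult_mono) auto
    also have "\<dots> = Y * (g - \<gamma>')" using g by (simp add: Y_def growth_const_def)
    finally show ?thesis by simp
  qed
  have "d n \<le> Y * q ^ n" for n
  proof -
    have early': "d n \<le> Y * q ^ n" if "\<rho> * real n \<le> T + 1" for n
    proof -
      have "d n \<le> X * (exp (6 * T + 6) * q ^ n)"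
        using grown[of n] early[OF that] X by (meson mult_left_mono order_trans)
      also have "\<dots> = (exp (6 * T + 6) * X) * q ^ n" by simp
      also have "\<dots> \<le> Y * q ^ n" using YX q1 by (intro mult_right_mono) auto
      finally show ?thesis .
    qed
    show ?thesis
    proof (induction n)
      case 0
      then show ?case using early'[of 0] T by simp
    next
      case (Suc n)
      show ?case
      proof (cases "\<rho> * real (Suc n) \<le> T + 1")
        case False
        then have "T \<le> \<rho> * real n" using \<rho> by (simp add: algebra_simps)
        then have "d (Suc n) \<le> (1 - \<rho> * g) * d n + \<rho> * E * q ^ n" by (rule contract)
        also have "\<dots> \<le> (1 - \<rho> * g) * (Y * q ^ n) + \<rho> * (Y * (g - \<gamma>')) * q ^ n"
          using Suc p0 EY \<rho> q1 by (intro add_mono mult_left_mono mult_right_mono) auto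
        also have "\<dots> = Y * q ^ Suc n" by (simp add: q algebra_simps)
        finally show ?thesis .
      qed (rule early')
    qed
  qed
  then show ?thesis by (simp add: Y_def X_def)
qed

text \<open>The zero curve enters only through the strip between \<open>Sm\<close> and
  \<open>SM\<close>: slopes at most - \<gamma> inside, a definite sign of \<open>f\<close> on either
  side. The derivative bounds hold on the whole real line, so they apply to segments that leave the
  strip.\<close>

locale drift = toral_mixing A B \<mu> \<nu> r z \<zeta> w \<alpha> \<sigma>
  for A B :: "real^2^2" and \<mu> \<nu> r :: real and z \<zeta> w :: "real^2" and \<alpha> \<sigma> :: real +
  fixes f f1 f2 f3 :: "real \<Rightarrow> real^2 \<Rightarrow> real" and K \<gamma> \<phi>m \<phi>M Sm SM :: real
  assumes D0: "\<And>\<phi> \<psi>. ((\<lambda>x. f x \<psi>) has_real_derivative f1 \<phi> \<psi>) (at \<phi>)"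
    and D1: "\<And>\<phi> \<psi>. ((\<lambda>x. f1 x \<psi>) has_real_derivative f2 \<phi> \<psi>) (at \<phi>)"
    and D2: "\<And>\<phi> \<psi>. ((\<lambda>x. f2 x \<psi>) has_real_derivative f3 \<phi> \<psi>) (at \<phi>)"
    and f_le: "\<And>\<phi> \<psi>. \<bar>f \<phi> \<psi>\<bar> \<le> 1" and f1_le: "\<And>\<phi> \<psi>. \<bar>f1 \<phi> \<psi>\<bar> \<le> 1"
    and f2_le: "\<And>\<phi> \<psi>. \<bar>f2 \<phi> \<psi>\<bar> \<le> 1" and f3_le: "\<And>\<phi> \<psi>. \<bar>f3 \<phi> \<psi>\<bar> \<le> 1"
    and K: "1 \<le> K"
    and f_holder: "\<And>\<phi>. holder_const K (f \<phi>)" and f1_holder: "\<And>\<phi>. holder_const K (f1 \<phi>)"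
    and f2_holder: "\<And>\<phi>. holder_const K (f2 \<phi>)"
    and f_per: "\<And>\<phi>. torus_periodic (f \<phi>)" and f1_per: "\<And>\<phi>. torus_periodic (f1 \<phi>)"
    and \<gamma>: "0 < \<gamma>" "\<gamma> \<le> 1"
    and S: "\<phi>m \<le> Sm" "Sm \<le> 0" "0 \<le> SM" "SM \<le> \<phi>M"
    and f1_neg: "\<And>\<phi> \<psi>. Sm \<le> \<phi> \<Longrightarrow> \<phi> \<le> SM \<Longrightarrow> f1 \<phi> \<psi> \<le> - \<gamma>"
    and f_pos: "\<And>\<phi> \<psi>. \<phi>m \<le> \<phi> \<Longrightarrow> \<phi> < Sm \<Longrightarrow> 0 < f \<phi> \<psi>" and f_Sm: "\<And>\<psi>. 0 \<le> f Sm \<psi>"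
    and f_neg: "\<And>\<phi> \<psi>. SM < \<phi> \<Longrightarrow> \<phi> \<le> \<phi>M \<Longrightarrow> f \<phi> \<psi> < 0" and f_SM: "\<And>\<psi>. f SM \<psi> \<le> 0"
    and mean_f0: "torus_mean (f 0) = 0"
begin

section \<open>Mean value estimates in the slow variable\<close>

lemma mean_value:
  assumes "\<And>x. (g has_real_derivative g' x) (at x)"
  obtains \<xi> where "\<xi> \<in> closed_segment v u" "g u - g v = g' \<xi> * (u - v)"
proof -
  consider "v < u" | "u < v" | "u = v" by linarith
  then show thesis
  proof cases
    case 1
    then obtain \<xi> where "v < \<xi>" "\<xi> < u" "g u - g v = (u - v) * g' \<xi>" using MVT2[of v u g g'] assms by blast
    then show thesis using that[of \<xi>] by (auto simp: closed_segment_eq_real_ivl)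
  next
    case 2
    then obtain \<xi> where "u < \<xi>" "\<xi> < v" "g v - g u = (v - u) * g' \<xi>" using MVT2[of u v g g'] assms by blast
    then show thesis using that[of \<xi>] by (auto simp: closed_segment_eq_real_ivl algebra_simps)
  qed (use that[of u] in auto)
qed

lemma lipschitz_of_deriv:
  assumes "\<And>x. (g has_real_derivative g' x) (at x)" "\<And>x. \<bar>g' x\<bar> \<le> c"
  shows "\<bar>g u - g v\<bar> \<le> c * \<bar>u - v\<bar>"
proof -
  obtain \<xi> where "g u - g v = g' \<xi> * (u - v)" using mean_value[OF assms(1)] by blast
  then show ?thesis using assms(2)[of \<xi>] by (simp add: abs_mult mult_right_mono)
qed

lemma f_lip: "\<bar>f u \<psi> - f v \<psi>\<bar> \<le> \<bar>u - v\<bar>" and f1_lip: "\<bar>f1 u \<psi> - f1 v \<psi>\<bar> \<le> \<bar>u - v\<bar>"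
  and f2_lip: "\<bar>f2 u \<psi> - f2 v \<psi>\<bar> \<le> \<bar>u - v\<bar>"
  using lipschitz_of_deriv[OF D0 f1_le] lipschitz_of_deriv[OF D1 f2_le] lipschitz_of_deriv[OF D2 f3_le]
  by simp_all

text \<open>Outside the strip the slope bound degrades by at most the distance to it, since
  \<open>f1\<close> is 1-Lipschitz. The clause for every \<delta> stays inside the conclusion so
  that one slope serves the expanding and the contracting regime.\<close>

lemma f_slope:
  obtains a where "f u \<psi> - f v \<psi> = a * (u - v)" "\<bar>a\<bar> \<le> 1"
    "\<And>\<delta>. Sm - \<delta> \<le> u \<Longrightarrow> u \<le> SM + \<delta> \<Longrightarrow> Sm - \<delta> \<le> v \<Longrightarrow> v \<le> SM + \<delta> \<Longrightarrow> 0 \<le> \<delta> \<Longrightarrow> a \<le> - \<gamma> + \<delta>"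
proof -
  obtain \<xi> where \<xi>: "\<xi> \<in> closed_segment v u" "f u \<psi> - f v \<psi> = f1 \<xi> \<psi> * (u - v)"
    using mean_value[OF D0] by blast
  show thesis
  proof (rule that[OF \<xi>(2) f1_le])
    fix \<delta> assume *: "Sm - \<delta> \<le> u" "u \<le> SM + \<delta>" "Sm - \<delta> \<le> v" "v \<le> SM + \<delta>" "0 \<le> \<delta>"
    have "Sm - \<delta> \<le> \<xi>" "\<xi> \<le> SM + \<delta>"
      using \<xi>(1) * by (auto simp: closed_segment_eq_real_ivl split: if_splits)
    define x where "x = max Sm (min SM \<xi>)"
    have "Sm \<le> x" "x \<le> SM" "\<bar>\<xi> - x\<bar> \<le> \<delta>"
      using \<open>Sm - \<delta> \<le> \<xi>\<close> \<open>\<xi> \<le> SM + \<delta>\<close> S * by (auto simp: x_def)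
    then show "f1 \<xi> \<psi> \<le> - \<gamma> + \<delta>"
      using f1_neg[of x \<psi>] f1_lip[of \<xi> \<psi> x] by linarith
  qed
qed

text \<open>Mean value theorem in \<open>d\<close> for a difference of two translates. Both factors
  of the bound matter: in the applications one carries the decay in time, the other smallness or
  unstable regularity.\<close>

lemma cross_difference:
  "\<bar>f (u + d) \<psi> - f u \<psi> - (f (u' + d) \<psi> - f u' \<psi>)\<bar> \<le> \<bar>d\<bar> * \<bar>u - u'\<bar>"
proof -
  have D: "((\<lambda>d. f (u + d) \<psi> - f (u' + d) \<psi>) has_real_derivative f1 (u + x) \<psi> - f1 (u' + x) \<psi>) (at x)" for x
    by (intro DERIV_diff DERIV_chain'[OF _ D0, where f = "\<lambda>x. u + x", THEN DERIV_cong]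
        DERIV_chain'[OF _ D0, where f = "\<lambda>x. u' + x", THEN DERIV_cong])
      (auto intro!: derivative_eq_intros)
  have "\<bar>f1 (u + x) \<psi> - f1 (u' + x) \<psi>\<bar> \<le> \<bar>u - u'\<bar>" for x
    using f1_lip[of "u + x" \<psi> "u' + x"] by simp
  from lipschitz_of_deriv[OF D this, of d 0] show ?thesis by (simp add: mult.commute)
qed

lemma cross_difference_f1:
  "\<bar>f1 (u + d) \<psi> - f1 u \<psi> - (f1 (u' + d) \<psi> - f1 u' \<psi>)\<bar> \<le> \<bar>d\<bar> * \<bar>u - u'\<bar>"
proof -
  have D: "((\<lambda>d. f1 (u + d) \<psi> - f1 (u' + d) \<psi>) has_real_derivative f2 (u + x) \<psi> - f2 (u' + x) \<psi>) (at x)" for x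
    by (intro DERIV_diff DERIV_chain'[OF _ D1, where f = "\<lambda>x. u + x", THEN DERIV_cong]
        DERIV_chain'[OF _ D1, where f = "\<lambda>x. u' + x", THEN DERIV_cong])
      (auto intro!: derivative_eq_intros)
  have "\<bar>f2 (u + x) \<psi> - f2 (u' + x) \<psi>\<bar> \<le> \<bar>u - u'\<bar>" for x
    using f2_lip[of "u + x" \<psi> "u' + x"] by simp
  from lipschitz_of_deriv[OF D this, of d 0] show ?thesis by (simp add: mult.commute)
qed

text \<open>The mean value theorem runs in the slow variable with both fast points fixed. Holder
  continuity of the derivative gives a constant proportional to |u - v|, so differences of
  \<open>f\<close> inherit the decay of the slow distance in their Holder constants too.\<close>

lemma holder_difference:
  "\<bar>f u \<psi>' - f v \<psi>' - (f u \<psi> - f v \<psi>)\<bar> \<le> K * \<bar>u - v\<bar> * norm (\<psi>' - \<psi>) powr \<alpha>"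
  "\<bar>f1 u \<psi>' - f1 v \<psi>' - (f1 u \<psi> - f1 v \<psi>)\<bar> \<le> K * \<bar>u - v\<bar> * norm (\<psi>' - \<psi>) powr \<alpha>"
proof -
  have "\<bar>f1 x \<psi>' - f1 x \<psi>\<bar> \<le> K * norm (\<psi>' - \<psi>) powr \<alpha>" "\<bar>f2 x \<psi>' - f2 x \<psi>\<bar> \<le> K * norm (\<psi>' - \<psi>) powr \<alpha>" for x
    using f1_holder f2_holder by (auto simp: holder_const_def)
  from lipschitz_of_deriv[OF DERIV_diff[OF D0 D0] this(1), of u v]
    lipschitz_of_deriv[OF DERIV_diff[OF D1 D1] this(2), of u v]
  show "\<bar>f u \<psi>' - f v \<psi>' - (f u \<psi> - f v \<psi>)\<bar> \<le> K * \<bar>u - v\<bar> * norm (\<psi>' - \<psi>) powr \<alpha>"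
    "\<bar>f1 u \<psi>' - f1 v \<psi>' - (f1 u \<psi> - f1 v \<psi>)\<bar> \<le> K * \<bar>u - v\<bar> * norm (\<psi>' - \<psi>) powr \<alpha>"
    by (simp_all add: algebra_simps)
qed

lemma joint_continuous:
  fixes g :: "real \<Rightarrow> real^2 \<Rightarrow> real"
  assumes lip: "\<And>u v \<psi>. \<bar>g u \<psi> - g v \<psi>\<bar> \<le> \<bar>u - v\<bar>" and hol: "\<And>u. holder_const K (g u)"
  shows "continuous_on UNIV (\<lambda>(u, \<psi>). g u \<psi>)"
  unfolding continuous_on_def
proof
  fix p0 :: "real \<times> (real^2)"
  define a b where "a = fst p0" and "b = snd p0"
  have "((\<lambda>p. \<bar>fst p - a\<bar> + K * norm (snd p - b) powr \<alpha>) \<longlongrightarrow> \<bar>fst p0 - a\<bar> + K * norm (snd p0 - b) powr \<alpha>) (at p0)"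
    using \<alpha> by (intro tendsto_intros) auto
  then have lim: "((\<lambda>p. \<bar>fst p - a\<bar> + K * norm (snd p - b) powr \<alpha>) \<longlongrightarrow> 0) (at p0)"
    by (simp add: a_def b_def)
  have le: "norm (g (fst p) (snd p) - g a b) \<le> \<bar>fst p - a\<bar> + K * norm (snd p - b) powr \<alpha>" for p
  proof -
    have "\<bar>g a (snd p) - g a b\<bar> \<le> K * norm (snd p - b) powr \<alpha>"
      using hol[of a] by (simp add: holder_const_def)
    then show ?thesis
      using lip[of "fst p" "snd p" a] by simp
  qed
  have "((\<lambda>p. g (fst p) (snd p) - g a b) \<longlongrightarrow> 0) (at p0)"
    by (rule Lim_null_comparison[OF always_eventually lim]) (use le in blast)
  then show "((\<lambda>(u, \<psi>). g u \<psi>) \<longlongrightarrow> (case p0 of (u, \<psi>) \<Rightarrow> g u \<psi>)) (at p0 within UNIV)"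
    by (simp add: LIM_zero_iff a_def b_def case_prod_unfold)
qed

lemma torus_continuous_comp_gen:
  fixes g :: "real \<Rightarrow> real^2 \<Rightarrow> real"
  assumes c: "continuous_on UNIV (\<lambda>(u, \<psi>). g u \<psi>)" and per: "\<And>u. torus_periodic (g u)"
    and h: "torus_continuous h"
  shows "torus_continuous (\<lambda>\<psi>. g (h \<psi>) (Ait n \<psi>))"
proof (rule torus_continuousI)
  show "continuous_on UNIV (\<lambda>\<psi>. g (h \<psi>) (Ait n \<psi>))"
    using continuous_on_compose2[OF c continuous_on_Pair[OF torus_continuous_cont[OF h] Ait_continuous]] by simp
next
  fix \<psi> i
  have "torus_continuous (g u)" for u
    using per continuous_on_section(1)[OF c] by (simp add: torus_continuous_def)
  from torus_continuous_period[OF torus_continuous_Ait[OF this]]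
  show "g (h (\<psi> + axis i (2 * pi))) (Ait n (\<psi> + axis i (2 * pi))) = g (h \<psi>) (Ait n \<psi>)"
    by (simp add: torus_continuous_period[OF h])
qed

lemmas f_comp = torus_continuous_comp_gen[OF joint_continuous[OF f_lip f_holder] f_per]
  and f1_comp = torus_continuous_comp_gen[OF joint_continuous[OF f1_lip f1_holder] f1_per]

lemma f_torus: "torus_continuous (f \<phi>)" and f1_torus: "torus_continuous (f1 \<phi>)"
  using f_comp[OF torus_continuous_const[of \<phi>], of 0] f1_comp[OF torus_continuous_const[of \<phi>], of 0]
  by simp_all

definition K' :: real where "K' = K * norm z powr \<alpha>"

lemma K'_nonneg: "0 \<le> K'"
  using K by (simp add: K'_def)

lemma holder_along_z:
  assumes "holder_const L v"
  shows "\<bar>v (Ait n (\<psi> + t *\<^sub>R z)) - v (Ait n \<psi>)\<bar> \<le> L * norm z powr \<alpha> * (\<bar>\<mu>\<bar> ^ n * \<bar>t\<bar>) powr \<alpha>"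
  using assms[unfolded holder_const_def, rule_format, of "Ait n (\<psi> + t *\<^sub>R z)" "Ait n \<psi>"]
  by (simp only: norm_shift_along_z mult.assoc)

definition \<rho>_max :: real where "\<rho>_max = (1 - \<sigma>) / 2"

lemma \<rho>_max_pos: "0 < \<rho>_max" and \<rho>_max_le: "\<rho>_max \<le> 1 / 2"
  using \<sigma>_pos \<sigma>_less_1 by (simp_all add: \<rho>_max_def)

text \<open>\<open>1 + 2 * \<rho>\<close> bounds the growth of an unstable Holder constant in one
  slow step, forcing included, and \<open>\<sigma> ^ 4\<close> is gained by looking one step back.
  The net factor is at most \<open>1 - \<rho> \<le> q\<close>, so such constants can even decay like
  \<open>q ^ n\<close>.\<close>

lemma \<sigma>_step: assumes "0 < \<rho>" "\<rho> < \<rho>_max" shows "\<sigma> ^ 4 * (1 + 2 * \<rho>) \<le> 1 - \<rho>"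
proof -
  have \<rho>: "\<rho> \<le> (1 - \<sigma>) / 2" using assms by (simp add: \<rho>_max_def)
  have "\<sigma> ^ 4 \<le> \<sigma> ^ 2" using \<sigma>_pos \<sigma>_less_1 by (intro power_decreasing) auto
  moreover have "\<sigma>\<^sup>2 * (2 - \<sigma>) \<le> \<sigma>"
  proof -
    have "0 \<le> \<sigma> * (1 - \<sigma>)\<^sup>2" using \<sigma>_pos by simp
    then show ?thesis by (simp add: power2_eq_square algebra_simps)
  qed
  moreover have "\<sigma> ^ 4 * (1 + 2 * \<rho>) \<le> \<sigma>\<^sup>2 * (2 - \<sigma>)"
    using \<rho> \<open>\<sigma> ^ 4 \<le> \<sigma> ^ 2\<close> assms by (intro mult_mono) auto
  moreover have "\<sigma> \<le> 1 - \<rho>" using \<rho> \<sigma>_less_1 by simp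
  ultimately show ?thesis by (meson order_trans)
qed

section \<open>The graph transform and its fixed point\<close>

definition slow_manifold :: "real \<Rightarrow> (real^2 \<Rightarrow> real) \<Rightarrow> bool" where
  "slow_manifold \<rho> W \<longleftrightarrow> torus_continuous W \<and> (\<forall>\<psi>. Sm \<le> W \<psi> \<and> W \<psi> \<le> SM) \<and>
    (\<forall>\<psi>. W (A *v \<psi>) = W \<psi> + \<rho> * f (W \<psi>) \<psi>) \<and>
    (\<forall>\<psi> t. \<bar>W (\<psi> + t *\<^sub>R z) - W \<psi>\<bar> \<le> K' * \<bar>t\<bar> powr \<alpha>)"

lemma fibre_contraction:
  assumes "0 < \<rho>" "\<rho> \<le> 1" "Sm \<le> u" "u \<le> SM" "Sm \<le> v" "v \<le> SM"
  shows "\<bar>u + \<rho> * f u \<psi> - (v + \<rho> * f v \<psi>)\<bar> \<le> (1 - \<rho> * \<gamma>) * \<bar>u - v\<bar>"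
proof -
  obtain a where a: "f u \<psi> - f v \<psi> = a * (u - v)" "\<bar>a\<bar> \<le> 1" "a \<le> - \<gamma>"
    using f_slope[of u \<psi> v] assms by (metis add.right_neutral diff_zero order_refl)
  have "u + \<rho> * f u \<psi> - (v + \<rho> * f v \<psi>) = (1 + \<rho> * a) * (u - v)"
  proof -
    have "u + \<rho> * f u \<psi> - (v + \<rho> * f v \<psi>) = (u - v) + \<rho> * (f u \<psi> - f v \<psi>)"
      by (simp add: algebra_simps)
    then show ?thesis unfolding a(1) by (simp add: algebra_simps)
  qed
  moreover have "0 \<le> 1 + \<rho> * a"
  proof -
    have "\<rho> * (- a) \<le> 1 * 1" using a(2,3) \<gamma> assms by (intro mult_mono) auto
    then show ?thesis by simp
  qed
  moreover have "\<rho> * a \<le> \<rho> * (- \<gamma>)" using a(3) assms by (intro mult_left_mono) auto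
  ultimately show ?thesis by (simp add: abs_mult mult_right_mono)
qed

text \<open>With \<rho> \<le> 1 and |f1| \<le> 1 the slow map preserves order, so a barrier that is
  pushed inwards at its own position is never crossed outwards.\<close>

lemma step_mono:
  assumes "0 < \<rho>" "\<rho> \<le> 1" "v \<le> u"
  shows "v + \<rho> * f v \<psi> \<le> u + \<rho> * f u \<psi>"
proof -
  have "\<rho> * (f v \<psi> - f u \<psi>) \<le> \<rho> * (u - v)" using f_lip[of v \<psi> u] assms by (intro mult_left_mono) auto
  also have "\<dots> \<le> 1 * (u - v)" using assms by (intro mult_right_mono) auto
  finally show ?thesis by (simp add: algebra_simps)
qed

text \<open>Iterate the graph transform from the zero graph. Monotonicity keeps the iterates in the
  strip, where the fibre maps contract by \<open>1 - \<rho> * \<gamma>\<close>, so they converge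
  uniformly. The unstable Holder bound holds for every iterate with the same \<open>K'\<close>,
  independent of \<rho>, and passes to the limit.\<close>

lemma slow_manifold_exists:
  assumes \<rho>: "0 < \<rho>" "\<rho> < \<rho>_max"
  obtains W where "slow_manifold \<rho> W"
proof -
  have \<rho>1: "\<rho> \<le> 1" using \<rho> \<rho>_max_le by linarith
  define G where "G V = (\<lambda>\<psi>. V (B *v \<psi>) + \<rho> * f (V (B *v \<psi>)) (B *v \<psi>))" for V
  define V where "V n = (G ^^ n) (\<lambda>\<psi>. 0)" for n
  have V_Suc: "V (Suc n) \<psi> = V n (B *v \<psi>) + \<rho> * f (V n (B *v \<psi>)) (B *v \<psi>)" for n \<psi>
    by (simp add: V_def G_def)
  have cont: "torus_continuous (V n)" for n
  proof (induction n)
    case 0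
    then show ?case by (simp add: V_def torus_continuous_const)
  next
    case (Suc n)
    have "torus_continuous (\<lambda>\<psi>. V n \<psi> + \<rho> * f (V n \<psi>) (Ait 0 \<psi>))"
      by (intro torus_continuous_add torus_continuous_mult torus_continuous_const f_comp Suc)
    from torus_continuous_matrix[OF this B_int] show ?case
      by (simp add: V_Suc[abs_def])
  qed
  have range: "Sm \<le> V n \<psi> \<and> V n \<psi> \<le> SM" for n \<psi>
  proof (induction n arbitrary: \<psi>)
    case (Suc n)
    have "Sm + \<rho> * f Sm (B *v \<psi>) \<le> V (Suc n) \<psi>" "V (Suc n) \<psi> \<le> SM + \<rho> * f SM (B *v \<psi>)"
      unfolding V_Suc using Suc by (auto intro!: step_mono \<rho> \<rho>1)
    moreover have "0 \<le> \<rho> * f Sm (B *v \<psi>)" "\<rho> * f SM (B *v \<psi>) \<le> 0"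
      using \<rho> f_Sm f_SM by (auto simp: mult_nonneg_nonpos)
    ultimately show ?case by linarith
  qed (use S in \<open>simp add: V_def\<close>)
  have "0 < \<rho> * \<gamma>" "\<rho> * \<gamma> \<le> 1" using \<rho> \<rho>1 \<gamma> by (auto intro: mult_le_one)
  then have p: "0 \<le> 1 - \<rho> * \<gamma>" "1 - \<rho> * \<gamma> < 1" by auto
  have step: "\<bar>V (Suc n) \<psi> - V n \<psi>\<bar> \<le> (SM - Sm) * (1 - \<rho> * \<gamma>) ^ n" for n \<psi>
  proof (induction n arbitrary: \<psi>)
    case 0
    then show ?case using range[of 0 \<psi>] range[of 1 \<psi>] by (simp add: abs_le_iff)
  next
    case (Suc n)
    have "\<bar>V (Suc (Suc n)) \<psi> - V (Suc n) \<psi>\<bar> \<le> (1 - \<rho> * \<gamma>) * \<bar>V (Suc n) (B *v \<psi>) - V n (B *v \<psi>)\<bar>"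
      unfolding V_Suc[of "Suc n"] V_Suc[of n \<psi>] using range
      by (intro fibre_contraction \<rho> \<rho>1) auto
    also have "\<dots> \<le> (1 - \<rho> * \<gamma>) * ((SM - Sm) * (1 - \<rho> * \<gamma>) ^ n)"
      using Suc p by (intro mult_left_mono) auto
    finally show ?case by (simp add: mult_ac)
  qed
  define W where "W \<psi> = (\<Sum>n. V (Suc n) \<psi> - V n \<psi>)" for \<psi>
  have "uniform_limit UNIV (\<lambda>n \<psi>. \<Sum>i<n. V (Suc i) \<psi> - V i \<psi>) W sequentially"
    unfolding W_def
    by (rule Weierstrass_m_test[of UNIV _ "\<lambda>n. (SM - Sm) * (1 - \<rho> * \<gamma>) ^ n"])
      (use step p in \<open>auto intro!: summable_mult summable_geometric\<close>)
  moreover have "(\<Sum>i<n. V (Suc i) \<psi> - V i \<psi>) = V n \<psi>" for n \<psi>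
    using sum_lessThan_telescope[of "\<lambda>i. V i \<psi>" n] by (simp add: V_def)
  ultimately have lim: "uniform_limit UNIV V W sequentially"
    by (simp add: fun_eq_iff[symmetric, of "V _"])
  have ptw: "(\<lambda>n. V n \<psi>) \<longlonglongrightarrow> W \<psi>" for \<psi>
    by (rule tendsto_uniform_limitI[OF lim]) simp
  have Wc: "continuous_on UNIV W"
    by (rule uniform_limit_theorem[OF _ lim]) (auto intro!: always_eventually torus_continuous_cont cont)
  have "slow_manifold \<rho> W"
    unfolding slow_manifold_def
  proof (intro conjI allI)
    show "torus_continuous W"
    proof (rule torus_continuousI[OF Wc])
      fix \<psi> i
      show "W (\<psi> + axis i (2 * pi)) = W \<psi>"
        using LIMSEQ_unique[OF ptw[of "\<psi> + axis i (2 * pi)"]] ptw[of \<psi>]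
        by (simp add: torus_continuous_period[OF cont])
    qed
    show "Sm \<le> W \<psi>" "W \<psi> \<le> SM" for \<psi>
      using range by (auto intro: LIMSEQ_le_const[OF ptw] LIMSEQ_le_const2[OF ptw])
    show "W (A *v \<psi>) = W \<psi> + \<rho> * f (W \<psi>) \<psi>" for \<psi>
    proof (rule LIMSEQ_unique[OF LIMSEQ_Suc[OF ptw]])
      have eq: "V (Suc n) (A *v \<psi>) = V n \<psi> + \<rho> * f (V n \<psi>) \<psi>" for n
        by (simp add: V_Suc matrix_vector_mul_assoc BA)
      have "isCont (\<lambda>x. f x \<psi>) (W \<psi>)" by (rule DERIV_isCont[OF D0])
      then have "(\<lambda>n. f (V n \<psi>) \<psi>) \<longlonglongrightarrow> f (W \<psi>) \<psi>" by (rule isCont_tendsto_compose[OF _ ptw])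
      then show "(\<lambda>n. V (Suc n) (A *v \<psi>)) \<longlonglongrightarrow> W \<psi> + \<rho> * f (W \<psi>) \<psi>"
        unfolding eq by (intro tendsto_intros ptw)
    qed
    have V_unstable: "\<bar>V n (\<psi> + t *\<^sub>R z) - V n \<psi>\<bar> \<le> K' * \<bar>t\<bar> powr \<alpha>" for n \<psi> t
    proof (induction n arbitrary: \<psi> t)
      case 0
      then show ?case using K'_nonneg by (simp add: V_def)
    next
      case (Suc n)
      have \<mu>0: "\<mu> \<noteq> 0" using \<mu> by auto
      have "\<mu> *\<^sub>R (B *v z) = z"
        using arg_cong[OF Az, of "(*v) B"] by (simp add: matrix_vector_mult_scaleR matrix_vector_mul_assoc BA)
      then have Bz: "B *v (\<psi> + t *\<^sub>R z) = B *v \<psi> + (t / \<mu>) *\<^sub>R z"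
      proof -
        have "t *\<^sub>R (B *v z) = (t / \<mu>) *\<^sub>R (\<mu> *\<^sub>R (B *v z))" using \<mu>0 by simp
        then show ?thesis
          unfolding \<open>\<mu> *\<^sub>R (B *v z) = z\<close> by (simp add: matrix_vector_right_distrib matrix_vector_mult_scaleR)
      qed
      define \<psi>\<^sub>1 where "\<psi>\<^sub>1 = B *v \<psi>"
      define s where "s = t / \<mu>"
      let ?u = "V n (\<psi>\<^sub>1 + s *\<^sub>R z)" and ?v = "V n \<psi>\<^sub>1"
      have "V (Suc n) (\<psi> + t *\<^sub>R z) - V (Suc n) \<psi> = (?u - ?v) + \<rho> * (f ?u (\<psi>\<^sub>1 + s *\<^sub>R z) - f ?v (\<psi>\<^sub>1 + s *\<^sub>R z)) +
          \<rho> * (f ?v (\<psi>\<^sub>1 + s *\<^sub>R z) - f ?v \<psi>\<^sub>1)"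
        unfolding V_Suc Bz \<psi>\<^sub>1_def s_def by (simp add: algebra_simps)
      also have "\<bar>\<dots>\<bar> \<le> \<bar>?u - ?v\<bar> + \<rho> * \<bar>?u - ?v\<bar> + \<rho> * (K' * \<bar>s\<bar> powr \<alpha>)"
      proof -
        have "\<bar>\<rho> * (f ?u (\<psi>\<^sub>1 + s *\<^sub>R z) - f ?v (\<psi>\<^sub>1 + s *\<^sub>R z))\<bar> \<le> \<rho> * \<bar>?u - ?v\<bar>"
          using f_lip \<rho> by (simp add: abs_mult)
        moreover have "\<bar>\<rho> * (f ?v (\<psi>\<^sub>1 + s *\<^sub>R z) - f ?v \<psi>\<^sub>1)\<bar> \<le> \<rho> * (K' * \<bar>s\<bar> powr \<alpha>)"
          using holder_along_z[OF f_holder, where n = 0, of ?v \<psi>\<^sub>1 s] \<rho> by (simp add: abs_mult K'_def)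
        ultimately show ?thesis by linarith
      qed
      \<comment> \<open>The variation of \<open>f\<close> in the fast variable has the constant
        \<open>K'\<close> as well, so it counts as one more \<rho> in the growth factor of the same
        constant.\<close>
      also have "\<dots> \<le> (1 + 2 * \<rho>) * (K' * \<bar>s\<bar> powr \<alpha>)"
      proof -
        have "(1 + \<rho>) * \<bar>?u - ?v\<bar> \<le> (1 + \<rho>) * (K' * \<bar>s\<bar> powr \<alpha>)"
          using Suc[of \<psi>\<^sub>1 s] \<rho> by (intro mult_left_mono) auto
        then show ?thesis by (simp add: algebra_simps)
      qed
      also have "\<bar>s\<bar> powr \<alpha> = \<bar>t\<bar> powr \<alpha> * \<sigma> ^ 4"
      proof -
        have "\<bar>s\<bar> = \<bar>t\<bar> * \<bar>\<nu>\<bar> ^ 1"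
        proof -
          have "\<bar>\<nu>\<bar> = 1 / \<bar>\<mu>\<bar>" using \<mu>0 \<mu>\<nu> by (simp add: field_simps)
          then show ?thesis by (simp add: s_def)
        qed
        then show ?thesis using powr_decay[of "\<bar>t\<bar>" 1] by simp
      qed
      also have "(1 + 2 * \<rho>) * (K' * (\<bar>t\<bar> powr \<alpha> * \<sigma> ^ 4)) = (\<sigma> ^ 4 * (1 + 2 * \<rho>)) * (K' * \<bar>t\<bar> powr \<alpha>)"
        by simp
      also have "\<dots> \<le> 1 * (K' * \<bar>t\<bar> powr \<alpha>)"
        using \<sigma>_step[OF \<rho>] \<rho> K'_nonneg by (intro mult_right_mono) auto
      finally show ?case by simp
    qed
    show "\<bar>W (\<psi> + t *\<^sub>R z) - W \<psi>\<bar> \<le> K' * \<bar>t\<bar> powr \<alpha>" for \<psi> t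
      by (rule LIMSEQ_le_const2[OF tendsto_rabs[OF tendsto_diff[OF ptw ptw]]]) (use V_unstable in auto)
  qed
  then show thesis by (rule that)
qed

text \<open>Every point is the n-th image of its n-th preimage, so the distance of two invariant
  graphs there is at most the width of the strip times the n-th power of the contraction factor, for
  all n. The argument is pointwise because a competitor need not be continuous.\<close>

lemma slow_manifold_unique:
  assumes \<rho>: "0 < \<rho>" "\<rho> \<le> 1"
    and W: "\<And>\<psi>. Sm \<le> W \<psi> \<and> W \<psi> \<le> SM" "\<And>\<psi>. W (A *v \<psi>) = W \<psi> + \<rho> * f (W \<psi>) \<psi>"
    and V: "\<And>\<psi>. Sm \<le> V \<psi> \<and> V \<psi> \<le> SM" "\<And>\<psi>. V (A *v \<psi>) = V \<psi> + \<rho> * f (V \<psi>) \<psi>"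
  shows "W = V"
proof
  fix \<psi>
  have "0 < \<rho> * \<gamma>" "\<rho> * \<gamma> \<le> 1" using \<rho> \<gamma> by (auto intro: mult_le_one)
  then have p: "0 \<le> 1 - \<rho> * \<gamma>" "1 - \<rho> * \<gamma> < 1" by auto
  have "\<bar>W (Ait n \<psi>) - V (Ait n \<psi>)\<bar> \<le> (1 - \<rho> * \<gamma>) ^ n * (SM - Sm)" for n \<psi>
  proof (induction n)
    case 0
    then show ?case using W(1)[of \<psi>] V(1)[of \<psi>] by (simp add: abs_le_iff)
  next
    case (Suc n)
    have "\<bar>W (Ait (Suc n) \<psi>) - V (Ait (Suc n) \<psi>)\<bar> \<le> (1 - \<rho> * \<gamma>) * \<bar>W (Ait n \<psi>) - V (Ait n \<psi>)\<bar>"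
      using W V fibre_contraction[OF \<rho>] by simp
    also have "\<dots> \<le> (1 - \<rho> * \<gamma>) * ((1 - \<rho> * \<gamma>) ^ n * (SM - Sm))"
      using Suc p by (intro mult_left_mono) auto
    finally show ?case by (simp add: mult_ac)
  qed
  from this[of _ "((*v) B ^^ _) \<psi>"]
  have "\<bar>W \<psi> - V \<psi>\<bar> \<le> (1 - \<rho> * \<gamma>) ^ n * (SM - Sm)" for n
    by (metis Ait_inverse)
  moreover have "(\<lambda>n. (1 - \<rho> * \<gamma>) ^ n * (SM - Sm)) \<longlonglongrightarrow> 0"
    using p by (intro tendsto_mult_left_zero LIMSEQ_power_zero) auto
  ultimately have "\<bar>W \<psi> - V \<psi>\<bar> \<le> 0"
    by (intro LIMSEQ_le_const) auto
  then show "W \<psi> = V \<psi>" by simp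
qed

section \<open>Absorption of the orbits into the contracting strip\<close>

primrec orbit :: "real \<Rightarrow> real \<Rightarrow> nat \<Rightarrow> real^2 \<Rightarrow> real" where
  "orbit \<rho> \<phi> 0 \<psi> = \<phi>"
| "orbit \<rho> \<phi> (Suc n) \<psi> = orbit \<rho> \<phi> n \<psi> + \<rho> * f (orbit \<rho> \<phi> n \<psi>) (Ait n \<psi>)"

primrec mean_orbit :: "real \<Rightarrow> real \<Rightarrow> nat \<Rightarrow> real" where
  "mean_orbit \<rho> \<phi> 0 = \<phi>"
| "mean_orbit \<rho> \<phi> (Suc n) = mean_orbit \<rho> \<phi> n + \<rho> * torus_mean (f (mean_orbit \<rho> \<phi> n))"

text \<open>\<open>T\<close> is measured in slow time \<rho> n; this lets one value serve all step
  sizes, starting points and fast points.\<close>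

definition absorbed :: "real \<Rightarrow> real \<Rightarrow> bool" where
  "absorbed \<delta> T \<longleftrightarrow> (\<forall>\<rho> \<phi> n \<psi>. 0 < \<rho> \<longrightarrow> \<rho> \<le> 1 \<longrightarrow> \<phi>m \<le> \<phi> \<longrightarrow> \<phi> \<le> \<phi>M \<longrightarrow> T \<le> \<rho> * real n \<longrightarrow>
    Sm - \<delta> \<le> orbit \<rho> \<phi> n \<psi> \<and> orbit \<rho> \<phi> n \<psi> \<le> SM + \<delta> \<and> \<bar>mean_orbit \<rho> \<phi> n\<bar> \<le> \<delta>)"

text \<open>\<open>s\<close> is a sign, for use on either side of the strip. Compactness of interval
  times box gives a positive minimum, which periodicity extends to all fast points.\<close>

lemma compact_lower_bound:
  assumes pos: "\<And>\<phi> \<psi>. a \<le> \<phi> \<Longrightarrow> \<phi> \<le> b \<Longrightarrow> 0 < s * f \<phi> \<psi>"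
  obtains c where "0 < c" "\<And>\<phi> \<psi>. a \<le> \<phi> \<Longrightarrow> \<phi> \<le> b \<Longrightarrow> c \<le> s * f \<phi> \<psi>"
proof (cases "a \<le> b")
  case False
  then show thesis using that[of 1] by auto
next
  case True
  have "\<exists>p\<in>{a..b} \<times> torus_box. \<forall>p'\<in>{a..b} \<times> torus_box. s * (\<lambda>(u, \<psi>). f u \<psi>) p \<le> s * (\<lambda>(u, \<psi>). f u \<psi>) p'"
  proof (rule continuous_attains_inf)
    show "compact ({a..b} \<times> torus_box)" by (intro compact_Times compact_Icc compact_cbox)
    have "0 \<in> torus_box" by (simp add: mem_box_cart)
    then show "{a..b} \<times> torus_box \<noteq> {}" using True by auto
    show "continuous_on ({a..b} \<times> torus_box) (\<lambda>p. s * (\<lambda>(u, \<psi>). f u \<psi>) p)"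
      by (intro continuous_on_mult_left continuous_on_subset[OF joint_continuous[OF f_lip f_holder]]) auto
  qed
  then obtain u \<psi>\<^sub>1 where m: "a \<le> u" "u \<le> b"
      "\<And>u' \<psi>'. a \<le> u' \<Longrightarrow> u' \<le> b \<Longrightarrow> \<psi>' \<in> torus_box \<Longrightarrow> s * f u \<psi>\<^sub>1 \<le> s * f u' \<psi>'"
    by fastforce
  show thesis
  proof (rule that)
    show "0 < s * f u \<psi>\<^sub>1" using pos m by auto
    fix \<phi> \<psi> assume "a \<le> \<phi>" "\<phi> \<le> b"
    obtain \<psi>\<^sub>0 where "\<psi>\<^sub>0 \<in> torus_box" "f \<phi> \<psi> = f \<phi> \<psi>\<^sub>0"
      using torus_box_representative[of \<psi>] f_per by metis
    then show "s * f u \<psi>\<^sub>1 \<le> s * f \<phi> \<psi>" using m \<open>a \<le> \<phi>\<close> \<open>\<phi> \<le> b\<close> by auto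
  qed
qed

lemma mean_step_mono:
  assumes "0 < \<rho>" "\<rho> \<le> 1" "v \<le> u"
  shows "v + \<rho> * torus_mean (f v) \<le> u + \<rho> * torus_mean (f u)"
proof -
  have "torus_mean (\<lambda>\<psi>. v + \<rho> * f v \<psi>) \<le> torus_mean (\<lambda>\<psi>. u + \<rho> * f u \<psi>)"
    using assms by (intro torus_mean_mono step_mono continuous_intros torus_continuous_cont f_torus)
  then show ?thesis
    by (simp add: torus_mean_add torus_mean_cmult torus_mean_const torus_continuous_cont[OF f_torus]
        continuous_on_mult_left)
qed

lemma torus_mean_f_lower: "(\<And>\<psi>. c \<le> f u \<psi>) \<Longrightarrow> c \<le> torus_mean (f u)"
  using torus_mean_mono[of "\<lambda>\<psi>. c" "f u"] torus_continuous_cont[OF f_torus] by (simp add: torus_mean_const)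

lemma torus_mean_f_upper: "(\<And>\<psi>. f u \<psi> \<le> c) \<Longrightarrow> torus_mean (f u) \<le> c"
  using torus_mean_mono[of "f u" "\<lambda>\<psi>. c"] torus_continuous_cont[OF f_torus] by (simp add: torus_mean_const)

text \<open>The mean of \<open>f 0\<close> vanishes, so the averaged drift is the mean of
  \<open>f u \<psi> - f 0 \<psi>\<close>, whose slope is at most - \<gamma> + \<delta> \<le> -
  \<gamma> / 2.\<close>

lemma mean_drift_slope:
  assumes "0 \<le> \<delta>" "\<delta> \<le> \<gamma> / 2"
  shows "Sm - \<delta> \<le> u \<Longrightarrow> u \<le> 0 \<Longrightarrow> \<gamma> / 2 * (- u) \<le> torus_mean (f u)"
    and "u \<le> SM + \<delta> \<Longrightarrow> 0 \<le> u \<Longrightarrow> torus_mean (f u) \<le> \<gamma> / 2 * (- u)"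
proof -
  have eq: "torus_mean (f u) = torus_mean (\<lambda>\<psi>. f u \<psi> - f 0 \<psi>)"
    using torus_mean_diff[of "f u" "f 0"] torus_continuous_cont[OF f_torus] mean_f0 by simp
  have c: "continuous_on UNIV (\<lambda>\<psi>. f u \<psi> - f 0 \<psi>)"
    by (intro continuous_intros torus_continuous_cont f_torus)
  {
    assume u: "Sm - \<delta> \<le> u" "u \<le> 0"
    have "\<gamma> / 2 * (- u) \<le> f u \<psi> - f 0 \<psi>" for \<psi>
    proof -
      obtain a where a: "f u \<psi> - f 0 \<psi> = a * (u - 0)" "a \<le> - \<gamma> + \<delta>"
        using f_slope[of u \<psi> 0] u S assms by (smt (verit))
      have "(\<gamma> / 2) * (- u) \<le> (- a) * (- u)" using a(2) assms u by (intro mult_right_mono) auto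
      then show ?thesis using a(1) by simp
    qed
    then show "\<gamma> / 2 * (- u) \<le> torus_mean (f u)"
      unfolding eq using torus_mean_mono[OF continuous_on_const c, of "\<gamma> / 2 * (- u)"] by (simp add: torus_mean_const)
  }
  {
    assume u: "u \<le> SM + \<delta>" "0 \<le> u"
    have "f u \<psi> - f 0 \<psi> \<le> \<gamma> / 2 * (- u)" for \<psi>
    proof -
      obtain a where a: "f u \<psi> - f 0 \<psi> = a * (u - 0)" "a \<le> - \<gamma> + \<delta>"
        using f_slope[of u \<psi> 0] u S assms by (smt (verit))
      have "a * u \<le> (- \<gamma> / 2) * u" using a(2) assms u by (intro mult_right_mono) auto
      then show ?thesis using a(1) by simp
    qed
    then show "torus_mean (f u) \<le> \<gamma> / 2 * (- u)"
      unfolding eq using torus_mean_mono[OF c continuous_on_const, of "\<gamma> / 2 * (- u)"] by (simp add: torus_mean_const)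
  }
qed

text \<open>There are four barriers: below and above, for the true and for the averaged orbit. At
  distance \<delta> from the strip compactness gives a positive speed to both; closer to it the
  averaged drift still points to 0, with speed at least \<open>\<gamma> / 2 * \<delta>\<close> at
  distance \<delta> from 0. The barriers are clipped to the interval because the sign of
  \<open>f\<close> is known only there.\<close>

lemma absorption:
  assumes \<delta>: "0 < \<delta>" "\<delta> \<le> \<gamma> / 2"
  obtains T where "0 \<le> T" "absorbed \<delta> T"
proof -
  obtain c1 where c1: "0 < c1" "\<And>\<phi> \<psi>. \<phi>m \<le> \<phi> \<Longrightarrow> \<phi> \<le> Sm - \<delta> \<Longrightarrow> c1 \<le> f \<phi> \<psi>"
    using compact_lower_bound[of \<phi>m "Sm - \<delta>" 1] f_pos \<delta> by auto
  obtain c2 where c2: "0 < c2" "\<And>\<phi> \<psi>. SM + \<delta> \<le> \<phi> \<Longrightarrow> \<phi> \<le> \<phi>M \<Longrightarrow> c2 \<le> - f \<phi> \<psi>"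
    using compact_lower_bound[of "SM + \<delta>" \<phi>M "-1"] f_neg \<delta> by auto
  define c where "c = min (min c1 c2) (\<gamma> / 2 * \<delta>)"
  have c: "0 < c" "c \<le> c1" "c \<le> c2" "c \<le> \<gamma> / 2 * \<delta>" using c1 c2 \<gamma> \<delta> by (auto simp: c_def)
  \<comment> \<open>Width over minimal speed: enough slow time for any of the four
    crossings.\<close>
  define T where "T = (\<phi>M - \<phi>m) / c"
  have T: "(l - a) / c \<le> T" if "l - a \<le> \<phi>M - \<phi>m" for l a
    unfolding T_def using that c by (intro divide_right_mono) auto
  have f_pos': "0 \<le> f u \<psi>" if "\<phi>m \<le> u" "u \<le> Sm" for u \<psi>
    using f_pos[of u \<psi>] f_Sm[of \<psi>] that by (cases "u = Sm") auto
  have f_neg': "f u \<psi> \<le> 0" if "SM \<le> u" "u \<le> \<phi>M" for u \<psi>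
    using f_neg[of u \<psi>] f_SM[of \<psi>] that by (cases "u = SM") auto
  have "absorbed \<delta> T"
    unfolding absorbed_def
  proof (intro allI impI)
    fix \<rho> \<phi> n \<psi>
    assume \<rho>: "0 < \<rho>" "\<rho> \<le> (1::real)" and \<phi>: "\<phi>m \<le> \<phi>" "\<phi> \<le> \<phi>M" and n: "T \<le> \<rho> * real n"
    have "max \<phi>m (Sm - \<delta>) \<le> orbit \<rho> \<phi> n \<psi>"
    proof (rule entry_time[of \<phi>m _ _ c \<rho>])
      fix n
      let ?u = "orbit \<rho> \<phi> n \<psi>"
      { assume "\<phi>m \<le> ?u" "?u < max \<phi>m (Sm - \<delta>)"
        then have "c \<le> f ?u (Ait n \<psi>)" using c1(2)[of ?u "Ait n \<psi>"] c by linarith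
        then show "?u + \<rho> * c \<le> orbit \<rho> \<phi> (Suc n) \<psi>" using \<rho> by simp }
      { assume u: "max \<phi>m (Sm - \<delta>) \<le> ?u"
        have "0 \<le> \<rho> * f (max \<phi>m (Sm - \<delta>)) (Ait n \<psi>)" using \<rho> S \<delta> by (intro mult_nonneg_nonneg f_pos') auto
        then show "max \<phi>m (Sm - \<delta>) \<le> orbit \<rho> \<phi> (Suc n) \<psi>"
          using step_mono[OF \<rho> u, of "Ait n \<psi>"] unfolding orbit.simps by linarith }
    qed (use \<phi> c \<rho> S \<delta> n T[of "max \<phi>m (Sm - \<delta>)" \<phi>m] in auto)
    moreover have "- min \<phi>M (SM + \<delta>) \<le> - orbit \<rho> \<phi> n \<psi>"
    proof (rule entry_time[of "- \<phi>M" "\<lambda>n. - orbit \<rho> \<phi> n \<psi>" _ c \<rho>])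
      fix n
      let ?u = "orbit \<rho> \<phi> n \<psi>"
      { assume "- \<phi>M \<le> - ?u" "- ?u < - min \<phi>M (SM + \<delta>)"
        then have "c \<le> - f ?u (Ait n \<psi>)" using c2(2)[of ?u "Ait n \<psi>"] c by linarith
        then have "\<rho> * c \<le> \<rho> * (- f ?u (Ait n \<psi>))" using \<rho> by (intro mult_left_mono) auto
        then show "- ?u + \<rho> * c \<le> - orbit \<rho> \<phi> (Suc n) \<psi>" by simp }
      { assume "- min \<phi>M (SM + \<delta>) \<le> - ?u"
        then have u: "?u \<le> min \<phi>M (SM + \<delta>)" by simp
        have "\<rho> * f (min \<phi>M (SM + \<delta>)) (Ait n \<psi>) \<le> 0" using \<rho> S \<delta> by (intro mult_nonneg_nonpos f_neg') auto
        then show "- min \<phi>M (SM + \<delta>) \<le> - orbit \<rho> \<phi> (Suc n) \<psi>"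
          using step_mono[OF \<rho> u, of "Ait n \<psi>"] unfolding orbit.simps by linarith }
    qed (use \<phi> c \<rho> S \<delta> n T[of "- min \<phi>M (SM + \<delta>)" "- \<phi>M"] in auto)
    moreover have "max \<phi>m (- \<delta>) \<le> mean_orbit \<rho> \<phi> n"
    proof (rule entry_time[of \<phi>m _ _ c \<rho>])
      fix n
      let ?u = "mean_orbit \<rho> \<phi> n"
      { assume u: "\<phi>m \<le> ?u" "?u < max \<phi>m (- \<delta>)"
        have "c \<le> torus_mean (f ?u)"
        proof (cases "?u \<le> Sm - \<delta>")
          case True
          then show ?thesis using torus_mean_f_lower[of c1 ?u] c1(2)[of ?u] u c by force
        next
          case False
          have "?u \<le> - \<delta>" using u by linarith
          moreover then have "\<gamma> / 2 * \<delta> \<le> \<gamma> / 2 * (- ?u)" using \<gamma> by (intro mult_left_mono) auto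
          ultimately show ?thesis using mean_drift_slope(1)[of \<delta> ?u] \<delta> c False by linarith
        qed
        then show "?u + \<rho> * c \<le> mean_orbit \<rho> \<phi> (Suc n)" using \<rho> by simp }
      { assume u: "max \<phi>m (- \<delta>) \<le> ?u"
        have "0 \<le> torus_mean (f (max \<phi>m (- \<delta>)))"
        proof (cases "Sm - \<delta> \<le> max \<phi>m (- \<delta>)")
          case True
          have "0 \<le> \<gamma> / 2 * (- max \<phi>m (- \<delta>))" using \<gamma> S \<delta> by (intro mult_nonneg_nonneg) auto
          moreover have "max \<phi>m (- \<delta>) \<le> 0" using S \<delta> by auto
          ultimately show ?thesis using mean_drift_slope(1)[of \<delta> "max \<phi>m (- \<delta>)"] \<delta> True by linarith
        next
          case False
          then show ?thesis using S by auto
        qed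
        then have "0 \<le> \<rho> * torus_mean (f (max \<phi>m (- \<delta>)))" using \<rho> by simp
        then show "max \<phi>m (- \<delta>) \<le> mean_orbit \<rho> \<phi> (Suc n)"
          using mean_step_mono[OF \<rho> u] unfolding mean_orbit.simps by linarith }
    qed (use \<phi> c \<rho> S \<delta> n T[of "max \<phi>m (- \<delta>)" \<phi>m] in auto)
    moreover have "- min \<phi>M \<delta> \<le> - mean_orbit \<rho> \<phi> n"
    proof (rule entry_time[of "- \<phi>M" "\<lambda>n. - mean_orbit \<rho> \<phi> n" _ c \<rho>])
      fix n
      let ?u = "mean_orbit \<rho> \<phi> n"
      { assume u: "- \<phi>M \<le> - ?u" "- ?u < - min \<phi>M \<delta>"
        have "torus_mean (f ?u) \<le> - c"
        proof (cases "SM + \<delta> \<le> ?u")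
          case True
          then have "f ?u \<psi> \<le> - c2" for \<psi> using c2(2)[of ?u \<psi>] u by auto
          then show ?thesis using torus_mean_f_upper[of ?u "- c2"] c by force
        next
          case False
          have "\<delta> \<le> ?u" using u by linarith
          moreover then have "\<gamma> / 2 * \<delta> \<le> \<gamma> / 2 * ?u" using \<gamma> by (intro mult_left_mono) auto
          ultimately show ?thesis using mean_drift_slope(2)[of \<delta> ?u] \<delta> c False by linarith
        qed
        then have "\<rho> * torus_mean (f ?u) \<le> \<rho> * (- c)" using \<rho> by (intro mult_left_mono) auto
        then show "- ?u + \<rho> * c \<le> - mean_orbit \<rho> \<phi> (Suc n)" by simp }
      { assume "- min \<phi>M \<delta> \<le> - ?u"
        then have u: "?u \<le> min \<phi>M \<delta>" by simp
        have "torus_mean (f (min \<phi>M \<delta>)) \<le> 0"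
        proof -
          have "0 \<le> \<gamma> / 2 * min \<phi>M \<delta>" using \<gamma> S \<delta> by (intro mult_nonneg_nonneg) auto
          moreover have "min \<phi>M \<delta> \<le> SM + \<delta>" "0 \<le> min \<phi>M \<delta>" using S \<delta> by auto
          ultimately show ?thesis using mean_drift_slope(2)[of \<delta> "min \<phi>M \<delta>"] \<delta> by linarith
        qed
        then have "\<rho> * torus_mean (f (min \<phi>M \<delta>)) \<le> 0" using \<rho> by (simp add: mult_nonneg_nonpos)
        then show "- min \<phi>M \<delta> \<le> - mean_orbit \<rho> \<phi> (Suc n)"
          using mean_step_mono[OF \<rho> u] unfolding mean_orbit.simps by linarith }
    qed (use \<phi> c \<rho> S \<delta> n T[of "- min \<phi>M \<delta>" "- \<phi>M"] in auto)
    ultimately show "Sm - \<delta> \<le> orbit \<rho> \<phi> n \<psi> \<and> orbit \<rho> \<phi> n \<psi> \<le> SM + \<delta> \<and> \<bar>mean_orbit \<rho> \<phi> n\<bar> \<le> \<delta>"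
      by (auto simp: abs_le_iff)
  qed
  moreover have "0 \<le> T" using c S by (simp add: T_def)
  ultimately show thesis using that by blast
qed

end

section \<open>Deviation from the averaged motion\<close>

context toral_mixing
begin

definition stretch :: real where "stretch = 1 + norm z powr \<alpha>"

definition summed_mix :: real where "summed_mix = mix_const / (1 - \<sigma>)"

lemma stretch_ge_1: "1 \<le> stretch" and summed_mix_nonneg: "0 \<le> summed_mix"
  using mix_const_nonneg \<sigma>_less_1 by (auto simp: stretch_def summed_mix_def)

lemma smooth_obs_nonneg: "smooth_obs c v \<Longrightarrow> 0 \<le> c"
  unfolding smooth_obs_def using abs_ge_zero order_trans by blast

lemma smooth_imp_unstable:
  assumes "smooth_obs c v" shows "unstable_obs k (stretch * c) (\<lambda>\<psi>. v (Ait k \<psi>))"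
  unfolding unstable_obs_def
proof (intro conjI allI)
  have c0: "0 \<le> c" by (rule smooth_obs_nonneg[OF assms])
  have v: "torus_continuous v" "\<And>\<psi>. \<bar>v \<psi>\<bar> \<le> c" "\<And>\<psi> \<psi>'. \<bar>v \<psi>' - v \<psi>\<bar> \<le> c * norm (\<psi>' - \<psi>) powr \<alpha>"
    using assms by (auto simp: smooth_obs_def holder_const_def)
  show "torus_continuous (\<lambda>\<psi>. v (Ait k \<psi>))" by (rule torus_continuous_Ait[OF v(1)])
  have "1 * c \<le> stretch * c" using stretch_ge_1 c0 by (intro mult_right_mono) auto
  then show "\<bar>v (Ait k \<psi>)\<bar> \<le> stretch * c" for \<psi> using v(2)[of "Ait k \<psi>"] by simp
  fix \<psi> t
  have "\<bar>v (Ait k (\<psi> + t *\<^sub>R z)) - v (Ait k \<psi>)\<bar> \<le> c * norm z powr \<alpha> * (\<bar>\<mu>\<bar> ^ k * \<bar>t\<bar>) powr \<alpha>"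
    using v(3)[where \<psi>' = "Ait k (\<psi> + t *\<^sub>R z)" and \<psi> = "Ait k \<psi>"]
    by (simp only: norm_shift_along_z mult.assoc)
  also have "\<dots> \<le> stretch * c * (\<bar>\<mu>\<bar> ^ k * \<bar>t\<bar>) powr \<alpha>"
    using c0 by (intro mult_right_mono) (auto simp: stretch_def algebra_simps)
  finally show "\<bar>v (Ait k (\<psi> + t *\<^sub>R z)) - v (Ait k \<psi>)\<bar> \<le> stretch * c * (\<bar>\<mu>\<bar> ^ k * \<bar>t\<bar>) powr \<alpha>" .
qed

section \<open>Response of a linear recursion to centred forcing\<close>

primrec relax :: "real \<Rightarrow> real \<Rightarrow> (nat \<Rightarrow> real^2 \<Rightarrow> real) \<Rightarrow> nat \<Rightarrow> real^2 \<Rightarrow> real" where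
  "relax \<rho> p h 0 \<psi> = 0"
| "relax \<rho> p h (Suc n) \<psi> = p * relax \<rho> p h n \<psi> + \<rho> * h n (Ait n \<psi>)"

lemma relax_eq_sum: "relax \<rho> p h n \<psi> = \<rho> * (\<Sum>k<n. p ^ (n - Suc k) * h k (Ait k \<psi>))"
proof (induction n)
  case (Suc n)
  have "(\<Sum>k<n. p ^ (n - k) * h k (Ait k \<psi>)) = p * (\<Sum>k<n. p ^ (n - Suc k) * h k (Ait k \<psi>))"
    unfolding sum_distrib_left
    by (rule sum.cong) (auto simp: Suc_diff_Suc simp flip: power_Suc mult.assoc)
  then show ?case using Suc by (simp add: algebra_simps)
qed simp

lemma relax_torus: "(\<And>k. torus_continuous (h k)) \<Longrightarrow> torus_continuous (relax \<rho> p h n)"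
  unfolding relax_eq_sum[abs_def] by (intro torus_continuous_intros torus_continuous_Ait)

definition relax_const :: "real \<Rightarrow> real \<Rightarrow> real" where
  "relax_const \<eta> c = c * sqrt ((2 * stretch * summed_mix + 1) / (\<eta> * \<sigma>))"

lemma relax_const_nonneg: "0 \<le> c \<Longrightarrow> 0 < \<eta> \<Longrightarrow> 0 \<le> relax_const \<eta> c"
  using stretch_ge_1 summed_mix_nonneg \<sigma>_pos by (auto simp: relax_const_def)

text \<open>Squaring the recursion gives \<open>p\<^sup>2\<close> times the old square, a cross term
  and \<open>\<rho>\<^sup>2\<close> times the squared forcing. The cross term pairs \<rho> times a
  sum of earlier forcings with the present one, so by mixing it is of order
  \<open>\<rho>\<^sup>2\<close> too. Balanced against \<open>Q\<^sup>2 - p\<^sup>2\<close>, of order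
  \<rho>, this leaves a square mean of order \<rho>. Stationary forcing takes \<open>Q = 1\<close>,
  decaying forcing \<open>Q = q\<close>.\<close>

lemma relax_L2:
  assumes \<rho>: "0 < \<rho>" "\<rho> \<le> 1" and p: "0 \<le> p" "p \<le> Q - \<rho> * \<eta>" and Q: "\<sigma> \<le> Q" "Q \<le> 1"
    and \<eta>: "0 < \<eta>" and c: "0 \<le> c"
    and h: "\<And>k. smooth_obs (c * Q ^ k) (h k)" "\<And>k. torus_mean (h k) = 0"
  shows "torus_L2 (relax \<rho> p h n) \<le> relax_const \<eta> c * sqrt \<rho> * Q ^ n"
proof -
  have Q0: "0 < Q" using Q \<sigma>_pos by linarith
  have p1: "p \<le> 1" using p Q \<rho> \<eta> by (smt (verit) mult_pos_pos)
  have ht: "torus_continuous (h k)" for k using h(1) by (auto simp: smooth_obs_def)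
  note Mt = relax_torus[of h, OF ht]
  note cont = torus_continuous_cont[OF Mt] torus_continuous_cont[OF torus_continuous_Ait[OF ht]]
  define S where "S = c\<^sup>2 * (2 * stretch * summed_mix + 1)"
  have S0: "0 \<le> S" using stretch_ge_1 summed_mix_nonneg by (simp add: S_def)
  have corr: "\<bar>torus_mean (\<lambda>\<psi>. relax \<rho> p h n \<psi> * h n (Ait n \<psi>))\<bar> \<le> \<rho> * (summed_mix * stretch * c\<^sup>2 * Q ^ (2 * n))" for n
  proof -
    have "\<bar>torus_mean (\<lambda>\<psi>. (\<Sum>k<n. p ^ (n - Suc k) * h k (Ait k \<psi>)) * h n (Ait n \<psi>))\<bar>
        \<le> mix_const / (1 - \<sigma>) * (stretch * c) * (c * Q ^ n) * Q ^ n"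
    proof (rule correlation_sum[OF _ _ h])
      show "unstable_obs k (stretch * c * Q ^ k) (\<lambda>\<psi>. h k (Ait k \<psi>))" for k
        using smooth_imp_unstable[OF h(1)] by (simp add: mult.assoc)
      show "\<bar>p ^ (n - Suc k)\<bar> \<le> 1" for k using p p1 by (simp add: power_abs power_le_one)
    qed (use Q stretch_ge_1 c in auto)
    also have "mix_const / (1 - \<sigma>) * (stretch * c) * (c * Q ^ n) * Q ^ n = summed_mix * stretch * c\<^sup>2 * Q ^ (2 * n)"
      by (simp add: summed_mix_def power2_eq_square mult_2 power_add)
    finally have "\<rho> * \<bar>torus_mean (\<lambda>\<psi>. (\<Sum>k<n. p ^ (n - Suc k) * h k (Ait k \<psi>)) * h n (Ait n \<psi>))\<bar>
        \<le> \<rho> * (summed_mix * stretch * c\<^sup>2 * Q ^ (2 * n))"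
      using \<rho> by (intro mult_left_mono) auto
    moreover have "torus_mean (\<lambda>\<psi>. relax \<rho> p h n \<psi> * h n (Ait n \<psi>)) =
        \<rho> * torus_mean (\<lambda>\<psi>. (\<Sum>k<n. p ^ (n - Suc k) * h k (Ait k \<psi>)) * h n (Ait n \<psi>))"
      unfolding relax_eq_sum mult.assoc by (rule torus_mean_cmult) (intro continuous_intros cont)
    ultimately show ?thesis
      using \<rho> by (simp add: abs_mult)
  qed
  have "torus_mean (\<lambda>\<psi>. (relax \<rho> p h n \<psi>)\<^sup>2) \<le> S / (\<eta> * \<sigma>) * \<rho> * Q ^ (2 * n)" for n
  proof (induction n)
    case 0
    then show ?case using S0 \<eta> \<sigma>_pos \<rho> by (simp add: torus_mean_const)
  next
    case (Suc n)
    have "torus_mean (\<lambda>\<psi>. (relax \<rho> p h (Suc n) \<psi>)\<^sup>2) =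
        torus_mean (\<lambda>\<psi>. p\<^sup>2 * (relax \<rho> p h n \<psi>)\<^sup>2 + 2 * p * \<rho> * (relax \<rho> p h n \<psi> * h n (Ait n \<psi>)) + \<rho>\<^sup>2 * (h n (Ait n \<psi>))\<^sup>2)"
      by (rule arg_cong[of _ _ torus_mean]) (auto simp: power2_eq_square algebra_simps)
    also have "\<dots> = p\<^sup>2 * torus_mean (\<lambda>\<psi>. (relax \<rho> p h n \<psi>)\<^sup>2)
        + 2 * p * \<rho> * torus_mean (\<lambda>\<psi>. relax \<rho> p h n \<psi> * h n (Ait n \<psi>)) + \<rho>\<^sup>2 * torus_mean (\<lambda>\<psi>. (h n (Ait n \<psi>))\<^sup>2)"
      by (simp add: torus_mean_add torus_mean_cmult cont continuous_on_add continuous_on_mult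
          continuous_on_mult_left continuous_on_power del: relax.simps)
    also have "\<dots> \<le> p\<^sup>2 * (S / (\<eta> * \<sigma>) * \<rho> * Q ^ (2 * n)) + 2 * \<rho> * (\<rho> * (summed_mix * stretch * c\<^sup>2 * Q ^ (2 * n))) + \<rho>\<^sup>2 * (c\<^sup>2 * Q ^ (2 * n))"
    proof (intro add_mono)
      show "p\<^sup>2 * torus_mean (\<lambda>\<psi>. (relax \<rho> p h n \<psi>)\<^sup>2) \<le> p\<^sup>2 * (S / (\<eta> * \<sigma>) * \<rho> * Q ^ (2 * n))"
        using Suc by (intro mult_left_mono) auto
      have "2 * p * \<rho> * torus_mean (\<lambda>\<psi>. relax \<rho> p h n \<psi> * h n (Ait n \<psi>))
          \<le> 2 * p * \<rho> * \<bar>torus_mean (\<lambda>\<psi>. relax \<rho> p h n \<psi> * h n (Ait n \<psi>))\<bar>"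
        using p \<rho> by (intro mult_left_mono) auto
      also have "\<dots> \<le> 2 * 1 * \<rho> * \<bar>torus_mean (\<lambda>\<psi>. relax \<rho> p h n \<psi> * h n (Ait n \<psi>))\<bar>"
        using p p1 \<rho> by (intro mult_right_mono) auto
      also have "\<dots> \<le> 2 * 1 * \<rho> * (\<rho> * (summed_mix * stretch * c\<^sup>2 * Q ^ (2 * n)))"
        using \<rho> by (intro mult_left_mono corr) auto
      finally show "2 * p * \<rho> * torus_mean (\<lambda>\<psi>. relax \<rho> p h n \<psi> * h n (Ait n \<psi>)) \<le> 2 * \<rho> * (\<rho> * (summed_mix * stretch * c\<^sup>2 * Q ^ (2 * n)))"
        by simp
      have "(h n (Ait n \<psi>))\<^sup>2 \<le> (c * Q ^ n)\<^sup>2" for \<psi>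
      proof (rule power2_le_iff_abs_le[THEN iffD2])
        show "0 \<le> c * Q ^ n" using c Q0 by simp
        show "\<bar>h n (Ait n \<psi>)\<bar> \<le> c * Q ^ n" using h(1)[of n] by (auto simp: smooth_obs_def)
      qed
      then have "torus_mean (\<lambda>\<psi>. (h n (Ait n \<psi>))\<^sup>2) \<le> torus_mean (\<lambda>\<psi>. (c * Q ^ n)\<^sup>2)"
        by (intro torus_mean_mono continuous_intros cont) auto
      also have "\<dots> = c\<^sup>2 * Q ^ (2 * n)"
        by (simp add: torus_mean_const power_mult_distrib power_mult[symmetric] mult.commute)
      finally show "\<rho>\<^sup>2 * torus_mean (\<lambda>\<psi>. (h n (Ait n \<psi>))\<^sup>2) \<le> \<rho>\<^sup>2 * (c\<^sup>2 * Q ^ (2 * n))"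
        by (intro mult_left_mono) auto
    qed
    also have "\<dots> = (p\<^sup>2 * (S / (\<eta> * \<sigma>)) + \<rho> * S) * \<rho> * Q ^ (2 * n)"
      by (simp add: S_def power2_eq_square algebra_simps)
    also have "\<dots> \<le> (Q\<^sup>2 * (S / (\<eta> * \<sigma>))) * \<rho> * Q ^ (2 * n)"
    proof (intro mult_right_mono)
      have "0 < \<rho> * \<eta>" using \<rho> \<eta> by simp
      \<comment> \<open>\<open>Q + p\<close> is bounded below by \<open>\<sigma>\<close>; hence the
        product \<open>\<eta> * \<sigma>\<close> in \<open>relax_const\<close>.\<close>
      then have "\<rho> * \<eta> * \<sigma> \<le> (Q - p) * (Q + p)" using p Q \<sigma>_pos by (intro mult_mono) auto
      then have "\<rho> * (\<eta> * \<sigma>) * (S / (\<eta> * \<sigma>)) \<le> (Q - p) * (Q + p) * (S / (\<eta> * \<sigma>))"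
        using S0 \<eta> \<sigma>_pos by (intro mult_right_mono) (auto simp: mult.assoc)
      moreover have "\<rho> * (\<eta> * \<sigma>) * (S / (\<eta> * \<sigma>)) = \<rho> * S" using \<eta> \<sigma>_pos by simp
      ultimately show "p\<^sup>2 * (S / (\<eta> * \<sigma>)) + \<rho> * S \<le> Q\<^sup>2 * (S / (\<eta> * \<sigma>))"
        by (simp add: power2_eq_square algebra_simps)
    qed (use \<rho> Q0 in auto)
    also have "\<dots> = S / (\<eta> * \<sigma>) * \<rho> * Q ^ (2 * Suc n)"
      by (simp add: power2_eq_square)
    finally show ?case .
  qed
  from this[of n] have "torus_L2 (relax \<rho> p h n) \<le> sqrt (S / (\<eta> * \<sigma>) * \<rho> * Q ^ (2 * n))"
    by (simp add: torus_L2_def)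
  also have "\<dots> = relax_const \<eta> c * sqrt \<rho> * Q ^ n"
  proof -
    have "S / (\<eta> * \<sigma>) * \<rho> * Q ^ (2 * n) = c\<^sup>2 * ((2 * stretch * summed_mix + 1) / (\<eta> * \<sigma>)) * \<rho> * (Q ^ n)\<^sup>2"
      by (simp add: S_def power_mult[symmetric] mult.commute)
    then show ?thesis
      using c Q0 by (simp only: real_sqrt_mult real_sqrt_abs relax_const_def) simp
  qed
  finally show ?thesis .
qed

end

context drift
begin

section \<open>Taylor remainders\<close>

lemma taylor_1: "\<bar>f u \<psi> - f v \<psi> - f1 v \<psi> * (u - v)\<bar> \<le> (u - v)\<^sup>2"
proof -
  obtain \<xi> where \<xi>: "\<xi> \<in> closed_segment v u" "f u \<psi> - f v \<psi> = f1 \<xi> \<psi> * (u - v)"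
    using mean_value[OF D0] by blast
  have "\<bar>\<xi> - v\<bar> \<le> \<bar>u - v\<bar>" using \<xi>(1) by (auto simp: closed_segment_eq_real_ivl split: if_splits)
  then have "\<bar>f1 \<xi> \<psi> - f1 v \<psi>\<bar> \<le> \<bar>u - v\<bar>" using f1_lip[of \<xi> \<psi> v] by linarith
  then have "\<bar>(f1 \<xi> \<psi> - f1 v \<psi>) * (u - v)\<bar> \<le> \<bar>u - v\<bar> * \<bar>u - v\<bar>"
    unfolding abs_mult by (intro mult_right_mono) auto
  then show ?thesis using \<xi>(2) by (simp add: algebra_simps power2_eq_square)
qed

text \<open>The mixed difference of \<open>f\<close> minus its part linear in \<open>v\<close>. The
  factor |y| in the remainder is the point: it will supply the decay in time, and
  \<open>v\<^sup>2\<close>, with v a value of the graph, a mean of order \<rho>.\<close>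

lemma taylor_cross:
  "\<bar>f (y + v) \<psi> - f v \<psi> - f y \<psi> + f 0 \<psi> - (f1 y \<psi> - f1 0 \<psi>) * v\<bar> \<le> \<bar>y\<bar> * v\<^sup>2"
proof -
  have D: "((\<lambda>x. f (y + x) \<psi> - f x \<psi>) has_real_derivative f1 (y + x) \<psi> - f1 x \<psi>) (at x)" for x
    by (intro DERIV_diff D0 DERIV_chain'[OF _ D0, where f = "\<lambda>x. y + x", THEN DERIV_cong])
      (auto intro!: derivative_eq_intros)
  obtain \<xi> where \<xi>: "\<xi> \<in> closed_segment 0 v"
      "(f (y + v) \<psi> - f v \<psi>) - (f (y + 0) \<psi> - f 0 \<psi>) = (f1 (y + \<xi>) \<psi> - f1 \<xi> \<psi>) * (v - 0)"
    using mean_value[OF D] by blast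
  have "\<bar>\<xi>\<bar> \<le> \<bar>v\<bar>" using \<xi>(1) by (auto simp: closed_segment_eq_real_ivl split: if_splits)
  have "\<bar>f1 (y + \<xi>) \<psi> - f1 \<xi> \<psi> - (f1 y \<psi> - f1 0 \<psi>)\<bar> \<le> \<bar>y\<bar> * \<bar>\<xi>\<bar>"
    using cross_difference_f1[of \<xi> y \<psi> 0] by (simp add: add.commute)
  also have "\<dots> \<le> \<bar>y\<bar> * \<bar>v\<bar>" using \<open>\<bar>\<xi>\<bar> \<le> \<bar>v\<bar>\<close> by (intro mult_left_mono) auto
  finally have "\<bar>(f1 (y + \<xi>) \<psi> - f1 \<xi> \<psi> - (f1 y \<psi> - f1 0 \<psi>)) * v\<bar> \<le> \<bar>y\<bar> * \<bar>v\<bar> * \<bar>v\<bar>"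
    unfolding abs_mult by (intro mult_right_mono) auto
  then show ?thesis using \<xi>(2) by (simp add: algebra_simps power2_eq_square)
qed

text \<open>Subtracting the mean keeps the Holder constant and at most doubles the sup bound;
  \<open>C\<close> is a common scale, since \<open>smooth_obs\<close> wants one constant for
  both.\<close>

lemma smooth_centred:
  assumes g: "torus_continuous g" and b: "\<And>\<psi>. \<bar>g \<psi>\<bar> \<le> c" and h: "holder_const L g" and cL: "L \<le> 2 * C" "c \<le> C"
  shows "smooth_obs (2 * C) (\<lambda>\<psi>. g \<psi> - torus_mean g)" "torus_mean (\<lambda>\<psi>. g \<psi> - torus_mean g) = 0"
proof -
  note gc = torus_continuous_cont[OF g]
  show "torus_mean (\<lambda>\<psi>. g \<psi> - torus_mean g) = 0"
    by (simp add: torus_mean_diff gc torus_mean_const)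
  have "\<bar>torus_mean g\<bar> \<le> c" using b by (intro torus_mean_bound gc)
  then have bd: "\<bar>g \<psi> - torus_mean g\<bar> \<le> 2 * C" for \<psi> using b[of \<psi>] cL by linarith
  have "L * norm (\<psi>' - \<psi>) powr \<alpha> \<le> 2 * C * norm (\<psi>' - \<psi>) powr \<alpha>" for \<psi>' \<psi> :: "real^2"
    using cL by (intro mult_right_mono) auto
  then have "holder_const (2 * C) (\<lambda>\<psi>. g \<psi> - torus_mean g)"
    using h unfolding holder_const_def by simp (meson order_trans)
  then show "smooth_obs (2 * C) (\<lambda>\<psi>. g \<psi> - torus_mean g)"
    using bd unfolding smooth_obs_def by (auto intro!: torus_continuous_intros g)
qed

lemma Ait_Suc: "Ait (Suc n) \<psi> = Ait n (A *v \<psi>)"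
  by (simp add: funpow_swap1)

end

text \<open>One step size, one starting point and one graph are fixed. The constants
  \<open>R\<close>, \<open>C1\<close>, \<open>C2\<close> and so on defined below mention none of the
  three, and so can be chosen before the run.\<close>

locale drift_run = drift +
  fixes \<gamma>' T \<rho> \<phi> :: real and W :: "real^2 \<Rightarrow> real"
  assumes \<gamma>': "0 < \<gamma>'" "\<gamma>' < \<gamma>" and T: "0 \<le> T" "absorbed ((\<gamma> - \<gamma>') / 2) T"
    and \<rho>: "0 < \<rho>" "\<rho> < \<rho>_max" and \<phi>: "\<phi>m \<le> \<phi>" "\<phi> \<le> \<phi>M" and W: "slow_manifold \<rho> W"
begin

definition q :: real where "q = 1 - \<rho> * \<gamma>'"
definition g2 :: real where "g2 = (\<gamma> + \<gamma>') / 2"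
definition R :: real where "R = growth_const T (g2 - \<gamma>')"
definition C1 :: real where "C1 = R * (\<phi>M - \<phi>m)"

lemma \<rho>_le: "\<rho> \<le> 1 / 2" "\<rho> \<le> 1" using \<rho> \<rho>_max_le by linarith+
lemma g2: "\<gamma>' < g2" "g2 \<le> 1" "0 < g2" using \<gamma>' \<gamma> by (auto simp: g2_def)
lemma R_pos: "0 < R" using g2 by (simp add: R_def growth_const_def)
lemma \<phi>_width: "0 \<le> \<phi>M - \<phi>m" using \<phi> by simp
lemma C1_nonneg: "0 \<le> C1" unfolding C1_def using R_pos \<phi>_width by simp
lemma q: "1 - \<rho> \<le> q" "\<sigma> \<le> q" "0 < q" "q \<le> 1"
proof -
  have "\<rho> * \<gamma>' \<le> \<rho> * 1" using \<rho> \<gamma>' \<gamma> by (intro mult_left_mono) auto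
  then show "1 - \<rho> \<le> q" by (simp add: q_def)
  then show "\<sigma> \<le> q" using \<rho> \<sigma>_less_1 by (simp add: \<rho>_max_def)
  then show "0 < q" using \<sigma>_pos by linarith
  show "q \<le> 1" using \<rho> \<gamma>' by (simp add: q_def)
qed

lemma decay:
  assumes "0 \<le> E" "0 \<le> d 0" "\<And>n. d (Suc n) \<le> (1 + \<rho>) * d n + \<rho> * E * q ^ n"
    "\<And>n. T \<le> \<rho> * real n \<Longrightarrow> d (Suc n) \<le> (1 - \<rho> * g2) * d n + \<rho> * E * q ^ n"
  shows "d n \<le> R * (d 0 + E) * q ^ n"
  unfolding R_def
  by (rule two_phase_decay[OF \<rho>(1) \<rho>_le(1) \<gamma>'(1) g2(1,2) T(1) assms(1) q_def assms(2,3,4)])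

lemma factor_le: "\<bar>a\<bar> \<le> 1 \<Longrightarrow> \<bar>1 + \<rho> * a\<bar> \<le> 1 + \<rho>"
  and factor_le': "\<bar>a\<bar> \<le> 1 \<Longrightarrow> a \<le> - g2 \<Longrightarrow> \<bar>1 + \<rho> * a\<bar> \<le> 1 - \<rho> * g2"
proof -
  assume a: "\<bar>a\<bar> \<le> 1"
  have ra: "\<bar>\<rho> * a\<bar> \<le> \<rho> * 1" unfolding abs_mult using \<rho> a by (intro mult_mono) auto
  then show "\<bar>1 + \<rho> * a\<bar> \<le> 1 + \<rho>" using \<rho> \<rho>_le by linarith
  assume "a \<le> - g2"
  then have "\<rho> * a \<le> \<rho> * (- g2)" using \<rho> by (intro mult_left_mono) auto
  then show "\<bar>1 + \<rho> * a\<bar> \<le> 1 - \<rho> * g2" using ra \<rho>_le by (simp add: abs_le_iff)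
qed

abbreviation x :: "nat \<Rightarrow> real^2 \<Rightarrow> real" where "x n \<equiv> orbit \<rho> \<phi> n"
abbreviation y :: "nat \<Rightarrow> real" where "y n \<equiv> mean_orbit \<rho> \<phi> n"

section \<open>Decay and unstable regularity of the distance to the graph\<close>

definition gap :: "nat \<Rightarrow> real^2 \<Rightarrow> real" where "gap n \<psi> = x n \<psi> - W (Ait n \<psi>)"
definition dev :: "nat \<Rightarrow> real^2 \<Rightarrow> real" where "dev n \<psi> = x n \<psi> - (y n + W (Ait n \<psi>))"
definition incr :: "nat \<Rightarrow> real^2 \<Rightarrow> real" where
  "incr n \<psi> = f (x n \<psi>) (Ait n \<psi>) - f (W (Ait n \<psi>)) (Ait n \<psi>) - torus_mean (f (y n))"

lemma W_torus: "torus_continuous W" and W_range: "Sm \<le> W \<psi>" "W \<psi> \<le> SM"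
  and W_step: "W (A *v \<psi>) = W \<psi> + \<rho> * f (W \<psi>) \<psi>"
  and W_unstable: "\<bar>W (\<psi> + t *\<^sub>R z) - W \<psi>\<bar> \<le> K' * \<bar>t\<bar> powr \<alpha>"
  using W by (auto simp: slow_manifold_def)

lemma W_Suc: "W (Ait (Suc n) \<psi>) = W (Ait n \<psi>) + \<rho> * f (W (Ait n \<psi>)) (Ait n \<psi>)"
  using W_step[of "Ait n \<psi>"] by simp

lemma W_bound: "\<bar>W \<psi>\<bar> \<le> \<phi>M - \<phi>m"
  using W_range[of \<psi>] S by (simp add: abs_le_iff)

lemma WA_torus: "torus_continuous (\<lambda>\<psi>. W (Ait n \<psi>))"
  by (rule torus_continuous_Ait[OF W_torus])

lemma x_torus: "torus_continuous (x n)"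
proof (induction n)
  case 0
  have "x 0 = (\<lambda>\<psi>. \<phi>)" by auto
  then show ?case by (simp add: torus_continuous_const)
next
  case (Suc n)
  have "x (Suc n) = (\<lambda>\<psi>. x n \<psi> + \<rho> * f (x n \<psi>) (Ait n \<psi>))" by auto
  then show ?case by (simp only:) (intro torus_continuous_intros f_comp Suc)
qed

lemma dev_torus: "torus_continuous (dev n)" and incr_torus: "torus_continuous (incr n)"
  unfolding dev_def[abs_def] incr_def[abs_def]
  by (intro torus_continuous_intros f_comp x_torus WA_torus)+

lemma gap_Suc: "gap (Suc n) \<psi> = gap n \<psi> + \<rho> * (f (x n \<psi>) (Ait n \<psi>) - f (W (Ait n \<psi>)) (Ait n \<psi>))"
  unfolding gap_def W_Suc by (simp add: algebra_simps)

lemma dev_Suc: "dev (Suc n) \<psi> = dev n \<psi> + \<rho> * incr n \<psi>"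
  unfolding dev_def incr_def W_Suc by (simp add: algebra_simps)

lemma late:
  assumes "T \<le> \<rho> * real n"
  shows "Sm - (\<gamma> - \<gamma>') / 2 \<le> x n \<psi>" "x n \<psi> \<le> SM + (\<gamma> - \<gamma>') / 2" "\<bar>y n\<bar> \<le> (\<gamma> - \<gamma>') / 2"
  using T(2) assms \<rho> \<rho>_le \<phi> unfolding absorbed_def by blast+

text \<open>A neighbourhood of width (\<gamma> - \<gamma>') / 2 degrades the rate \<gamma> exactly
  to \<open>g2\<close>.\<close>

lemma slope:
  obtains a where "f u \<psi> - f v \<psi> = a * (u - v)" "\<bar>a\<bar> \<le> 1"
    "Sm - (\<gamma> - \<gamma>') / 2 \<le> u \<Longrightarrow> u \<le> SM + (\<gamma> - \<gamma>') / 2 \<Longrightarrow>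
      Sm - (\<gamma> - \<gamma>') / 2 \<le> v \<Longrightarrow> v \<le> SM + (\<gamma> - \<gamma>') / 2 \<Longrightarrow> a \<le> - g2"
proof -
  obtain a where a: "f u \<psi> - f v \<psi> = a * (u - v)" "\<bar>a\<bar> \<le> 1"
    "\<And>\<delta>. Sm - \<delta> \<le> u \<Longrightarrow> u \<le> SM + \<delta> \<Longrightarrow> Sm - \<delta> \<le> v \<Longrightarrow> v \<le> SM + \<delta> \<Longrightarrow> 0 \<le> \<delta> \<Longrightarrow> a \<le> - \<gamma> + \<delta>"
    using f_slope by blast
  have "- \<gamma> + (\<gamma> - \<gamma>') / 2 = - g2" by (simp add: g2_def field_simps)
  then show thesis using that[OF a(1,2)] a(3)[of "(\<gamma> - \<gamma>') / 2"] \<gamma>' by auto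
qed

text \<open>Orbit and graph follow the same fibre maps, so their distance obeys a homogeneous
  recursion and decays like \<open>q ^ n\<close> at every fast point, before any averaging.\<close>

lemma gap_bound: "\<bar>gap n \<psi>\<bar> \<le> C1 * q ^ n"
proof -
  have "\<bar>gap n \<psi>\<bar> \<le> R * (\<bar>gap 0 \<psi>\<bar> + 0) * q ^ n"
  proof (rule decay)
    fix n
    obtain a where a: "f (x n \<psi>) (Ait n \<psi>) - f (W (Ait n \<psi>)) (Ait n \<psi>) = a * gap n \<psi>" "\<bar>a\<bar> \<le> 1"
      "T \<le> \<rho> * real n \<Longrightarrow> a \<le> - g2"
    proof -
      obtain a where a: "f (x n \<psi>) (Ait n \<psi>) - f (W (Ait n \<psi>)) (Ait n \<psi>) = a * (x n \<psi> - W (Ait n \<psi>))" "\<bar>a\<bar> \<le> 1"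
        "Sm - (\<gamma> - \<gamma>') / 2 \<le> x n \<psi> \<Longrightarrow> x n \<psi> \<le> SM + (\<gamma> - \<gamma>') / 2 \<Longrightarrow>
          Sm - (\<gamma> - \<gamma>') / 2 \<le> W (Ait n \<psi>) \<Longrightarrow> W (Ait n \<psi>) \<le> SM + (\<gamma> - \<gamma>') / 2 \<Longrightarrow> a \<le> - g2"
        using slope by blast
      have "0 \<le> (\<gamma> - \<gamma>') / 2" using \<gamma>' by simp
      then have "Sm - (\<gamma> - \<gamma>') / 2 \<le> W (Ait n \<psi>)" "W (Ait n \<psi>) \<le> SM + (\<gamma> - \<gamma>') / 2"
        using W_range[of "Ait n \<psi>"] by linarith+
      then show thesis using that[of a] a late(1,2)[of n \<psi>] by (auto simp: gap_def)
    qed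
    have eq: "gap (Suc n) \<psi> = (1 + \<rho> * a) * gap n \<psi>"
      unfolding gap_Suc a(1) by (simp add: algebra_simps)
    show "\<bar>gap (Suc n) \<psi>\<bar> \<le> (1 + \<rho>) * \<bar>gap n \<psi>\<bar> + \<rho> * 0 * q ^ n"
      unfolding eq abs_mult using factor_le[OF a(2)] by (simp add: mult_right_mono)
    show "\<bar>gap (Suc n) \<psi>\<bar> \<le> (1 - \<rho> * g2) * \<bar>gap n \<psi>\<bar> + \<rho> * 0 * q ^ n" if "T \<le> \<rho> * real n"
      unfolding eq abs_mult using factor_le'[OF a(2) a(3)[OF that]] by (simp add: mult_right_mono)
  qed auto
  also have "\<dots> \<le> R * (\<phi>M - \<phi>m) * q ^ n"
  proof -
    have "\<bar>gap 0 \<psi>\<bar> \<le> \<phi>M - \<phi>m" using W_range[of \<psi>] S \<phi> by (simp add: gap_def abs_le_iff)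
    then show ?thesis using R_pos q by (intro mult_right_mono mult_left_mono) auto
  qed
  finally show ?thesis by (simp add: C1_def)
qed

lemma mean_f_le: "\<bar>torus_mean (f u)\<bar> \<le> \<bar>u\<bar>"
proof -
  have "torus_mean (f u) = torus_mean (\<lambda>\<psi>. f u \<psi> - f 0 \<psi>)"
    by (simp add: torus_mean_diff torus_continuous_cont[OF f_torus] mean_f0)
  also have "\<bar>\<dots>\<bar> \<le> \<bar>u\<bar>"
    using f_lip[of u _ 0] by (intro torus_mean_bound continuous_intros torus_continuous_cont f_torus) auto
  finally show ?thesis .
qed

lemma y_bound: "\<bar>y n\<bar> \<le> C1 * q ^ n"
proof -
  have "\<bar>y n\<bar> \<le> R * (\<bar>y 0\<bar> + 0) * q ^ n"
  proof (rule decay)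
    fix n
    \<comment> \<open>The averaged step is the mean of the true steps from the same position.
      Subtracting \<open>f 0\<close> costs nothing in the mean, and each fast point can then be
      estimated separately.\<close>
    have step: "y (Suc n) = torus_mean (\<lambda>\<psi>. y n + \<rho> * (f (y n) \<psi> - f 0 \<psi>))"
      by (simp add: torus_mean_add torus_mean_cmult torus_mean_diff torus_mean_const mean_f0
          torus_continuous_cont[OF f_torus] continuous_on_mult_left continuous_on_diff)
    have cont: "continuous_on UNIV (\<lambda>\<psi>. y n + \<rho> * (f (y n) \<psi> - f 0 \<psi>))"
      by (intro continuous_intros torus_continuous_cont f_torus)
    have pt: "\<bar>y n + \<rho> * (f (y n) \<psi> - f 0 \<psi>)\<bar> \<le> (1 + \<rho>) * \<bar>y n\<bar>"
      "T \<le> \<rho> * real n \<Longrightarrow> \<bar>y n + \<rho> * (f (y n) \<psi> - f 0 \<psi>)\<bar> \<le> (1 - \<rho> * g2) * \<bar>y n\<bar>" for \<psi>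
    proof -
      obtain a where a: "f (y n) \<psi> - f 0 \<psi> = a * (y n - 0)" "\<bar>a\<bar> \<le> 1"
        "Sm - (\<gamma> - \<gamma>') / 2 \<le> y n \<Longrightarrow> y n \<le> SM + (\<gamma> - \<gamma>') / 2 \<Longrightarrow>
          Sm - (\<gamma> - \<gamma>') / 2 \<le> 0 \<Longrightarrow> 0 \<le> SM + (\<gamma> - \<gamma>') / 2 \<Longrightarrow> a \<le> - g2"
        using slope by blast
      have eq: "y n + \<rho> * (f (y n) \<psi> - f 0 \<psi>) = (1 + \<rho> * a) * y n"
        unfolding a(1) by (simp add: algebra_simps)
      show "\<bar>y n + \<rho> * (f (y n) \<psi> - f 0 \<psi>)\<bar> \<le> (1 + \<rho>) * \<bar>y n\<bar>"
        unfolding eq abs_mult using factor_le[OF a(2)] by (simp add: mult_right_mono)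
      assume "T \<le> \<rho> * real n"
      then have "\<bar>y n\<bar> \<le> (\<gamma> - \<gamma>') / 2" by (rule late)
      then have "Sm - (\<gamma> - \<gamma>') / 2 \<le> y n" "y n \<le> SM + (\<gamma> - \<gamma>') / 2"
        "Sm - (\<gamma> - \<gamma>') / 2 \<le> 0" "0 \<le> SM + (\<gamma> - \<gamma>') / 2"
        using S \<gamma>' by linarith+
      then have "a \<le> - g2" by (rule a(3))
      then show "\<bar>y n + \<rho> * (f (y n) \<psi> - f 0 \<psi>)\<bar> \<le> (1 - \<rho> * g2) * \<bar>y n\<bar>"
        unfolding eq abs_mult using factor_le'[OF a(2)] by (simp add: mult_right_mono)
    qed
    show "\<bar>y (Suc n)\<bar> \<le> (1 + \<rho>) * \<bar>y n\<bar> + \<rho> * 0 * q ^ n"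
      unfolding step using torus_mean_bound[OF cont pt(1)] by simp
    show "\<bar>y (Suc n)\<bar> \<le> (1 - \<rho> * g2) * \<bar>y n\<bar> + \<rho> * 0 * q ^ n" if "T \<le> \<rho> * real n"
      unfolding step using torus_mean_bound[OF cont pt(2)[OF that]] by simp
  qed auto
  also have "\<dots> \<le> R * (\<phi>M - \<phi>m) * q ^ n"
  proof -
    have "\<bar>y 0\<bar> \<le> \<phi>M - \<phi>m" using S \<phi> by (simp add: abs_le_iff)
    then show ?thesis using R_pos q by (intro mult_right_mono mult_left_mono) auto
  qed
  finally show ?thesis by (simp add: C1_def)
qed

text \<open>In \<open>C2\<close>, \<open>K'\<close> is the constant of the initial gap, which varies
  like \<open>W\<close>; the rest absorbs the forcing found in \<open>increment_unstable\<close>.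
  \<open>C3\<close> also covers the sup bound of \<open>incr\<close>, whence the summand
  \<open>2 * C1\<close>.\<close>

definition C2 :: real where "C2 = K' * (1 + 2 * C1)"
definition C3 :: real where "C3 = 2 * C1 + C2 + 2 * K' * C1"

lemma C2_nonneg: "0 \<le> C2" and C3_nonneg: "0 \<le> C3"
  using K'_nonneg C1_nonneg by (auto simp: C2_def C3_def)

text \<open>Moving the fast point changes the gap, the base point on the graph and the fast argument
  of \<open>f\<close>. The first change is kept as it stands; the other two produce mixed
  differences, which carry the factor |gap| \<le> \<open>C1 * q ^ n\<close>.\<close>

lemma increment_unstable:
  defines "F \<equiv> \<lambda>n \<psi>. f (x n \<psi>) (Ait n \<psi>) - f (W (Ait n \<psi>)) (Ait n \<psi>)"
  shows "\<bar>F n (\<psi> + t *\<^sub>R z) - F n \<psi>\<bar> \<le> \<bar>gap n (\<psi> + t *\<^sub>R z) - gap n \<psi>\<bar> + 2 * K' * C1 * q ^ n * (\<bar>\<mu>\<bar> ^ n * \<bar>t\<bar>) powr \<alpha>"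
proof -
  define s where "s = (\<bar>\<mu>\<bar> ^ n * \<bar>t\<bar>) powr \<alpha>"
  define u u' d d' \<psi>\<^sub>1 \<psi>\<^sub>2 where "u = W (Ait n \<psi>)" "u' = W (Ait n (\<psi> + t *\<^sub>R z))"
    "d = gap n \<psi>" "d' = gap n (\<psi> + t *\<^sub>R z)" "\<psi>\<^sub>1 = Ait n \<psi>" "\<psi>\<^sub>2 = Ait n (\<psi> + t *\<^sub>R z)"
  note defs = this
  have x: "x n \<psi> = u + d" "x n (\<psi> + t *\<^sub>R z) = u' + d'" by (auto simp: defs gap_def)
  have s0: "0 \<le> s" by (simp add: s_def)
  have nrm: "K * norm (\<psi>\<^sub>2 - \<psi>\<^sub>1) powr \<alpha> = K' * s"
    unfolding defs norm_shift_along_z by (simp add: K'_def s_def)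
  have uu: "\<bar>u' - u\<bar> \<le> K' * s"
    using W_unstable[of "Ait n \<psi>" "\<mu> ^ n * t"]
    by (simp add: defs Ait_add Ait_scale Ait_z s_def abs_mult power_abs mult.commute)
  have d: "\<bar>d\<bar> \<le> C1 * q ^ n" using gap_bound by (simp add: defs)
  have "F n (\<psi> + t *\<^sub>R z) - F n \<psi> = (f (u' + d') \<psi>\<^sub>2 - f (u' + d) \<psi>\<^sub>2)
      + (f (u' + d) \<psi>\<^sub>2 - f u' \<psi>\<^sub>2 - (f (u + d) \<psi>\<^sub>2 - f u \<psi>\<^sub>2))
      + (f (u + d) \<psi>\<^sub>2 - f u \<psi>\<^sub>2 - (f (u + d) \<psi>\<^sub>1 - f u \<psi>\<^sub>1))"
    unfolding F_def x by (simp add: defs)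
  also have "\<bar>\<dots>\<bar> \<le> \<bar>d' - d\<bar> + \<bar>d\<bar> * \<bar>u' - u\<bar> + \<bar>d\<bar> * (K' * s)"
  proof -
    have "\<bar>f (u' + d') \<psi>\<^sub>2 - f (u' + d) \<psi>\<^sub>2\<bar> \<le> \<bar>d' - d\<bar>" using f_lip[of "u' + d'" \<psi>\<^sub>2 "u' + d"] by simp
    moreover have "\<bar>f (u + d) \<psi>\<^sub>2 - f u \<psi>\<^sub>2 - (f (u + d) \<psi>\<^sub>1 - f u \<psi>\<^sub>1)\<bar> \<le> \<bar>d\<bar> * (K' * s)"
      using holder_difference(1)[of "u + d" \<psi>\<^sub>2 u \<psi>\<^sub>1] unfolding nrm[symmetric] by (simp add: mult_ac)
    ultimately show ?thesis using cross_difference[of u' d \<psi>\<^sub>2 u] by linarith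
  qed
  also have "\<dots> \<le> \<bar>d' - d\<bar> + \<bar>d\<bar> * (K' * s) + \<bar>d\<bar> * (K' * s)"
    using mult_left_mono[OF uu abs_ge_zero[of d]] by linarith
  also have "\<dots> = \<bar>d' - d\<bar> + \<bar>d\<bar> * (2 * K' * s)" by simp
  also have "\<dots> \<le> \<bar>d' - d\<bar> + C1 * q ^ n * (2 * K' * s)"
    using d K'_nonneg s0 by (intro add_left_mono mult_right_mono) auto
  finally show ?thesis by (simp add: defs s_def mult_ac)
qed

text \<open>Passing from n to n + 1 relaxes the admissible constant by a factor 1 /
  \<open>\<sigma> ^ 4\<close>, more than the growth \<open>1 + 2 * \<rho>\<close> consumes; the
  surplus is spent on the decay \<open>q ^ n\<close>.\<close>

lemma gap_unstable: "\<bar>gap n (\<psi> + t *\<^sub>R z) - gap n \<psi>\<bar> \<le> C2 * q ^ n * (\<bar>\<mu>\<bar> ^ n * \<bar>t\<bar>) powr \<alpha>"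
proof (induction n)
  case 0
  have "K' * 1 \<le> C2" unfolding C2_def using K'_nonneg C1_nonneg by (intro mult_left_mono) auto
  then have "K' * \<bar>t\<bar> powr \<alpha> \<le> C2 * \<bar>t\<bar> powr \<alpha>" by (intro mult_right_mono) auto
  then show ?case using W_unstable[of \<psi> t] by (simp add: gap_def abs_minus_commute)
next
  case (Suc n)
  define s where "s = (\<bar>\<mu>\<bar> ^ n * \<bar>t\<bar>) powr \<alpha>"
  define s' where "s' = (\<bar>\<mu>\<bar> ^ Suc n * \<bar>t\<bar>) powr \<alpha>"
  have ss: "s = \<sigma> ^ 4 * s'"
  proof -
    have "\<bar>\<mu>\<bar> ^ Suc n * \<bar>t\<bar> * \<bar>\<nu>\<bar> ^ 1 = (\<bar>\<mu>\<bar> * \<bar>\<nu>\<bar>) * (\<bar>\<mu>\<bar> ^ n * \<bar>t\<bar>)" by (simp add: mult_ac)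
    then have "\<bar>\<mu>\<bar> ^ n * \<bar>t\<bar> = \<bar>\<mu>\<bar> ^ Suc n * \<bar>t\<bar> * \<bar>\<nu>\<bar> ^ 1" using \<mu>\<nu> by simp
    moreover have "0 \<le> \<bar>\<mu>\<bar> ^ Suc n * \<bar>t\<bar>" by simp
    ultimately show ?thesis
      using powr_decay[of "\<bar>\<mu>\<bar> ^ Suc n * \<bar>t\<bar>" 1] unfolding s_def s'_def by (simp only: mult.commute mult_1_right mult_1_left)
  qed
  have s0: "0 \<le> s" "0 \<le> s'" by (auto simp: s_def s'_def)
  define F where "F = (\<lambda>n \<psi>. f (x n \<psi>) (Ait n \<psi>) - f (W (Ait n \<psi>)) (Ait n \<psi>))"
  let ?g = "\<bar>gap n (\<psi> + t *\<^sub>R z) - gap n \<psi>\<bar>"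
  have "gap (Suc n) (\<psi> + t *\<^sub>R z) - gap (Suc n) \<psi> = (gap n (\<psi> + t *\<^sub>R z) - gap n \<psi>) + \<rho> * (F n (\<psi> + t *\<^sub>R z) - F n \<psi>)"
    unfolding gap_Suc by (simp add: F_def algebra_simps)
  also have "\<bar>\<dots>\<bar> \<le> ?g + \<rho> * \<bar>F n (\<psi> + t *\<^sub>R z) - F n \<psi>\<bar>"
    using \<rho> by (simp add: abs_mult order_trans[OF abs_triangle_ineq])
  also have "\<dots> \<le> ?g + \<rho> * (?g + 2 * K' * C1 * q ^ n * s)"
    using increment_unstable[of n \<psi> t] \<rho> unfolding F_def s_def by (intro add_left_mono mult_left_mono) auto
  also have "\<dots> = (1 + \<rho>) * ?g + \<rho> * (2 * K' * C1) * (q ^ n * s)" by (simp add: algebra_simps)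
  also have "\<dots> \<le> (1 + \<rho>) * (C2 * q ^ n * s) + \<rho> * C2 * (q ^ n * s)"
  proof (intro add_mono mult_left_mono mult_right_mono)
    show "?g \<le> C2 * q ^ n * s" using Suc by (simp add: s_def)
    show "2 * K' * C1 \<le> C2" using K'_nonneg by (simp add: C2_def algebra_simps)
  qed (use \<rho> q s0 in auto)
  also have "\<dots> = (\<sigma> ^ 4 * (1 + 2 * \<rho>)) * (C2 * q ^ n * s')" unfolding ss by (simp add: algebra_simps)
  also have "\<dots> \<le> q * (C2 * q ^ n * s')"
    using \<sigma>_step[OF \<rho>] q C2_nonneg s0 by (intro mult_right_mono) auto
  finally show ?case by (simp add: s'_def mult_ac)
qed

lemma incr_obs: "unstable_obs k (C3 * q ^ k) (incr k)"
  unfolding unstable_obs_def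
proof (intro conjI allI incr_torus)
  fix \<psi> t
  have "\<bar>incr k \<psi>\<bar> \<le> \<bar>gap k \<psi>\<bar> + \<bar>y k\<bar>"
    using f_lip[of "x k \<psi>" "Ait k \<psi>" "W (Ait k \<psi>)"] mean_f_le[of "y k"] by (simp add: incr_def gap_def)
  also have "\<dots> \<le> C1 * q ^ k + C1 * q ^ k" by (intro add_mono gap_bound y_bound)
  also have "\<dots> \<le> C3 * q ^ k"
    using C1_nonneg C2_nonneg K'_nonneg q by (simp add: C3_def algebra_simps)
  finally show "\<bar>incr k \<psi>\<bar> \<le> C3 * q ^ k" .
  define s where "s = (\<bar>\<mu>\<bar> ^ k * \<bar>t\<bar>) powr \<alpha>"
  have s0: "0 \<le> s" by (simp add: s_def)
  have "\<bar>incr k (\<psi> + t *\<^sub>R z) - incr k \<psi>\<bar> \<le> C2 * q ^ k * s + 2 * K' * C1 * q ^ k * s"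
    using increment_unstable[of k \<psi> t] gap_unstable[of k \<psi> t] unfolding incr_def s_def by linarith
  also have "\<dots> = (C2 + 2 * K' * C1) * (q ^ k * s)" by (simp add: algebra_simps)
  also have "\<dots> \<le> C3 * (q ^ k * s)" using C1_nonneg q s0 by (intro mult_right_mono) (auto simp: C3_def)
  finally show "\<bar>incr k (\<psi> + t *\<^sub>R z) - incr k \<psi>\<bar> \<le> C3 * q ^ k * (\<bar>\<mu>\<bar> ^ k * \<bar>t\<bar>) powr \<alpha>"
    by (simp add: s_def mult_ac)
qed

text \<open>At time 0 the deviation is \<open>- W \<psi>\<close>. The factor 1 is the weight
  expected by \<open>correlation_sum\<close>.\<close>

lemma dev_eq_sum: "dev n \<psi> = (\<rho> * (\<Sum>k<n. 1 * incr k \<psi>)) - W \<psi>"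
  by (induction n) (simp_all add: dev_Suc algebra_simps, simp add: dev_def)

section \<open>Mean-square bounds of order sqrt \<rho>\<close>

definition CN :: real where "CN = relax_const \<gamma> K"
definition CW :: real where "CW = (1 + 2 / \<gamma>) * CN"

lemma CN_nonneg: "0 \<le> CN" and CW_nonneg: "0 \<le> CW"
  using K \<gamma> relax_const_nonneg[of K \<gamma>] by (auto simp: CN_def CW_def)

text \<open>\<open>W\<close> along the fast orbit is compared with the response \<open>N\<close> to
  the forcing \<open>f 0\<close>. The difference contracts with a source of size \<rho> |N|, so up
  to a term with \<open>p ^ n\<close> it is of the order of \<open>N\<close>. The norm of
  \<open>W\<close> along the orbit does not depend on n, and letting n grow removes that
  term.\<close>

lemma W_L2: "torus_L2 W \<le> CW * sqrt \<rho>"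
proof -
  define p where "p = 1 - \<rho> * \<gamma>"
  have "\<rho> * \<gamma> \<le> 1 * 1" using \<rho> \<rho>_le \<gamma> by (intro mult_mono) auto
  moreover have "0 < \<rho> * \<gamma>" using \<rho> \<gamma> by simp
  ultimately have p: "0 \<le> p" "p < 1" "p = 1 - \<rho> * \<gamma>" by (auto simp: p_def)
  define N where "N n = relax \<rho> p (\<lambda>_. f 0) n" for n
  define D where "D n \<psi> = W (Ait n \<psi>) - N n \<psi>" for n \<psi>
  have f0: "smooth_obs K (f 0)"
    using f_torus[of 0] f_holder[of 0] f_le[of 0] K unfolding smooth_obs_def by (auto intro: order_trans)
  have Nt: "torus_continuous (N n)" for n
    unfolding N_def by (rule relax_torus) (rule f_torus)
  have Dt: "torus_continuous (D n)" for n
    unfolding D_def[abs_def] by (intro torus_continuous_intros WA_torus Nt)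
  have N_L2: "torus_L2 (N n) \<le> CN * sqrt \<rho>" for n
    using relax_L2[OF \<rho>(1) \<rho>_le(2) p(1), of 1 \<gamma> K "\<lambda>_. f 0" n] f0 mean_f0 \<gamma> K \<sigma>_less_1
    by (simp add: N_def CN_def p(3))
  \<comment> \<open>The slope \<open>a\<close> differs from - \<gamma> by at most 2, hence the
    factor 2; the last summand only fills the shape of \<open>torus_L2_le3\<close>.\<close>
  have step: "\<bar>D (Suc n) \<psi>\<bar> \<le> p * \<bar>D n \<psi>\<bar> + 2 * \<rho> * \<bar>N n \<psi>\<bar> + 0 * \<bar>N n \<psi>\<bar>" for n \<psi>
  proof -
    define v where "v = W (Ait n \<psi>)"
    have v: "Sm \<le> v" "v \<le> SM" using W_range by (auto simp: v_def)
    obtain a where a: "f v (Ait n \<psi>) - f 0 (Ait n \<psi>) = a * (v - 0)" "\<bar>a\<bar> \<le> 1" "a \<le> - \<gamma>"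
      using f_slope[of v "Ait n \<psi>" 0] v S by (metis add.right_neutral diff_zero order_refl)
    have "D (Suc n) \<psi> = (v + \<rho> * f v (Ait n \<psi>)) - (p * N n \<psi> + \<rho> * f 0 (Ait n \<psi>))"
      unfolding D_def W_Suc by (simp add: N_def v_def)
    also have "\<dots> = v + \<rho> * (f v (Ait n \<psi>) - f 0 (Ait n \<psi>)) - p * N n \<psi>" by (simp add: algebra_simps)
    also have "\<dots> = (1 + \<rho> * a) * D n \<psi> + \<rho> * ((a + \<gamma>) * N n \<psi>)"
      unfolding a(1) D_def p(3) by (simp add: v_def algebra_simps)
    finally have eq: "D (Suc n) \<psi> = (1 + \<rho> * a) * D n \<psi> + \<rho> * ((a + \<gamma>) * N n \<psi>)" .
    have "\<bar>1 + \<rho> * a\<bar> \<le> p"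
    proof -
      have "\<rho> * a \<le> \<rho> * (- \<gamma>)" "\<rho> * (- 1) \<le> \<rho> * a" using a \<rho> mult_left_mono[of a "- \<gamma>" \<rho>] mult_left_mono[of "- 1" a \<rho>]
        by (auto simp: abs_le_iff)
      then show ?thesis using \<rho>_le by (simp add: p(3) abs_le_iff)
    qed
    then have "\<bar>(1 + \<rho> * a) * D n \<psi>\<bar> \<le> p * \<bar>D n \<psi>\<bar>" unfolding abs_mult by (intro mult_right_mono) auto
    moreover have "\<bar>\<rho> * ((a + \<gamma>) * N n \<psi>)\<bar> \<le> \<rho> * (2 * \<bar>N n \<psi>\<bar>)"
    proof -
      have "\<bar>a + \<gamma>\<bar> \<le> 2" using a \<gamma> by linarith
      then show ?thesis unfolding abs_mult using \<rho> by (intro mult_mono) auto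
    qed
    ultimately show ?thesis unfolding eq by linarith
  qed
  have L2_step: "torus_L2 (D (Suc n)) \<le> p * torus_L2 (D n) + 2 * \<rho> * (CN * sqrt \<rho>)" for n
  proof -
    have "torus_L2 (D (Suc n)) \<le> p * torus_L2 (D n) + 2 * \<rho> * torus_L2 (N n) + 0 * torus_L2 (N n)"
      using \<rho> by (intro torus_L2_le3[OF Dt Dt Nt Nt p(1) _ _ step]) auto
    moreover have "2 * \<rho> * torus_L2 (N n) \<le> 2 * \<rho> * (CN * sqrt \<rho>)"
      using \<rho> by (intro mult_left_mono N_L2) auto
    ultimately show ?thesis by linarith
  qed
  have D_L2: "torus_L2 (D n) \<le> p ^ n * torus_L2 W + 2 / \<gamma> * (CN * sqrt \<rho>)" for n
  proof (induction n)
    case 0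
    have "D 0 = W" by (simp add: D_def N_def fun_eq_iff)
    then show ?case using CN_nonneg \<gamma> \<rho> by simp
  next
    case (Suc n)
    have "torus_L2 (D (Suc n)) \<le> p * (p ^ n * torus_L2 W + 2 / \<gamma> * (CN * sqrt \<rho>)) + 2 * \<rho> * (CN * sqrt \<rho>)"
      using L2_step[of n] mult_left_mono[OF Suc p(1)] by linarith
    also have "\<dots> = p ^ Suc n * torus_L2 W + (p * (2 / \<gamma>) + 2 * \<rho>) * (CN * sqrt \<rho>)" by (simp add: algebra_simps)
    also have "p * (2 / \<gamma>) + 2 * \<rho> = 2 / \<gamma>" using \<gamma> by (simp add: p(3) field_simps)
    finally show ?case .
  qed
  have "torus_L2 W \<le> p ^ n * torus_L2 W + CW * sqrt \<rho>" for n
  proof -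
    have "torus_mean (\<lambda>\<psi>. (W (Ait n \<psi>))\<^sup>2) = torus_mean (\<lambda>\<psi>. (W \<psi>)\<^sup>2)"
      using torus_mean_Ait[of "\<lambda>\<psi>. (W \<psi>)\<^sup>2" n] by (simp add: torus_continuous_power W_torus)
    then have "torus_L2 W = torus_L2 (\<lambda>\<psi>. D n \<psi> + N n \<psi>)"
      by (simp add: torus_L2_def D_def)
    also have "\<dots> \<le> torus_L2 (D n) + torus_L2 (N n)" by (rule torus_L2_triangle[OF Dt Nt])
    also have "\<dots> \<le> p ^ n * torus_L2 W + 2 / \<gamma> * (CN * sqrt \<rho>) + CN * sqrt \<rho>" by (intro add_mono D_L2 N_L2)
    finally show ?thesis by (simp add: CW_def algebra_simps)
  qed
  moreover have "(\<lambda>n. p ^ n * torus_L2 W + CW * sqrt \<rho>) \<longlonglongrightarrow> 0 * torus_L2 W + CW * sqrt \<rho>"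
    using p by (intro tendsto_intros LIMSEQ_power_zero) auto
  ultimately show ?thesis by (intro LIMSEQ_le_const[of _ "CW * sqrt \<rho>"]) auto
qed

lemma W_square: "torus_mean (\<lambda>\<psi>. (W (Ait n \<psi>))\<^sup>2) \<le> CW\<^sup>2 * \<rho>"
proof -
  have "torus_mean (\<lambda>\<psi>. (W (Ait n \<psi>))\<^sup>2) = (torus_L2 W)\<^sup>2"
    using torus_mean_Ait[of "\<lambda>\<psi>. (W \<psi>)\<^sup>2" n] by (simp add: torus_continuous_power W_torus torus_L2_square)
  also have "\<dots> \<le> (CW * sqrt \<rho>)\<^sup>2" by (intro power_mono W_L2 torus_L2_nonneg W_torus)
  finally show ?thesis using \<rho> by (simp add: power_mult_distrib)
qed

definition CM :: real where "CM = relax_const (g2 - \<gamma>') (2 * (K * C1))"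
definition CD :: real where "CD = R * (CW + (2 * CM + C1 * CW)) + CM"

lemma CM_nonneg: "0 \<le> CM"
  using K C1_nonneg g2 by (simp add: CM_def relax_const_nonneg)

lemma y_le: "\<bar>y n\<bar> \<le> K * (C1 * q ^ n)" "K * \<bar>y n\<bar> \<le> K * (C1 * q ^ n)"
proof -
  show 1: "K * \<bar>y n\<bar> \<le> K * (C1 * q ^ n)" using K y_bound by (intro mult_left_mono) auto
  have "1 * \<bar>y n\<bar> \<le> K * \<bar>y n\<bar>" using K by (intro mult_right_mono) auto
  then show "\<bar>y n\<bar> \<le> K * (C1 * q ^ n)" using 1 by simp
qed

text \<open>The change of the fast fluctuation when the slow variable moves from 0 to
  \<open>y n\<close>; the fluctuation at 0 is already carried by \<open>W\<close>. It is centred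
  because \<open>f 0\<close> has mean zero, and of the size of \<open>y n\<close>.\<close>

definition forcing :: "nat \<Rightarrow> real^2 \<Rightarrow> real" where
  "forcing n \<psi> = f (y n) \<psi> - f 0 \<psi> - torus_mean (f (y n))"

lemma forcing_obs: "smooth_obs (2 * (K * C1) * q ^ n) (forcing n)" and mean_forcing: "torus_mean (forcing n) = 0"
proof -
  have t: "torus_continuous (\<lambda>\<psi>. f (y n) \<psi> - f 0 \<psi>)" by (intro torus_continuous_intros f_torus)
  have m: "torus_mean (\<lambda>\<psi>. f (y n) \<psi> - f 0 \<psi>) = torus_mean (f (y n))"
    by (simp add: torus_mean_diff torus_continuous_cont[OF f_torus] mean_f0)
  have h: "holder_const (K * \<bar>y n\<bar>) (\<lambda>\<psi>. f (y n) \<psi> - f 0 \<psi>)"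
    using holder_difference(1)[of "y n" _ 0] by (simp add: holder_const_def)
  have b: "\<bar>f (y n) \<psi> - f 0 \<psi>\<bar> \<le> \<bar>y n\<bar>" for \<psi> using f_lip[of "y n" \<psi> 0] by simp
  have "0 \<le> K * (C1 * q ^ n)" using y_le(1) abs_ge_zero order_trans by blast
  then have "K * \<bar>y n\<bar> \<le> 2 * (K * (C1 * q ^ n))" using y_le(2)[of n] by linarith
  from smooth_centred[OF t b h this y_le(1)]
  show "smooth_obs (2 * (K * C1) * q ^ n) (forcing n)" "torus_mean (forcing n) = 0"
    by (simp_all add: m forcing_def[abs_def] mult.assoc)
qed

text \<open>The increment splits exactly into slope times deviation, centred forcing and a mixed
  difference. Subtracting the response \<open>M\<close> to the forcing leaves a recursion with the
  sources \<rho> |M| and \<rho> \<open>C1 * q ^ n\<close> |W|, both of mean-square size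
  \<open>\<rho> * sqrt \<rho> * q ^ n\<close>.\<close>

lemma dev_L2: "torus_L2 (dev n) \<le> CD * sqrt \<rho> * q ^ n"
proof -
  define p where "p = 1 - \<rho> * g2"
  have "\<rho> * g2 \<le> 1 * 1" using \<rho> \<rho>_le g2 by (intro mult_mono) auto
  then have p: "0 \<le> p" "p \<le> q - \<rho> * (g2 - \<gamma>')" by (auto simp: p_def q_def algebra_simps)
  define M where "M n = relax \<rho> p forcing n" for n
  define D where "D n \<psi> = dev n \<psi> - M n \<psi>" for n \<psi>
  have ft: "torus_continuous (forcing n)" for n using forcing_obs by (auto simp: smooth_obs_def)
  have Mt: "torus_continuous (M n)" for n
    unfolding M_def by (rule relax_torus) (rule ft)
  have Dt: "torus_continuous (D n)" for n
    unfolding D_def[abs_def] by (intro torus_continuous_intros dev_torus Mt)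
  have M_L2: "torus_L2 (M n) \<le> CM * sqrt \<rho> * q ^ n" for n
    unfolding M_def CM_def
    by (rule relax_L2[OF \<rho>(1) \<rho>_le(2) p q(2,4)]) (use g2 K C1_nonneg forcing_obs mean_forcing in auto)
  \<comment> \<open>The slope depends on the fast point; only its bounds matter, and
    \<open>L2_step\<close> turns them into a factor uniform in \<psi>.\<close>
  have step: "\<exists>a. \<bar>a\<bar> \<le> 1 \<and> (T \<le> \<rho> * real n \<longrightarrow> a \<le> - g2) \<and>
      \<bar>D (Suc n) \<psi>\<bar> \<le> \<bar>1 + \<rho> * a\<bar> * \<bar>D n \<psi>\<bar> + 2 * \<rho> * \<bar>M n \<psi>\<bar> + \<rho> * (C1 * q ^ n) * \<bar>W (Ait n \<psi>)\<bar>" for n \<psi>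
  proof -
    define v where "v = W (Ait n \<psi>)"
    define \<psi>\<^sub>1 where "\<psi>\<^sub>1 = Ait n \<psi>"
    obtain a where a: "f (x n \<psi>) \<psi>\<^sub>1 - f (y n + v) \<psi>\<^sub>1 = a * (x n \<psi> - (y n + v))" "\<bar>a\<bar> \<le> 1"
      "Sm - (\<gamma> - \<gamma>') / 2 \<le> x n \<psi> \<Longrightarrow> x n \<psi> \<le> SM + (\<gamma> - \<gamma>') / 2 \<Longrightarrow>
        Sm - (\<gamma> - \<gamma>') / 2 \<le> y n + v \<Longrightarrow> y n + v \<le> SM + (\<gamma> - \<gamma>') / 2 \<Longrightarrow> a \<le> - g2"
      using slope by blast
    have late_a: "a \<le> - g2" if "T \<le> \<rho> * real n"
    proof -
      have "Sm \<le> v" "v \<le> SM" using W_range by (auto simp: v_def)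
      then have "Sm - (\<gamma> - \<gamma>') / 2 \<le> y n + v" "y n + v \<le> SM + (\<gamma> - \<gamma>') / 2"
        using late(3)[OF that] by linarith+
      then show ?thesis using a(3) late(1,2)[OF that] by auto
    qed
    define e where "e = f (y n + v) \<psi>\<^sub>1 - f v \<psi>\<^sub>1 - (f (y n) \<psi>\<^sub>1 - f 0 \<psi>\<^sub>1)"
    have e: "\<bar>e\<bar> \<le> C1 * q ^ n * \<bar>v\<bar>"
    proof -
      have "\<bar>e\<bar> \<le> \<bar>v\<bar> * \<bar>y n\<bar>"
        using cross_difference[of "y n" v \<psi>\<^sub>1 0] cross_difference[of 0 "y n" \<psi>\<^sub>1 v]
        by (simp add: e_def add.commute algebra_simps)
      also have "\<dots> \<le> \<bar>v\<bar> * (C1 * q ^ n)" using y_bound by (intro mult_left_mono) auto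
      finally show ?thesis by (simp add: mult_ac)
    qed
    have "incr n \<psi> = a * dev n \<psi> + forcing n \<psi>\<^sub>1 + e"
      using a(1) by (simp add: incr_def forcing_def e_def dev_def v_def \<psi>\<^sub>1_def)
    then have "D (Suc n) \<psi> = (dev n \<psi> + \<rho> * (a * dev n \<psi> + forcing n \<psi>\<^sub>1 + e)) - (p * M n \<psi> + \<rho> * forcing n \<psi>\<^sub>1)"
      unfolding D_def dev_Suc by (simp add: M_def \<psi>\<^sub>1_def)
    also have "\<dots> = (1 + \<rho> * a) * D n \<psi> + \<rho> * ((a + g2) * M n \<psi>) + \<rho> * e"
      by (simp add: D_def p_def algebra_simps)
    finally have eq: "D (Suc n) \<psi> = (1 + \<rho> * a) * D n \<psi> + \<rho> * ((a + g2) * M n \<psi>) + \<rho> * e" .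
    have "\<bar>\<rho> * ((a + g2) * M n \<psi>)\<bar> \<le> \<rho> * (2 * \<bar>M n \<psi>\<bar>)"
    proof -
      have "\<bar>a + g2\<bar> \<le> 2" using a(2) g2 by linarith
      then show ?thesis unfolding abs_mult using \<rho> by (intro mult_mono) auto
    qed
    moreover have "\<bar>\<rho> * e\<bar> \<le> \<rho> * (C1 * q ^ n * \<bar>v\<bar>)" unfolding abs_mult using \<rho> e by (intro mult_mono) auto
    moreover have "\<bar>(1 + \<rho> * a) * D n \<psi>\<bar> = \<bar>1 + \<rho> * a\<bar> * \<bar>D n \<psi>\<bar>" by (rule abs_mult)
    ultimately have "\<bar>D (Suc n) \<psi>\<bar> \<le> \<bar>1 + \<rho> * a\<bar> * \<bar>D n \<psi>\<bar> + 2 * \<rho> * \<bar>M n \<psi>\<bar> + \<rho> * (C1 * q ^ n) * \<bar>W (Ait n \<psi>)\<bar>"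
      unfolding eq v_def by linarith
    then show ?thesis using a(2) late_a by blast
  qed
  define E where "E = (2 * CM + C1 * CW) * sqrt \<rho>"
  have E0: "0 \<le> E" using CM_nonneg C1_nonneg CW_nonneg \<rho> by (simp add: E_def)
  have L2_step: "torus_L2 (D (Suc n)) \<le> \<kappa> * torus_L2 (D n) + \<rho> * E * q ^ n"
    if \<kappa>: "0 \<le> \<kappa>" "\<And>a. \<bar>a\<bar> \<le> 1 \<Longrightarrow> (T \<le> \<rho> * real n \<longrightarrow> a \<le> - g2) \<Longrightarrow> \<bar>1 + \<rho> * a\<bar> \<le> \<kappa>" for \<kappa> n
  proof -
    have "\<bar>D (Suc n) \<psi>\<bar> \<le> \<kappa> * \<bar>D n \<psi>\<bar> + 2 * \<rho> * \<bar>M n \<psi>\<bar> + \<rho> * (C1 * q ^ n) * \<bar>W (Ait n \<psi>)\<bar>" for \<psi>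
    proof -
      obtain a where a: "\<bar>a\<bar> \<le> 1" "T \<le> \<rho> * real n \<longrightarrow> a \<le> - g2"
        "\<bar>D (Suc n) \<psi>\<bar> \<le> \<bar>1 + \<rho> * a\<bar> * \<bar>D n \<psi>\<bar> + 2 * \<rho> * \<bar>M n \<psi>\<bar> + \<rho> * (C1 * q ^ n) * \<bar>W (Ait n \<psi>)\<bar>"
        using step by blast
      have "\<bar>1 + \<rho> * a\<bar> * \<bar>D n \<psi>\<bar> \<le> \<kappa> * \<bar>D n \<psi>\<bar>" using \<kappa>(2)[OF a(1,2)] by (intro mult_right_mono) auto
      then show ?thesis using a(3) by linarith
    qed
    then have "torus_L2 (D (Suc n)) \<le> \<kappa> * torus_L2 (D n) + 2 * \<rho> * torus_L2 (M n) + \<rho> * (C1 * q ^ n) * torus_L2 (\<lambda>\<psi>. W (Ait n \<psi>))"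
      by (intro torus_L2_le3 Dt Mt WA_torus \<kappa>(1)) (use \<rho> C1_nonneg q \<kappa>(1) in auto)
    also have "torus_L2 (\<lambda>\<psi>. W (Ait n \<psi>)) = torus_L2 W"
      using torus_mean_Ait[of "\<lambda>\<psi>. (W \<psi>)\<^sup>2" n] by (simp add: torus_L2_def torus_continuous_power W_torus)
    also have "\<kappa> * torus_L2 (D n) + 2 * \<rho> * torus_L2 (M n) + \<rho> * (C1 * q ^ n) * torus_L2 W
        \<le> \<kappa> * torus_L2 (D n) + 2 * \<rho> * (CM * sqrt \<rho> * q ^ n) + \<rho> * (C1 * q ^ n) * (CW * sqrt \<rho>)"
      using \<rho> C1_nonneg q \<kappa>(1) by (intro add_mono mult_left_mono M_L2 W_L2) auto
    finally show ?thesis by (simp add: E_def algebra_simps)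
  qed
  have "torus_L2 (D n) \<le> R * (torus_L2 (D 0) + E) * q ^ n"
  proof (rule decay[OF E0])
    show "0 \<le> torus_L2 (D 0)" by (rule torus_L2_nonneg[OF Dt])
    show "torus_L2 (D (Suc n)) \<le> (1 + \<rho>) * torus_L2 (D n) + \<rho> * E * q ^ n" for n
      by (rule L2_step) (use \<rho> factor_le in auto)
    show "torus_L2 (D (Suc n)) \<le> (1 - \<rho> * g2) * torus_L2 (D n) + \<rho> * E * q ^ n" if "T \<le> \<rho> * real n" for n
      by (rule L2_step) (use p(1) factor_le' that in \<open>auto simp: p_def\<close>)
  qed
  also have "torus_L2 (D 0) = torus_L2 W"
    by (simp add: torus_L2_def D_def M_def dev_def)
  also have "R * (torus_L2 W + E) * q ^ n \<le> R * (CW * sqrt \<rho> + E) * q ^ n"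
    using R_pos q by (intro mult_right_mono mult_left_mono add_right_mono W_L2) auto
  finally have D_L2: "torus_L2 (D n) \<le> R * (CW * sqrt \<rho> + E) * q ^ n" .
  have "torus_L2 (dev n) = torus_L2 (\<lambda>\<psi>. D n \<psi> + M n \<psi>)" by (simp add: D_def)
  also have "\<dots> \<le> torus_L2 (D n) + torus_L2 (M n)" by (rule torus_L2_triangle[OF Dt Mt])
  also have "\<dots> \<le> R * (CW * sqrt \<rho> + E) * q ^ n + CM * sqrt \<rho> * q ^ n" by (intro add_mono D_L2 M_L2)
  also have "\<dots> = CD * sqrt \<rho> * q ^ n" by (simp add: CD_def E_def algebra_simps)
  finally show ?thesis .
qed

lemma dev_square: "torus_mean (\<lambda>\<psi>. (dev n \<psi>)\<^sup>2) \<le> CD\<^sup>2 * \<rho> * q ^ (2 * n)"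
proof -
  have "torus_mean (\<lambda>\<psi>. (dev n \<psi>)\<^sup>2) = (torus_L2 (dev n))\<^sup>2" by (simp add: torus_L2_square dev_torus)
  also have "\<dots> \<le> (CD * sqrt \<rho> * q ^ n)\<^sup>2" by (intro power_mono dev_L2 torus_L2_nonneg dev_torus)
  also have "\<dots> = CD\<^sup>2 * \<rho> * q ^ (2 * n)"
    using \<rho> by (simp add: power_mult_distrib power_mult[symmetric] mult.commute)
  finally show ?thesis .
qed

section \<open>Correlations and means of order \<rho>\<close>

definition CC :: real where "CC = mix_const * (1 + 2 * K') / (1 - \<sigma>)"

lemma CC_nonneg: "0 \<le> CC"
  using mix_const_nonneg K'_nonneg \<sigma>_less_1 by (simp add: CC_def)

text \<open>Correlations with \<open>W\<close> are of order \<open>\<rho>\<close> because consecutive ones differ by \<open>\<rho>\<close> times an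
  exponentially small term.\<close>
lemma W_correlation:
  assumes v: "smooth_obs c v" "torus_mean v = 0"
  shows "\<bar>torus_mean (\<lambda>\<psi>. W \<psi> * v (Ait n \<psi>))\<bar> \<le> \<rho> * CC * c * \<sigma> ^ n"
proof -
  have c0: "0 \<le> c" by (rule smooth_obs_nonneg[OF v(1)])
  have vt: "torus_continuous v" using v by (simp add: smooth_obs_def)
  define a where "a n = torus_mean (\<lambda>\<psi>. W \<psi> * v (Ait n \<psi>))" for n
  define g where "g = (\<lambda>\<psi>. f (W \<psi>) \<psi>)"
  have gt: "torus_continuous g" using f_comp[OF W_torus, of 0] by (simp add: g_def)
  have W_obs: "unstable_obs 0 (\<phi>M - \<phi>m + K') W"
    unfolding unstable_obs_def
  proof (intro conjI allI W_torus)
    show "\<bar>W \<psi>\<bar> \<le> \<phi>M - \<phi>m + K'" for \<psi> using W_bound[of \<psi>] K'_nonneg by linarith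
    fix \<psi> t
    have "K' * \<bar>t\<bar> powr \<alpha> \<le> (\<phi>M - \<phi>m + K') * \<bar>t\<bar> powr \<alpha>" using \<phi>_width by (intro mult_right_mono) auto
    then show "\<bar>W (\<psi> + t *\<^sub>R z) - W \<psi>\<bar> \<le> (\<phi>M - \<phi>m + K') * (\<bar>\<mu>\<bar> ^ 0 * \<bar>t\<bar>) powr \<alpha>"
      using W_unstable[of \<psi> t] by simp
  qed
  have g_obs: "unstable_obs 0 (1 + 2 * K') g"
    unfolding unstable_obs_def
  proof (intro conjI allI gt)
    show "\<bar>g \<psi>\<bar> \<le> 1 + 2 * K'" for \<psi> using f_le[of "W \<psi>" \<psi>] K'_nonneg by (simp add: g_def)
    fix \<psi> t
    have "\<bar>f (W \<psi>) (\<psi> + t *\<^sub>R z) - f (W \<psi>) \<psi>\<bar> \<le> K' * \<bar>t\<bar> powr \<alpha>"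
      using holder_along_z[OF f_holder, where n = 0, of "W \<psi>" \<psi> t] by (simp add: K'_def)
    then have "\<bar>g (\<psi> + t *\<^sub>R z) - g \<psi>\<bar> \<le> 2 * K' * \<bar>t\<bar> powr \<alpha>"
      using f_lip[of "W (\<psi> + t *\<^sub>R z)" "\<psi> + t *\<^sub>R z" "W \<psi>"] W_unstable[of \<psi> t] unfolding g_def by linarith
    also have "\<dots> \<le> (1 + 2 * K') * \<bar>t\<bar> powr \<alpha>" by (intro mult_right_mono) auto
    finally show "\<bar>g (\<psi> + t *\<^sub>R z) - g \<psi>\<bar> \<le> (1 + 2 * K') * (\<bar>\<mu>\<bar> ^ 0 * \<bar>t\<bar>) powr \<alpha>" by simp
  qed
  have prod: "continuous_on UNIV (\<lambda>\<psi>. W \<psi> * v (Ait m \<psi>))" "continuous_on UNIV (\<lambda>\<psi>. g \<psi> * v (Ait m \<psi>))" for m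
    by (intro torus_continuous_cont torus_continuous_mult torus_continuous_Ait W_torus gt vt)+
  define B' where "B' = mix_const * (1 + 2 * K') * c"
  have B': "0 \<le> B'" using mix_const_nonneg K'_nonneg c0 by (simp add: B'_def)
  \<comment> \<open>By invariance of the mean both factors may be read one step ahead; the
    invariance equation then turns the first one into \<open>W\<close> plus \<rho> times
    \<open>g\<close>.\<close>
  have shift: "\<bar>a m\<bar> \<le> \<bar>a (Suc m)\<bar> + \<rho> * B' * \<sigma> ^ (2 * Suc m)" for m
  proof -
    have "a m = torus_mean (\<lambda>\<psi>. W (Ait 1 \<psi>) * v (Ait m (Ait 1 \<psi>)))"
      unfolding a_def
      by (rule torus_mean_Ait[OF torus_continuous_mult[OF W_torus torus_continuous_Ait[OF vt]], symmetric])
    also have "\<dots> = torus_mean (\<lambda>\<psi>. W \<psi> * v (Ait (Suc m) \<psi>) + \<rho> * (g \<psi> * v (Ait (Suc m) \<psi>)))"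
      by (rule arg_cong[of _ _ torus_mean]) (auto simp: W_step g_def Ait_Suc algebra_simps simp del: funpow.simps)
    also have "\<dots> = a (Suc m) + \<rho> * torus_mean (\<lambda>\<psi>. g \<psi> * v (Ait (Suc m) \<psi>))"
      unfolding a_def
      by (subst torus_mean_add, rule prod, rule continuous_on_mult_left[OF prod(2)], subst torus_mean_cmult, rule prod, rule refl)
    finally have "a m = a (Suc m) + \<rho> * torus_mean (\<lambda>\<psi>. g \<psi> * v (Ait (Suc m) \<psi>))" .
    moreover have "\<bar>torus_mean (\<lambda>\<psi>. g \<psi> * v (Ait (Suc m) \<psi>))\<bar> \<le> B' * \<sigma> ^ (2 * Suc m)"
      using decay_of_correlations[OF g_obs v, of "Suc m"] by (simp add: B'_def del: funpow.simps)
    then have "\<bar>\<rho> * torus_mean (\<lambda>\<psi>. g \<psi> * v (Ait (Suc m) \<psi>))\<bar> \<le> \<rho> * (B' * \<sigma> ^ (2 * Suc m))"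
      unfolding abs_mult using \<rho> by (intro mult_mono) auto
    ultimately show ?thesis by (simp del: funpow.simps)
  qed
  have partial: "\<bar>a n\<bar> \<le> \<bar>a (n + m)\<bar> + \<rho> * B' * \<sigma> ^ n * (\<Sum>j<m. \<sigma> ^ j)" for m
  proof (induction m)
    case (Suc m)
    have "\<sigma> ^ (2 * Suc (n + m)) \<le> \<sigma> ^ (n + m)" using \<sigma>_pos \<sigma>_less_1 by (intro power_decreasing) auto
    then have "\<rho> * B' * \<sigma> ^ (2 * Suc (n + m)) \<le> \<rho> * B' * \<sigma> ^ (n + m)" using \<rho> B' by (intro mult_left_mono) auto
    then have "\<bar>a (n + m)\<bar> \<le> \<bar>a (n + Suc m)\<bar> + \<rho> * B' * \<sigma> ^ n * \<sigma> ^ m" using shift[of "n + m"] by (simp add: power_add)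
    then show ?case using Suc by (simp add: algebra_simps)
  qed simp
  have sum_le: "(\<Sum>j<m. \<sigma> ^ j) \<le> 1 / (1 - \<sigma>)" for m
    using \<sigma>_pos \<sigma>_less_1 by (subst sum_gp_strict) (auto simp: field_simps)
  \<comment> \<open>Mixing with a constant of order one sends \<open>a (n + m)\<close> to 0 as m
    grows, so that only the telescoped terms with \<rho> survive.\<close>
  have "\<bar>a n\<bar> \<le> mix_const * (\<phi>M - \<phi>m + K') * c * \<sigma> ^ m + \<rho> * B' * \<sigma> ^ n * (1 / (1 - \<sigma>))" for m
  proof -
    have "\<bar>a (n + m)\<bar> \<le> mix_const * (\<phi>M - \<phi>m + K') * c * \<sigma> ^ (2 * (n + m))"
      using decay_of_correlations[OF W_obs v, of "n + m"] by (simp add: a_def)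
    also have "\<dots> \<le> mix_const * (\<phi>M - \<phi>m + K') * c * \<sigma> ^ m"
      using \<sigma>_pos \<sigma>_less_1 mix_const_nonneg \<phi>_width K'_nonneg c0 by (intro mult_left_mono power_decreasing) auto
    finally have 1: "\<bar>a (n + m)\<bar> \<le> mix_const * (\<phi>M - \<phi>m + K') * c * \<sigma> ^ m" .
    have "\<rho> * B' * \<sigma> ^ n * (\<Sum>j<m. \<sigma> ^ j) \<le> \<rho> * B' * \<sigma> ^ n * (1 / (1 - \<sigma>))"
      using \<rho> B' \<sigma>_pos by (intro mult_left_mono sum_le) auto
    then show ?thesis using partial[of m] 1 by linarith
  qed
  moreover have "(\<lambda>m. mix_const * (\<phi>M - \<phi>m + K') * c * \<sigma> ^ m + \<rho> * B' * \<sigma> ^ n * (1 / (1 - \<sigma>)))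
      \<longlonglongrightarrow> mix_const * (\<phi>M - \<phi>m + K') * c * 0 + \<rho> * B' * \<sigma> ^ n * (1 / (1 - \<sigma>))"
    using \<sigma>_pos \<sigma>_less_1 by (intro tendsto_intros LIMSEQ_power_zero) auto
  ultimately have "\<bar>a n\<bar> \<le> mix_const * (\<phi>M - \<phi>m + K') * c * 0 + \<rho> * B' * \<sigma> ^ n * (1 / (1 - \<sigma>))"
    by (intro LIMSEQ_le_const) auto
  then show ?thesis by (simp add: a_def B'_def CC_def algebra_simps add_divide_distrib)
qed

definition CE :: real where "CE = (CW\<^sup>2 + 2 * K * CC) / \<gamma>"

lemma CE_nonneg: "0 \<le> CE"
  using CC_nonneg K \<gamma> by (simp add: CE_def)

lemma f1_mean_bound: "\<bar>torus_mean (f1 u)\<bar> \<le> 1"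
  by (rule torus_mean_bound[OF torus_continuous_cont[OF f1_torus] f1_le])

lemma f1_centred: "smooth_obs (2 * K) (\<lambda>\<psi>. f1 u \<psi> - torus_mean (f1 u))" "torus_mean (\<lambda>\<psi>. f1 u \<psi> - torus_mean (f1 u)) = 0"
  using smooth_centred[OF f1_torus f1_le f1_holder, where C = K] K by simp_all

text \<open>Invariance makes the mean of \<open>f\<close> along the graph vanish. Expanding at 0
  isolates the mean of \<open>W\<close> with a coefficient of modulus at least \<gamma>; what is
  left is a correlation of \<open>W\<close> with a centred function and a remainder bounded by the
  mean of \<open>W\<^sup>2\<close>, both of order \<rho>.\<close>

lemma W_mean: "\<bar>torus_mean W\<bar> \<le> CE * \<rho>"
proof -
  note Wc = torus_continuous_cont[OF W_torus]
  define b where "b = torus_mean (f1 0)"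
  define v where "v \<psi> = f1 0 \<psi> - b" for \<psi>
  define e where "e \<psi> = f (W \<psi>) \<psi> - f 0 \<psi> - f1 0 \<psi> * W \<psi>" for \<psi>
  have ft: "torus_continuous (\<lambda>\<psi>. f (W \<psi>) \<psi>)" using f_comp[OF W_torus, of 0] by simp
  have vt: "torus_continuous v" unfolding v_def[abs_def] by (intro torus_continuous_intros f1_torus)
  have et: "torus_continuous e" unfolding e_def[abs_def] by (intro torus_continuous_intros ft f_torus f1_torus W_torus)
  have v: "smooth_obs (2 * K) v" "torus_mean v = 0"
    using f1_centred[of 0] by (simp_all add: v_def[abs_def] b_def)
  note cont = torus_continuous_cont[OF ft] torus_continuous_cont[OF vt] torus_continuous_cont[OF et]
    torus_continuous_cont[OF f_torus] Wc
  have "torus_mean W = torus_mean (\<lambda>\<psi>. W \<psi> + \<rho> * f (W \<psi>) \<psi>)"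
    using torus_mean_matrix[OF W_torus A_int AB] by (simp add: W_step)
  also have "\<dots> = torus_mean W + \<rho> * torus_mean (\<lambda>\<psi>. f (W \<psi>) \<psi>)"
    by (simp add: torus_mean_add torus_mean_cmult cont continuous_on_mult_left)
  finally have zero: "torus_mean (\<lambda>\<psi>. f (W \<psi>) \<psi>) = 0" using \<rho> by simp
  have "torus_mean (\<lambda>\<psi>. f (W \<psi>) \<psi>) = torus_mean (\<lambda>\<psi>. f 0 \<psi> + (b * W \<psi> + (W \<psi> * v \<psi> + e \<psi>)))"
    by (rule arg_cong[of _ _ torus_mean]) (auto simp: e_def v_def algebra_simps)
  also have "\<dots> = b * torus_mean W + (torus_mean (\<lambda>\<psi>. W \<psi> * v \<psi>) + torus_mean e)"
    by (simp add: torus_mean_add torus_mean_cmult cont continuous_on_add continuous_on_mult continuous_on_mult_left mean_f0)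
  finally have "b * torus_mean W = - (torus_mean (\<lambda>\<psi>. W \<psi> * v \<psi>) + torus_mean e)" using zero by simp
  moreover have "\<bar>torus_mean (\<lambda>\<psi>. W \<psi> * v \<psi>)\<bar> \<le> \<rho> * CC * (2 * K)" using W_correlation[OF v, of 0] by simp
  moreover have "\<bar>torus_mean e\<bar> \<le> CW\<^sup>2 * \<rho>"
  proof -
    have "\<bar>torus_mean e\<bar> \<le> torus_mean (\<lambda>\<psi>. (W \<psi>)\<^sup>2)"
      using taylor_1[of "W _" _ 0] by (intro torus_mean_abs_le cont continuous_on_power) (simp add: e_def)
    also have "\<dots> \<le> CW\<^sup>2 * \<rho>" using W_square[of 0] by simp
    finally show ?thesis .
  qed
  ultimately have "\<bar>b * torus_mean W\<bar> \<le> (CW\<^sup>2 + 2 * K * CC) * \<rho>" by (simp add: algebra_simps)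
  moreover have "\<gamma> * \<bar>torus_mean W\<bar> \<le> \<bar>b * torus_mean W\<bar>"
  proof -
    have "b \<le> torus_mean (\<lambda>\<psi>. - \<gamma>)" unfolding b_def
      using f1_neg[of 0] S by (intro torus_mean_mono torus_continuous_cont f1_torus torus_continuous_const) auto
    then have "\<gamma> \<le> \<bar>b\<bar>" using \<gamma> by (simp add: torus_mean_const)
    then show ?thesis unfolding abs_mult by (intro mult_right_mono) auto
  qed
  ultimately have "\<gamma> * \<bar>torus_mean W\<bar> \<le> (CW\<^sup>2 + 2 * K * CC) * \<rho>" by linarith
  then show ?thesis using \<gamma> by (simp add: CE_def field_simps)
qed

text \<open>Three groups: the correlation of the deviation, the two terms linear in
  \<open>W\<close>, and the Taylor remainder.\<close>

definition CF :: real where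
  "CF = (2 * K * CC + summed_mix * C3 * (2 * K)) + (C1 * CE + CC * (2 * (K * C1))) + (2 * CD\<^sup>2 + (1 + C1) * CW\<^sup>2)"

lemma CF_nonneg: "0 \<le> CF"
  using K CC_nonneg summed_mix_nonneg C3_nonneg C1_nonneg CE_nonneg by (simp add: CF_def)

text \<open>The Cauchy-Schwarz inequality would give only order sqrt \<rho>. Writing the deviation
  as a sum puts \<rho> in front, while the correlations of the increments with \<open>v\<close> at
  time n are summable; the starting value is covered by \<open>W_correlation\<close>.\<close>

lemma dev_correlation:
  assumes v: "smooth_obs c v" "torus_mean v = 0"
  shows "\<bar>torus_mean (\<lambda>\<psi>. dev n \<psi> * v (Ait n \<psi>))\<bar> \<le> (c * CC + summed_mix * C3 * c) * \<rho> * q ^ n"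
proof -
  have c0: "0 \<le> c" by (rule smooth_obs_nonneg[OF v(1)])
  have vt: "torus_continuous v" using v by (simp add: smooth_obs_def)
  have c1: "continuous_on UNIV (\<lambda>\<psi>. (\<Sum>k<n. 1 * incr k \<psi>) * v (Ait n \<psi>))" "continuous_on UNIV (\<lambda>\<psi>. W \<psi> * v (Ait n \<psi>))"
    by (intro torus_continuous_cont torus_continuous_mult torus_continuous_sum torus_continuous_Ait[OF vt]
        incr_torus W_torus torus_continuous_const)+
  have "torus_mean (\<lambda>\<psi>. dev n \<psi> * v (Ait n \<psi>)) =
      torus_mean (\<lambda>\<psi>. \<rho> * ((\<Sum>k<n. 1 * incr k \<psi>) * v (Ait n \<psi>)) - W \<psi> * v (Ait n \<psi>))"
    unfolding dev_eq_sum by (simp add: algebra_simps)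
  also have "\<dots> = \<rho> * torus_mean (\<lambda>\<psi>. (\<Sum>k<n. 1 * incr k \<psi>) * v (Ait n \<psi>)) - torus_mean (\<lambda>\<psi>. W \<psi> * v (Ait n \<psi>))"
    by (subst torus_mean_diff, rule continuous_on_mult_left[OF c1(1)], rule c1, subst torus_mean_cmult, rule c1, rule refl)
  finally have eq: "torus_mean (\<lambda>\<psi>. dev n \<psi> * v (Ait n \<psi>)) =
      \<rho> * torus_mean (\<lambda>\<psi>. (\<Sum>k<n. 1 * incr k \<psi>) * v (Ait n \<psi>)) - torus_mean (\<lambda>\<psi>. W \<psi> * v (Ait n \<psi>))" .
  have "\<bar>torus_mean (\<lambda>\<psi>. (\<Sum>k<n. 1 * incr k \<psi>) * v (Ait n \<psi>))\<bar> \<le> summed_mix * C3 * c * q ^ n"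
    unfolding summed_mix_def by (rule correlation_sum[OF incr_obs _ v q(2) C3_nonneg]) auto
  then have "\<bar>\<rho> * torus_mean (\<lambda>\<psi>. (\<Sum>k<n. 1 * incr k \<psi>) * v (Ait n \<psi>))\<bar> \<le> \<rho> * (summed_mix * C3 * c * q ^ n)"
    unfolding abs_mult using \<rho> by (intro mult_mono) auto
  moreover have "\<bar>torus_mean (\<lambda>\<psi>. W \<psi> * v (Ait n \<psi>))\<bar> \<le> \<rho> * CC * c * q ^ n"
  proof (rule order_trans[OF W_correlation[OF v]])
    show "\<rho> * CC * c * \<sigma> ^ n \<le> \<rho> * CC * c * q ^ n"
      using \<rho> CC_nonneg c0 \<sigma>_pos q by (intro mult_left_mono power_mono) auto
  qed
  ultimately show ?thesis unfolding eq by (simp add: algebra_simps)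
qed

text \<open>Second-order expansion around \<open>y n\<close>. Each term linear in the deviation or
  in \<open>W\<close> splits into mean coefficient times mean plus a correlation with the centred
  coefficient, and the forcing has mean zero. The coefficient of \<open>W\<close> is a difference of
  \<open>f1\<close> at \<open>y n\<close> and at 0, hence small with \<open>y n\<close>.\<close>

lemma mean_incr:
  "\<exists>b. \<bar>b\<bar> \<le> 1 \<and> (T \<le> \<rho> * real n \<longrightarrow> b \<le> - g2) \<and>
    \<bar>torus_mean (incr n) - b * torus_mean (dev n)\<bar> \<le> CF * \<rho> * q ^ n"
proof -
  define b where "b = torus_mean (f1 (y n))"
  define v where "v \<psi> = f1 (y n) \<psi> - b" for \<psi>
  define u0 where "u0 = torus_mean (\<lambda>\<psi>. f1 (y n) \<psi> - f1 0 \<psi>)"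
  define u where "u \<psi> = f1 (y n) \<psi> - f1 0 \<psi> - u0" for \<psi>
  define Wn where "Wn \<psi> = W (Ait n \<psi>)" for \<psi>
  define e where "e \<psi> = incr n \<psi> - (forcing n (Ait n \<psi>) + (b * dev n \<psi> + (dev n \<psi> * v (Ait n \<psi>) + (u0 * Wn \<psi> + Wn \<psi> * u (Ait n \<psi>)))))" for \<psi>
  have q0: "0 < q ^ n" "q ^ n \<le> 1" using q by (auto simp: power_le_one)
  have ft: "torus_continuous (forcing n)" using forcing_obs by (auto simp: smooth_obs_def)
  have vt: "torus_continuous v" unfolding v_def[abs_def] by (intro torus_continuous_intros f1_torus)
  have u1: "torus_continuous (\<lambda>\<psi>. f1 (y n) \<psi> - f1 0 \<psi>)" by (intro torus_continuous_intros f1_torus)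
  have ut: "torus_continuous u" unfolding u_def[abs_def] by (intro torus_continuous_intros f1_torus)
  have Wt: "torus_continuous Wn" unfolding Wn_def[abs_def] by (rule WA_torus)
  note A = torus_continuous_Ait[OF ft, of n] torus_continuous_Ait[OF vt, of n] torus_continuous_Ait[OF ut, of n]
  have et: "torus_continuous e" unfolding e_def[abs_def]
    by (intro torus_continuous_diff torus_continuous_add torus_continuous_mult torus_continuous_const A Wt dev_torus incr_torus)
  note cont = A[THEN torus_continuous_cont] torus_continuous_cont[OF et] torus_continuous_cont[OF Wt] torus_continuous_cont[OF dev_torus]
  have v: "smooth_obs (2 * K) v" "torus_mean v = 0"
    using f1_centred[of "y n"] by (simp_all add: v_def[abs_def] b_def)
  have ub: "\<bar>f1 (y n) \<psi> - f1 0 \<psi>\<bar> \<le> \<bar>y n\<bar>" for \<psi> using f1_lip[of "y n" \<psi> 0] by simp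
  have u: "smooth_obs (2 * (K * (C1 * q ^ n))) u" "torus_mean u = 0"
  proof -
    have "holder_const (K * \<bar>y n\<bar>) (\<lambda>\<psi>. f1 (y n) \<psi> - f1 0 \<psi>)"
      using holder_difference(2)[of "y n" _ 0] by (simp add: holder_const_def)
    moreover have "0 \<le> K * (C1 * q ^ n)" using y_le(1) abs_ge_zero order_trans by blast
    then have "K * \<bar>y n\<bar> \<le> 2 * (K * (C1 * q ^ n))" using y_le(2)[of n] by linarith
    ultimately show "smooth_obs (2 * (K * (C1 * q ^ n))) u" "torus_mean u = 0"
      using smooth_centred[OF u1 ub, of "K * \<bar>y n\<bar>" "K * (C1 * q ^ n)"] y_le(1)
      by (simp_all add: u_def[abs_def] u0_def)
  qed
  have "torus_mean (incr n) = torus_mean (\<lambda>\<psi>. (forcing n (Ait n \<psi>) + (b * dev n \<psi> + (dev n \<psi> * v (Ait n \<psi>) + (u0 * Wn \<psi> + Wn \<psi> * u (Ait n \<psi>))))) + e \<psi>)"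
    by (rule arg_cong[of _ _ torus_mean]) (auto simp: e_def)
  also have "\<dots> = torus_mean (\<lambda>\<psi>. forcing n (Ait n \<psi>)) + (b * torus_mean (dev n) + (torus_mean (\<lambda>\<psi>. dev n \<psi> * v (Ait n \<psi>))
      + (u0 * torus_mean Wn + torus_mean (\<lambda>\<psi>. Wn \<psi> * u (Ait n \<psi>))))) + torus_mean e"
    by (simp add: torus_mean_add torus_mean_cmult cont continuous_on_add continuous_on_mult continuous_on_mult_left)
  also have "torus_mean (\<lambda>\<psi>. forcing n (Ait n \<psi>)) = 0" by (simp add: torus_mean_Ait[OF ft] mean_forcing)
  finally have dec: "torus_mean (incr n) - b * torus_mean (dev n) = torus_mean (\<lambda>\<psi>. dev n \<psi> * v (Ait n \<psi>))
      + (u0 * torus_mean Wn + torus_mean (\<lambda>\<psi>. Wn \<psi> * u (Ait n \<psi>))) + torus_mean e" by simp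
  have 1: "\<bar>torus_mean (\<lambda>\<psi>. dev n \<psi> * v (Ait n \<psi>))\<bar> \<le> (2 * K * CC + summed_mix * C3 * (2 * K)) * \<rho> * q ^ n"
    by (rule dev_correlation[OF v])
  have 2: "\<bar>u0 * torus_mean Wn\<bar> \<le> C1 * CE * \<rho> * q ^ n"
  proof -
    have "\<bar>u0\<bar> \<le> C1 * q ^ n" unfolding u0_def
      using torus_mean_bound[OF torus_continuous_cont[OF u1] ub] y_bound[of n] by linarith
    moreover have "\<bar>torus_mean Wn\<bar> \<le> CE * \<rho>"
      using W_mean torus_mean_Ait[OF W_torus, of n] by (simp add: Wn_def[abs_def])
    ultimately have "\<bar>u0\<bar> * \<bar>torus_mean Wn\<bar> \<le> (C1 * q ^ n) * (CE * \<rho>)"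
      using C1_nonneg q0 by (intro mult_mono) auto
    then show ?thesis by (simp add: abs_mult mult_ac)
  qed
  have 3: "\<bar>torus_mean (\<lambda>\<psi>. Wn \<psi> * u (Ait n \<psi>))\<bar> \<le> CC * (2 * (K * C1)) * \<rho> * q ^ n"
  proof -
    have "torus_mean (\<lambda>\<psi>. Wn \<psi> * u (Ait n \<psi>)) = torus_mean (\<lambda>\<psi>. W \<psi> * u \<psi>)"
      unfolding Wn_def by (rule torus_mean_Ait) (intro torus_continuous_mult W_torus ut)
    then show ?thesis using W_correlation[OF u, of 0] by (simp add: mult_ac)
  qed
  have 4: "\<bar>torus_mean e\<bar> \<le> (2 * CD\<^sup>2 + (1 + C1) * CW\<^sup>2) * \<rho> * q ^ n"
  proof -
    \<comment> \<open>The product of deviation and \<open>W\<close> is split with the weight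
      \<open>q ^ n\<close>: the mean square of the deviation has a factor \<open>q ^ n\<close> to
      spare, that of \<open>W\<close> has none, and after weighting both contribute order
      \<open>\<rho> * q ^ n\<close>.\<close>
    have pt: "\<bar>e \<psi>\<bar> \<le> (1 + 1 / q ^ n) * (dev n \<psi>)\<^sup>2 + (1 + C1) * q ^ n * (Wn \<psi>)\<^sup>2" for \<psi>
    proof -
      define \<psi>\<^sub>1 where "\<psi>\<^sub>1 = Ait n \<psi>"
      define d where "d = dev n \<psi>"
      define v1 where "v1 = Wn \<psi>"
      have x: "x n \<psi> = y n + v1 + d" by (simp add: dev_def d_def v1_def Wn_def)
      \<comment> \<open>A Taylor step from \<open>y n + v1\<close> to the orbit, the derivative
        moved from \<open>y n + v1\<close> to \<open>y n\<close>, and the mixed remainder of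
        \<open>taylor_cross\<close>.\<close>
      have "e \<psi> = (f (x n \<psi>) \<psi>\<^sub>1 - f (y n + v1) \<psi>\<^sub>1 - f1 (y n + v1) \<psi>\<^sub>1 * d) + (f1 (y n + v1) \<psi>\<^sub>1 - f1 (y n) \<psi>\<^sub>1) * d
          + (f (y n + v1) \<psi>\<^sub>1 - f v1 \<psi>\<^sub>1 - f (y n) \<psi>\<^sub>1 + f 0 \<psi>\<^sub>1 - (f1 (y n) \<psi>\<^sub>1 - f1 0 \<psi>\<^sub>1) * v1)"
        by (simp add: e_def incr_def forcing_def v_def u_def \<psi>\<^sub>1_def d_def v1_def Wn_def algebra_simps)
      moreover have "\<bar>f (x n \<psi>) \<psi>\<^sub>1 - f (y n + v1) \<psi>\<^sub>1 - f1 (y n + v1) \<psi>\<^sub>1 * d\<bar> \<le> d\<^sup>2"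
        using taylor_1[of "x n \<psi>" \<psi>\<^sub>1 "y n + v1"] by (simp add: x)
      moreover have "\<bar>(f1 (y n + v1) \<psi>\<^sub>1 - f1 (y n) \<psi>\<^sub>1) * d\<bar> \<le> \<bar>v1\<bar> * \<bar>d\<bar>"
        unfolding abs_mult using f1_lip[of "y n + v1" \<psi>\<^sub>1 "y n"] by (intro mult_right_mono) auto
      moreover have "\<bar>v1\<bar> * \<bar>d\<bar> \<le> q ^ n * v1\<^sup>2 + 1 / q ^ n * d\<^sup>2"
      proof -
        have "0 \<le> (q ^ n * \<bar>v1\<bar> - \<bar>d\<bar>)\<^sup>2" by simp
        then have "2 * (q ^ n * (\<bar>v1\<bar> * \<bar>d\<bar>)) \<le> (q ^ n)\<^sup>2 * v1\<^sup>2 + d\<^sup>2"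
          by (simp add: power2_diff power_mult_distrib)
        moreover have "0 \<le> q ^ n * (\<bar>v1\<bar> * \<bar>d\<bar>)" using q0 by simp
        ultimately have "q ^ n * (\<bar>v1\<bar> * \<bar>d\<bar>) \<le> (q ^ n)\<^sup>2 * v1\<^sup>2 + d\<^sup>2" by linarith
        also have "\<dots> = q ^ n * (q ^ n * v1\<^sup>2 + 1 / q ^ n * d\<^sup>2)" using q(3) by (simp add: field_simps power2_eq_square)
        finally show ?thesis using q0 by simp
      qed
      moreover have "\<bar>f (y n + v1) \<psi>\<^sub>1 - f v1 \<psi>\<^sub>1 - f (y n) \<psi>\<^sub>1 + f 0 \<psi>\<^sub>1 - (f1 (y n) \<psi>\<^sub>1 - f1 0 \<psi>\<^sub>1) * v1\<bar> \<le> (C1 * q ^ n) * v1\<^sup>2"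
        by (rule order_trans[OF taylor_cross]) (intro mult_right_mono y_bound zero_le_power2)
      ultimately have "\<bar>e \<psi>\<bar> \<le> d\<^sup>2 + (q ^ n * v1\<^sup>2 + 1 / q ^ n * d\<^sup>2) + (C1 * q ^ n) * v1\<^sup>2" by linarith
      then show ?thesis by (simp add: d_def v1_def algebra_simps)
    qed
    have "\<bar>torus_mean e\<bar> \<le> torus_mean (\<lambda>\<psi>. (1 + 1 / q ^ n) * (dev n \<psi>)\<^sup>2 + (1 + C1) * q ^ n * (Wn \<psi>)\<^sup>2)"
      using pt by (intro torus_mean_abs_le cont continuous_on_add continuous_on_mult_left continuous_on_power) auto
    also have "\<dots> = (1 + 1 / q ^ n) * torus_mean (\<lambda>\<psi>. (dev n \<psi>)\<^sup>2) + (1 + C1) * q ^ n * torus_mean (\<lambda>\<psi>. (Wn \<psi>)\<^sup>2)"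
      by (simp add: torus_mean_add torus_mean_cmult cont continuous_on_mult_left continuous_on_power)
    also have "\<dots> \<le> (1 + 1 / q ^ n) * (CD\<^sup>2 * \<rho> * q ^ (2 * n)) + (1 + C1) * q ^ n * (CW\<^sup>2 * \<rho>)"
      using q0 C1_nonneg dev_square[of n] W_square[of n] unfolding Wn_def by (intro add_mono mult_left_mono) auto
    also have "(1 + 1 / q ^ n) * (CD\<^sup>2 * \<rho> * q ^ (2 * n)) = (q ^ n + 1) * (CD\<^sup>2 * \<rho> * q ^ n)"
    proof -
      have "q ^ (2 * n) = q ^ n * q ^ n" by (simp add: mult_2 power_add)
      then show ?thesis using q(3) by (simp add: distrib_right)
    qed
    also have "\<dots> \<le> 2 * (CD\<^sup>2 * \<rho> * q ^ n)" using q0 \<rho> by (intro mult_right_mono) auto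
    finally show ?thesis by (simp add: algebra_simps)
  qed
  have "\<bar>torus_mean (incr n) - b * torus_mean (dev n)\<bar> \<le> CF * \<rho> * q ^ n"
  proof -
    have "CF * \<rho> * q ^ n = (2 * K * CC + summed_mix * C3 * (2 * K)) * \<rho> * q ^ n
        + (C1 * CE * \<rho> * q ^ n + CC * (2 * (K * C1)) * \<rho> * q ^ n) + (2 * CD\<^sup>2 + (1 + C1) * CW\<^sup>2) * \<rho> * q ^ n"
      by (simp add: CF_def distrib_right)
    then show ?thesis unfolding dec using 1 2 3 4 by linarith
  qed
  moreover have "b \<le> - g2" if "T \<le> \<rho> * real n"
  proof -
    have "f1 (y n) \<psi> \<le> - g2" for \<psi>
    proof -
      have "f1 (y n) \<psi> \<le> - \<gamma> + (\<gamma> - \<gamma>') / 2"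
        using f1_neg[of 0 \<psi>] S ub[of \<psi>] late(3)[OF that] by linarith
      then show ?thesis by (simp add: g2_def field_simps)
    qed
    then have "b \<le> torus_mean (\<lambda>\<psi>. - g2)" unfolding b_def
      by (intro torus_mean_mono torus_continuous_cont f1_torus torus_continuous_const) auto
    then show ?thesis by (simp add: torus_mean_const)
  qed
  moreover have "\<bar>b\<bar> \<le> 1" unfolding b_def by (rule f1_mean_bound)
  ultimately show ?thesis by blast
qed

text \<open>The recursion for the means has slope \<open>b\<close> and a source of order
  \<open>\<rho>\<^sup>2 * q ^ n\<close>, and it starts from minus the mean of \<open>W\<close>,
  already of order \<rho>; decay in two regimes preserves this order.\<close>

lemma dev_mean: "\<bar>torus_mean (dev n)\<bar> \<le> R * (CE + CF) * \<rho> * q ^ n"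
proof -
  define E where "E = CF * \<rho>"
  have E0: "0 \<le> E" using CF_nonneg \<rho> by (simp add: E_def)
  have step: "\<bar>torus_mean (dev (Suc n))\<bar> \<le> \<kappa> * \<bar>torus_mean (dev n)\<bar> + \<rho> * E * q ^ n"
    if \<kappa>: "\<And>a. \<bar>a\<bar> \<le> 1 \<Longrightarrow> (T \<le> \<rho> * real n \<longrightarrow> a \<le> - g2) \<Longrightarrow> \<bar>1 + \<rho> * a\<bar> \<le> \<kappa>" for \<kappa> n
  proof -
    obtain b where b: "\<bar>b\<bar> \<le> 1" "T \<le> \<rho> * real n \<longrightarrow> b \<le> - g2"
      "\<bar>torus_mean (incr n) - b * torus_mean (dev n)\<bar> \<le> E * q ^ n"
      using mean_incr unfolding E_def by blast
    have "dev (Suc n) = (\<lambda>\<psi>. dev n \<psi> + \<rho> * incr n \<psi>)" by (rule ext) (rule dev_Suc)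
    then have "torus_mean (dev (Suc n)) = torus_mean (dev n) + \<rho> * torus_mean (incr n)"
      by (simp add: torus_mean_add torus_mean_cmult torus_continuous_cont dev_torus incr_torus continuous_on_mult_left)
    then have eq: "torus_mean (dev (Suc n)) = (1 + \<rho> * b) * torus_mean (dev n) + \<rho> * (torus_mean (incr n) - b * torus_mean (dev n))"
      by (simp add: algebra_simps)
    have "\<bar>(1 + \<rho> * b) * torus_mean (dev n)\<bar> \<le> \<kappa> * \<bar>torus_mean (dev n)\<bar>"
      unfolding abs_mult using \<kappa>[OF b(1,2)] by (intro mult_right_mono) auto
    moreover have "\<bar>\<rho> * (torus_mean (incr n) - b * torus_mean (dev n))\<bar> \<le> \<rho> * E * q ^ n"
      unfolding abs_mult mult.assoc using \<rho> b(3) by (intro mult_mono) auto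
    ultimately show ?thesis unfolding eq by (intro order_trans[OF abs_triangle_ineq] add_mono)
  qed
  have "\<bar>torus_mean (dev n)\<bar> \<le> R * (\<bar>torus_mean (dev 0)\<bar> + E) * q ^ n"
  proof (rule decay[OF E0])
    show "\<bar>torus_mean (dev (Suc n))\<bar> \<le> (1 + \<rho>) * \<bar>torus_mean (dev n)\<bar> + \<rho> * E * q ^ n" for n
      by (rule step) (use factor_le in auto)
    show "\<bar>torus_mean (dev (Suc n))\<bar> \<le> (1 - \<rho> * g2) * \<bar>torus_mean (dev n)\<bar> + \<rho> * E * q ^ n" if "T \<le> \<rho> * real n" for n
      by (rule step) (use factor_le' that in auto)
  qed simp
  also have "torus_mean (dev 0) = - torus_mean W"
    by (simp add: dev_def[abs_def] torus_mean_minus torus_continuous_cont[OF W_torus])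
  also have "R * (\<bar>- torus_mean W\<bar> + E) * q ^ n \<le> R * (CE * \<rho> + E) * q ^ n"
    using R_pos q W_mean by (intro mult_right_mono mult_left_mono) auto
  also have "\<dots> = R * (CE + CF) * \<rho> * q ^ n" by (simp add: E_def algebra_simps)
  finally show ?thesis .
qed

end

section \<open>The averaging theorem\<close>

lemma (in drift) averaging_estimate:
  assumes \<gamma>': "0 < \<gamma>'" "\<gamma>' < \<gamma>"
  obtains C where "\<And>\<rho> \<phi> W n. 0 < \<rho> \<Longrightarrow> \<rho> < \<rho>_max \<Longrightarrow> \<phi>m \<le> \<phi> \<Longrightarrow> \<phi> \<le> \<phi>M \<Longrightarrow> slow_manifold \<rho> W \<Longrightarrow>
    \<bar>torus_mean (\<lambda>\<psi>. orbit \<rho> \<phi> n \<psi> - (mean_orbit \<rho> \<phi> n + W (Ait n \<psi>)))\<bar> \<le> C * \<rho> * (1 - \<rho> * \<gamma>') ^ n \<and>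
    torus_mean (\<lambda>\<psi>. (orbit \<rho> \<phi> n \<psi> - (mean_orbit \<rho> \<phi> n + W (Ait n \<psi>)))\<^sup>2) \<le> C * \<rho> * (1 - \<rho> * \<gamma>') ^ (2 * n)"
proof -
  obtain T where T: "0 \<le> T" "absorbed ((\<gamma> - \<gamma>') / 2) T"
    using absorption[of "(\<gamma> - \<gamma>') / 2"] \<gamma>' by auto
  \<comment> \<open>Formed before any run is interpreted: none of \<rho>, \<phi> and
    \<open>W\<close> is an argument of these constants, which is the required uniformity.\<close>
  define Cm where "Cm = drift_run.R \<gamma> \<gamma>' T * (drift_run.CE z \<zeta> w \<alpha> \<sigma> K \<gamma> + drift_run.CF z \<zeta> w \<alpha> \<sigma> K \<gamma> \<phi>m \<phi>M \<gamma>' T)"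
  define Cs where "Cs = (drift_run.CD z \<zeta> w \<alpha> \<sigma> K \<gamma> \<phi>m \<phi>M \<gamma>' T)\<^sup>2"
  show thesis
  proof (rule that[of "max Cm Cs"])
    fix \<rho> \<phi> W n
    assume *: "0 < \<rho>" "\<rho> < \<rho>_max" "\<phi>m \<le> \<phi>" "\<phi> \<le> \<phi>M" "slow_manifold \<rho> W"
    interpret run: drift_run A B \<mu> \<nu> r z \<zeta> w \<alpha> \<sigma> f f1 f2 f3 K \<gamma> \<phi>m \<phi>M Sm SM \<gamma>' T \<rho> \<phi> W
      by unfold_locales (use \<gamma>' T * in auto)
    have q: "run.q = 1 - \<rho> * \<gamma>'" by (rule run.q_def)
    have "Cm * \<rho> * run.q ^ n \<le> max Cm Cs * \<rho> * run.q ^ n" "Cs * \<rho> * run.q ^ (2 * n) \<le> max Cm Cs * \<rho> * run.q ^ (2 * n)"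
      using *(1) run.q(3) by (auto intro!: mult_right_mono)
    then show "\<bar>torus_mean (\<lambda>\<psi>. orbit \<rho> \<phi> n \<psi> - (mean_orbit \<rho> \<phi> n + W (Ait n \<psi>)))\<bar> \<le> max Cm Cs * \<rho> * (1 - \<rho> * \<gamma>') ^ n \<and>
      torus_mean (\<lambda>\<psi>. (orbit \<rho> \<phi> n \<psi> - (mean_orbit \<rho> \<phi> n + W (Ait n \<psi>)))\<^sup>2) \<le> max Cm Cs * \<rho> * (1 - \<rho> * \<gamma>') ^ (2 * n)"
      using run.dev_mean[of n] run.dev_square[of n]
      unfolding q Cm_def[symmetric] Cs_def[symmetric] run.dev_def[abs_def] by linarith
  qed
qed

section \<open>From the norm and the zero curve to the working hypotheses\<close>

lemma B_space_bounds:
  assumes f: "f \<in> B_space \<alpha> k" and norm: "B_norm \<alpha> k f \<le> 1" and \<alpha>: "0 < \<alpha>"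
  shows "n \<le> k \<Longrightarrow> \<bar>(dphi ^^ n) f \<phi> \<psi>\<bar> \<le> 1"
    and "n < k \<Longrightarrow> \<bar>(dphi ^^ n) f \<phi> \<psi>' - (dphi ^^ n) f \<phi> \<psi>\<bar> \<le> 1 / \<alpha> * norm (\<psi>' - \<psi>) powr \<alpha>"
    and "n < k \<Longrightarrow> ((\<lambda>x. (dphi ^^ n) f x \<psi>) has_real_derivative (dphi ^^ Suc n) f \<phi> \<psi>) (at \<phi>)"
    and "torus_periodic ((dphi ^^ n) f \<phi>)"
proof -
  let ?g = "(dphi ^^ n) f"
  {
    assume "n \<le> k"
    have "ennreal \<bar>?g \<phi> \<psi>\<bar> \<le> sup_norm ?g"
      unfolding sup_norm_def by (intro SUP_upper2[of \<phi>] SUP_upper2[of \<psi>]) auto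
    also have "\<dots> \<le> (\<Sum>n\<le>k. sup_norm ((dphi ^^ n) f))"
      using \<open>n \<le> k\<close> by (intro member_le_sum) auto
    also have "\<dots> \<le> B_norm \<alpha> k f" unfolding B_norm_def by simp
    also have "\<dots> \<le> 1" by (rule norm)
    finally show "\<bar>?g \<phi> \<psi>\<bar> \<le> 1" by simp
  }
  {
    assume "n < k"
    show "\<bar>?g \<phi> \<psi>' - ?g \<phi> \<psi>\<bar> \<le> 1 / \<alpha> * norm (\<psi>' - \<psi>) powr \<alpha>"
    proof (cases "\<psi>' = \<psi>")
      case False
      then have pos: "0 < norm (\<psi>' - \<psi>) powr \<alpha>" by simp
      have "ennreal (\<bar>?g \<phi> \<psi>' - ?g \<phi> \<psi>\<bar> / norm (\<psi>' - \<psi>) powr \<alpha>) \<le> holder_seminorm \<alpha> ?g"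
        unfolding holder_seminorm_def using False
        by (intro SUP_upper2[of \<phi>] SUP_upper2[of \<psi>] SUP_upper2[of \<psi>']) auto
      also have "\<dots> \<le> (\<Sum>n<k. holder_seminorm \<alpha> ((dphi ^^ n) f))"
        using \<open>n < k\<close> by (intro member_le_sum) auto
      finally have "ennreal \<alpha> * ennreal (\<bar>?g \<phi> \<psi>' - ?g \<phi> \<psi>\<bar> / norm (\<psi>' - \<psi>) powr \<alpha>)
          \<le> ennreal \<alpha> * (\<Sum>n<k. holder_seminorm \<alpha> ((dphi ^^ n) f))"
        by (intro mult_left_mono) auto
      also have "\<dots> \<le> B_norm \<alpha> k f" unfolding B_norm_def by simp
      also have "\<dots> \<le> 1" by (rule norm)
      \<comment> \<open>The weight \<alpha> of the seminorms in the norm is what makes the Holder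
        constant 1 / \<alpha>.\<close>
      finally have "\<alpha> * (\<bar>?g \<phi> \<psi>' - ?g \<phi> \<psi>\<bar> / norm (\<psi>' - \<psi>) powr \<alpha>) \<le> 1"
        using \<alpha> by (simp add: ennreal_mult[symmetric])
      then show ?thesis using pos \<alpha> by (simp add: field_simps)
    qed simp
  }
  {
    assume "n < k"
    then have "(\<lambda>x. ?g x \<psi>) differentiable (at \<phi>)" using f by (simp add: B_space_def)
    then show "((\<lambda>x. ?g x \<psi>) has_real_derivative (dphi ^^ Suc n) f \<phi> \<psi>) (at \<phi>)"
      by (simp add: dphi_def DERIV_deriv_iff_real_differentiable)
  }
  have "\<forall>\<phi>. torus_periodic ((dphi ^^ n) f \<phi>)" for n
  proof (induction n)
    case 0
    then show ?case using f by (simp add: B_space_def)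
  next
    case (Suc n)
    then show ?case by (simp add: torus_periodic_def dphi_def)
  qed
  then show "torus_periodic ((dphi ^^ n) f \<phi>)" by blast
qed

lemma zero_curve_props:
  assumes "\<exists>!s. s \<in> {a<..<b} \<and> f s \<psi> = 0"
  shows "a < zero_curve f a b \<psi>" "zero_curve f a b \<psi> < b" "f (zero_curve f a b \<psi>) \<psi> = 0"
    and "a < s \<Longrightarrow> s < b \<Longrightarrow> f s \<psi> = 0 \<Longrightarrow> zero_curve f a b \<psi> = s"
  using theI'[OF assms] the1_equality[OF assms, of s] unfolding zero_curve_def by auto

lemma drift_instance:
  fixes f :: "real \<Rightarrow> real^2 \<Rightarrow> real" and \<alpha> \<phi>\<^sub>m \<phi>\<^sub>M :: real
  defines "Sm \<equiv> INF \<psi>. zero_curve f \<phi>\<^sub>m \<phi>\<^sub>M \<psi>" and "SM \<equiv> SUP \<psi>. zero_curve f \<phi>\<^sub>m \<phi>\<^sub>M \<psi>"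
  assumes split: "toral_splitting A B \<mu> \<nu> r z \<zeta> w"
    and \<alpha>: "0 < \<alpha>" "\<alpha> \<le> 1"
    and f: "f \<in> B_space \<alpha> 6" "B_norm \<alpha> 6 f = 1"
    and ends: "\<forall>\<psi>. f \<phi>\<^sub>m \<psi> > 0 \<and> 0 > f \<phi>\<^sub>M \<psi>"
    and zero: "\<forall>\<psi>. \<exists>!s. s \<in> {\<phi>\<^sub>m<..<\<phi>\<^sub>M} \<and> f s \<psi> = 0"
    and rate: "contraction_rate f \<phi>\<^sub>m \<phi>\<^sub>M > 0"
    and S0: "0 \<in> {Sm..SM}"
    and mean: "\<forall>\<phi>\<in>{\<phi>\<^sub>m..\<phi>\<^sub>M}. fbar f \<phi> = 0 \<longleftrightarrow> \<phi> = 0"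
  shows "drift A B \<mu> \<nu> r z \<zeta> w \<alpha> (\<bar>\<mu>\<bar> powr (- \<alpha> / 4)) f (dphi f) ((dphi ^^ 2) f) ((dphi ^^ 3) f)
    (1 / \<alpha>) (contraction_rate f \<phi>\<^sub>m \<phi>\<^sub>M) \<phi>\<^sub>m \<phi>\<^sub>M Sm SM"
proof -
  interpret toral_splitting A B \<mu> \<nu> r z \<zeta> w by (rule split)
  interpret mix: toral_mixing A B \<mu> \<nu> r z \<zeta> w \<alpha> "\<bar>\<mu>\<bar> powr (- \<alpha> / 4)"
    by unfold_locales (use \<alpha> in auto)
  note bounds = B_space_bounds[OF f(1) eq_refl[OF f(2)] \<alpha>(1)]
  note zc = zero_curve_props[of \<phi>\<^sub>m \<phi>\<^sub>M f, OF zero[rule_format]]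
  let ?zc = "zero_curve f \<phi>\<^sub>m \<phi>\<^sub>M"
  have bdd: "bdd_below (range ?zc)" "bdd_above (range ?zc)"
    using zc(1,2) by (auto intro!: bdd_belowI[of _ \<phi>\<^sub>m] bdd_aboveI[of _ \<phi>\<^sub>M] less_imp_le)
  have Sm: "Sm \<le> ?zc \<psi>" and SM: "?zc \<psi> \<le> SM" for \<psi>
    unfolding Sm_def SM_def using bdd by (auto intro: cINF_lower cSUP_upper)
  have edge: "\<phi>\<^sub>m \<le> Sm" "SM \<le> \<phi>\<^sub>M"
    unfolding Sm_def SM_def using zc(1,2) by (auto intro!: cINF_greatest cSUP_least simp: less_imp_le)
  have less: "\<phi>\<^sub>m < \<phi>\<^sub>M" using zc(1,2)[of 0] by linarith
  have cont: "continuous_on S (\<lambda>x. f x \<psi>)" for S \<psi>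
    using bounds(3)[of 0] by (intro continuous_at_imp_continuous_on ballI) (auto intro: DERIV_isCont)
  \<comment> \<open>The sign at the left end persists up to the zero curve: otherwise the
    intermediate value theorem would give a second zero.\<close>
  have pos: "0 < f \<phi> \<psi>" if hyp: "\<phi>\<^sub>m \<le> \<phi>" "\<phi> < ?zc \<psi>" for \<phi> \<psi>
  proof (rule ccontr)
    assume "\<not> 0 < f \<phi> \<psi>"
    then obtain s where s: "\<phi>\<^sub>m \<le> s" "s \<le> \<phi>" "f s \<psi> = 0"
      using IVT2'[of "\<lambda>x. f x \<psi>" \<phi> 0 \<phi>\<^sub>m] ends cont hyp by (auto simp: not_less less_imp_le)
    then have "s \<noteq> \<phi>\<^sub>m" using ends by (metis less_irrefl)
    then have "?zc \<psi> = s" using s hyp zc(2)[of \<psi>] by (intro zc(4)) auto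
    then show False using s hyp by simp
  qed
  have neg: "f \<phi> \<psi> < 0" if hyp: "?zc \<psi> < \<phi>" "\<phi> \<le> \<phi>\<^sub>M" for \<phi> \<psi>
  proof (rule ccontr)
    assume "\<not> f \<phi> \<psi> < 0"
    then obtain s where s: "\<phi> \<le> s" "s \<le> \<phi>\<^sub>M" "f s \<psi> = 0"
      using IVT2'[of "\<lambda>x. f x \<psi>" \<phi>\<^sub>M 0 \<phi>] ends cont hyp by (auto simp: not_less less_imp_le)
    then have "s \<noteq> \<phi>\<^sub>M" using ends by (metis less_irrefl)
    then have "?zc \<psi> = s" using s hyp zc(1)[of \<psi>] by (intro zc(4)) auto
    then show False using s hyp by simp
  qed
  have rate_le: "dphi f \<phi> \<psi> \<le> - contraction_rate f \<phi>\<^sub>m \<phi>\<^sub>M" if "Sm \<le> \<phi>" "\<phi> \<le> SM" for \<phi> \<psi>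
  proof -
    have "bdd_above ((\<lambda>(\<phi>, \<psi>). dphi f \<phi> \<psi>) ` Lambda f \<phi>\<^sub>m \<phi>\<^sub>M)"
      using bounds(1)[of 1] by (intro bdd_aboveI[of _ 1]) (auto simp: abs_le_iff)
    moreover have "(\<phi>, \<psi>) \<in> Lambda f \<phi>\<^sub>m \<phi>\<^sub>M"
      using that by (simp add: Lambda_def Sm_def SM_def)
    ultimately show ?thesis
      unfolding contraction_rate_def using cSUP_upper[of "(\<phi>, \<psi>)" _ "\<lambda>(\<phi>, \<psi>). dphi f \<phi> \<psi>"] by simp
  qed
  have rate1: "contraction_rate f \<phi>\<^sub>m \<phi>\<^sub>M \<le> 1"
    using rate_le[of 0 0] S0 bounds(1)[of 1 0 0] by (auto simp: abs_le_iff)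
  show ?thesis
  proof unfold_locales
    show "((\<lambda>x. f x \<psi>) has_real_derivative dphi f \<phi> \<psi>) (at \<phi>)"
      "((\<lambda>x. dphi f x \<psi>) has_real_derivative (dphi ^^ 2) f \<phi> \<psi>) (at \<phi>)"
      "((\<lambda>x. (dphi ^^ 2) f x \<psi>) has_real_derivative (dphi ^^ 3) f \<phi> \<psi>) (at \<phi>)" for \<phi> \<psi>
      using bounds(3)[of 0] bounds(3)[of 1] bounds(3)[of 2] by (simp_all add: numeral_2_eq_2 numeral_3_eq_3)
    show "\<bar>f \<phi> \<psi>\<bar> \<le> 1" "\<bar>dphi f \<phi> \<psi>\<bar> \<le> 1" "\<bar>(dphi ^^ 2) f \<phi> \<psi>\<bar> \<le> 1" "\<bar>(dphi ^^ 3) f \<phi> \<psi>\<bar> \<le> 1" for \<phi> \<psi>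
      using bounds(1)[of 0] bounds(1)[of 1] bounds(1)[of 2] bounds(1)[of 3] by simp_all
    show "1 \<le> 1 / \<alpha>" using \<alpha> by simp
    show "mix.holder_const (1 / \<alpha>) (f \<phi>)" "mix.holder_const (1 / \<alpha>) (dphi f \<phi>)"
      "mix.holder_const (1 / \<alpha>) ((dphi ^^ 2) f \<phi>)" for \<phi>
      unfolding mix.holder_const_def using bounds(2)[of 0] bounds(2)[of 1] bounds(2)[of 2] by simp_all
    show "torus_periodic (f \<phi>)" "torus_periodic (dphi f \<phi>)" for \<phi>
      using bounds(4)[of 0] bounds(4)[of 1] by simp_all
    show "0 < f \<phi> \<psi>" if "\<phi>\<^sub>m \<le> \<phi>" "\<phi> < Sm" for \<phi> \<psi>
      using pos[OF that(1), of \<psi>] that(2) Sm[of \<psi>] by linarith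
    show "f \<phi> \<psi> < 0" if "SM < \<phi>" "\<phi> \<le> \<phi>\<^sub>M" for \<phi> \<psi>
      using neg[OF _ that(2), of \<psi>] that(1) SM[of \<psi>] by linarith
    \<comment> \<open>For a given fast point the infimum either is the zero itself or lies strictly
      to its left.\<close>
    show "0 \<le> f Sm \<psi>" for \<psi>
      using pos[OF edge(1), of \<psi>] Sm[of \<psi>] zc(3)[of \<psi>] by (cases "Sm = ?zc \<psi>") auto
    show "f SM \<psi> \<le> 0" for \<psi>
      using neg[OF _ edge(2), of \<psi>] SM[of \<psi>] zc(3)[of \<psi>] by (cases "SM = ?zc \<psi>") auto
    have "0 \<in> {\<phi>\<^sub>m..\<phi>\<^sub>M}" using S0 edge by auto
    then have "fbar f 0 = 0" using mean by blast
    then show "torus_mean (f 0) = 0" by (simp add: fbar_def)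
  qed (use rate rate1 rate_le edge S0 in auto)
qed

theorem theorem6:
  fixes f :: "real \<Rightarrow> real^2 \<Rightarrow> real" and A :: "real^2^2" and \<alpha> \<phi>\<^sub>m \<phi>\<^sub>M :: real
  assumes "anosov_automorphism A"
    and "0 < \<alpha>" and "\<alpha> \<le> 1"
    and "f \<in> B_space \<alpha> 6" and "B_norm \<alpha> 6 f = 1"
    and "\<phi>\<^sub>m < \<phi>\<^sub>M" and "\<phi>\<^sub>M < \<phi>\<^sub>m + 2 * pi"
    and "\<forall>\<psi>. f \<phi>\<^sub>m \<psi> > 0 \<and> 0 > f \<phi>\<^sub>M \<psi>"
    and "\<forall>\<psi>. \<exists>!s. s \<in> {\<phi>\<^sub>m<..<\<phi>\<^sub>M} \<and> f s \<psi> = 0"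
    and "contraction_rate f \<phi>\<^sub>m \<phi>\<^sub>M > 0"
    and "0 \<in> {(INF \<psi>. zero_curve f \<phi>\<^sub>m \<phi>\<^sub>M \<psi>)..(SUP \<psi>. zero_curve f \<phi>\<^sub>m \<phi>\<^sub>M \<psi>)}"
    and "\<forall>\<phi>\<in>{\<phi>\<^sub>m..\<phi>\<^sub>M}. fbar f \<phi> = 0 \<longleftrightarrow> \<phi> = 0"
  shows "\<exists>\<rho>\<^sub>0>0.
    (\<forall>\<rho>\<in>{0<..<\<rho>\<^sub>0}. (\<forall>\<phi>\<in>{\<phi>\<^sub>m..\<phi>\<^sub>M}. \<forall>\<psi>. 1 + \<rho> * dphi f \<phi> \<psi> > 0) \<and>
                   (\<exists>!W. is_invariant_graph f A \<phi>\<^sub>m \<phi>\<^sub>M \<rho> W)) \<and>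
    (\<forall>\<gamma>'\<in>{0<..<contraction_rate f \<phi>\<^sub>m \<phi>\<^sub>M}. \<exists>C::real. \<forall>\<rho>\<in>{0<..<\<rho>\<^sub>0}. \<forall>n::nat. \<forall>\<phi>\<in>{\<phi>\<^sub>m..\<phi>\<^sub>M}.
       \<bar>torus_mean (\<lambda>\<psi>. deviation f A \<phi>\<^sub>m \<phi>\<^sub>M \<rho> n \<phi> \<psi>)\<bar> \<le> C * \<rho> * (1 - \<rho> * \<gamma>') ^ n \<and>
       torus_mean (\<lambda>\<psi>. (deviation f A \<phi>\<^sub>m \<phi>\<^sub>M \<rho> n \<phi> \<psi>)\<^sup>2) \<le> C * \<rho> * (1 - \<rho> * \<gamma>') ^ (2 * n))"
proof -
  obtain B \<mu> \<nu> r z \<zeta> w where split: "toral_splitting A B \<mu> \<nu> r z \<zeta> w"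
    using anosov_splitting[OF assms(1)] .
  define Sm where "Sm = (INF \<psi>. zero_curve f \<phi>\<^sub>m \<phi>\<^sub>M \<psi>)"
  define SM where "SM = (SUP \<psi>. zero_curve f \<phi>\<^sub>m \<phi>\<^sub>M \<psi>)"
  interpret drift A B \<mu> \<nu> r z \<zeta> w \<alpha> "\<bar>\<mu>\<bar> powr (- \<alpha> / 4)" f "dphi f" "(dphi ^^ 2) f" "(dphi ^^ 3) f"
    "1 / \<alpha>" "contraction_rate f \<phi>\<^sub>m \<phi>\<^sub>M" \<phi>\<^sub>m \<phi>\<^sub>M Sm SM
    unfolding Sm_def SM_def by (rule drift_instance) (use split assms in auto)
  have graph_iff: "is_invariant_graph f A \<phi>\<^sub>m \<phi>\<^sub>M \<rho> W \<longleftrightarrow> torus_periodic W \<and>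
      (\<forall>\<psi>. Sm \<le> W \<psi> \<and> W \<psi> \<le> SM) \<and> (\<forall>\<psi>. W (A *v \<psi>) = W \<psi> + \<rho> * f (W \<psi>) \<psi>)" for \<rho> W
    by (auto simp: is_invariant_graph_def Lambda_def Smap_def Sm_def SM_def)
  \<comment> \<open>\<open>slow_manifold\<close> carries the regularity, and uniqueness holds among
    all periodic invariant graphs in the strip; together they identify the graph named by the
    description operator with the regular one.\<close>
  have unique: "\<exists>W. slow_manifold \<rho> W \<and> is_invariant_graph f A \<phi>\<^sub>m \<phi>\<^sub>M \<rho> W \<and>
      (\<forall>V. is_invariant_graph f A \<phi>\<^sub>m \<phi>\<^sub>M \<rho> V \<longrightarrow> V = W)" if \<rho>: "0 < \<rho>" "\<rho> < \<rho>_max" for \<rho>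
  proof -
    obtain W where W: "slow_manifold \<rho> W" using slow_manifold_exists[OF \<rho>] .
    then have graph: "is_invariant_graph f A \<phi>\<^sub>m \<phi>\<^sub>M \<rho> W"
      by (simp add: graph_iff slow_manifold_def torus_continuous_def)
    have "V = W" if "is_invariant_graph f A \<phi>\<^sub>m \<phi>\<^sub>M \<rho> V" for V
      by (rule slow_manifold_unique[of \<rho>]) (use \<rho> \<rho>_max_le that graph in \<open>auto simp: graph_iff\<close>)
    then show ?thesis using W graph by blast
  qed
  have iter: "(Smap f A \<rho> ^^ n) (\<phi>, \<psi>) = (orbit \<rho> \<phi> n \<psi>, Ait n \<psi>)"
      "fst ((Smap_bar f A \<rho> ^^ n) (\<phi>, \<psi>)) = mean_orbit \<rho> \<phi> n" for \<rho> n \<phi> \<psi>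
    by (induction n) (simp_all add: Smap_def Smap_bar_def fbar_def case_prod_unfold)
  have dev: "deviation f A \<phi>\<^sub>m \<phi>\<^sub>M \<rho> n \<phi> \<psi> = orbit \<rho> \<phi> n \<psi> - (mean_orbit \<rho> \<phi> n + W (Ait n \<psi>))"
    if "is_invariant_graph f A \<phi>\<^sub>m \<phi>\<^sub>M \<rho> W" "\<forall>V. is_invariant_graph f A \<phi>\<^sub>m \<phi>\<^sub>M \<rho> V \<longrightarrow> V = W" for \<rho> W n \<phi> \<psi>
  proof -
    have "invariant_graph f A \<phi>\<^sub>m \<phi>\<^sub>M \<rho> = W"
      unfolding invariant_graph_def using that by blast
    then show ?thesis by (simp add: deviation_def iter)
  qed
  show ?thesis
  \<comment> \<open>The threshold depends only on the automorphism and \<alpha>, so it can be named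
    before \<gamma>', as the order of the quantifiers requires.\<close>
  proof (rule exI[of _ \<rho>_max], intro conjI ballI allI)
    show "0 < \<rho>_max" by (rule \<rho>_max_pos)
  next
    fix \<rho> \<phi> \<psi> assume \<rho>: "\<rho> \<in> {0<..<\<rho>_max}"
    have "\<bar>\<rho> * dphi f \<phi> \<psi>\<bar> \<le> \<rho> * 1"
      unfolding abs_mult using \<rho> f1_le[of \<phi> \<psi>] by (intro mult_mono) auto
    then show "1 + \<rho> * dphi f \<phi> \<psi> > 0" using \<rho> \<rho>_max_le by auto
  next
    fix \<rho> assume "\<rho> \<in> {0<..<\<rho>_max}"
    then show "\<exists>!W. is_invariant_graph f A \<phi>\<^sub>m \<phi>\<^sub>M \<rho> W" using unique[of \<rho>] by auto
  next
    fix \<gamma>' assume "\<gamma>' \<in> {0<..<contraction_rate f \<phi>\<^sub>m \<phi>\<^sub>M}"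
    then obtain C where C: "\<And>\<rho> \<phi> W n. 0 < \<rho> \<Longrightarrow> \<rho> < \<rho>_max \<Longrightarrow> \<phi>\<^sub>m \<le> \<phi> \<Longrightarrow> \<phi> \<le> \<phi>\<^sub>M \<Longrightarrow> slow_manifold \<rho> W \<Longrightarrow>
      \<bar>torus_mean (\<lambda>\<psi>. orbit \<rho> \<phi> n \<psi> - (mean_orbit \<rho> \<phi> n + W (Ait n \<psi>)))\<bar> \<le> C * \<rho> * (1 - \<rho> * \<gamma>') ^ n \<and>
      torus_mean (\<lambda>\<psi>. (orbit \<rho> \<phi> n \<psi> - (mean_orbit \<rho> \<phi> n + W (Ait n \<psi>)))\<^sup>2) \<le> C * \<rho> * (1 - \<rho> * \<gamma>') ^ (2 * n)"
      using averaging_estimate[of \<gamma>'] by auto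
    show "\<exists>C. \<forall>\<rho>\<in>{0<..<\<rho>_max}. \<forall>n. \<forall>\<phi>\<in>{\<phi>\<^sub>m..\<phi>\<^sub>M}.
       \<bar>torus_mean (\<lambda>\<psi>. deviation f A \<phi>\<^sub>m \<phi>\<^sub>M \<rho> n \<phi> \<psi>)\<bar> \<le> C * \<rho> * (1 - \<rho> * \<gamma>') ^ n \<and>
       torus_mean (\<lambda>\<psi>. (deviation f A \<phi>\<^sub>m \<phi>\<^sub>M \<rho> n \<phi> \<psi>)\<^sup>2) \<le> C * \<rho> * (1 - \<rho> * \<gamma>') ^ (2 * n)"
    proof (rule exI[of _ C], intro ballI allI)
      fix \<rho> n \<phi> assume "\<rho> \<in> {0<..<\<rho>_max}" and \<phi>: "\<phi> \<in> {\<phi>\<^sub>m..\<phi>\<^sub>M}"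
      then have \<rho>: "0 < \<rho>" "\<rho> < \<rho>_max" by auto
      obtain W where W: "slow_manifold \<rho> W" "is_invariant_graph f A \<phi>\<^sub>m \<phi>\<^sub>M \<rho> W"
        "\<forall>V. is_invariant_graph f A \<phi>\<^sub>m \<phi>\<^sub>M \<rho> V \<longrightarrow> V = W"
        using unique[OF \<rho>] by blast
      show "\<bar>torus_mean (\<lambda>\<psi>. deviation f A \<phi>\<^sub>m \<phi>\<^sub>M \<rho> n \<phi> \<psi>)\<bar> \<le> C * \<rho> * (1 - \<rho> * \<gamma>') ^ n \<and>
        torus_mean (\<lambda>\<psi>. (deviation f A \<phi>\<^sub>m \<phi>\<^sub>M \<rho> n \<phi> \<psi>)\<^sup>2) \<le> C * \<rho> * (1 - \<rho> * \<gamma>') ^ (2 * n)"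
        unfolding dev[OF W(2,3)] using C[OF \<rho> _ _ W(1)] \<phi> by simp
    qed
  qed
qed

end
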